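(* Let $\{\mathcal F,\mathcal G\}$ be a Hilbert C*-system with fixed point algebra $\mathcal A$. Then for each $F\in\mathcal F$ we have $$F=\sum_{D\in\widehat{\mathcal G}}\Pi_DF,$$ where the sum on the right-hand side is convergent with respect to the $\mathcal A$-norm $|\cdot|_{\mathcal A}$, and we have Parseval's equation $$\langle F,F\rangle_{\mathcal A}=\sum_{D\in\widehat{\mathcal G}}\langle\Pi_DF,\Pi_DF\rangle_{\mathcal A}.$$
   Context: C*-algebras are unital. An algebraic Hilbert space in $\mathcal F$ is a finite-dimensional subspace $\mathcal H\subset\mathcal F$ with $A^*B\in\mathbb C\mathbf 1$ for $A,B\in\mathcal H$, scalar product $\langle A,B\rangle\mathbf 1=A^*B$, always assumed to have support $\sum_j\Phi_j\Phi_j^*=\mathbf 1$ ($\{\Phi_j\}$ an orthonormal basis). For a compact group $\mathcal G$ acting on $\mathcal F$ by a pointwise norm-continuous homomorphism $\alpha:\mathcal G\to\mathrm{Aut}\,\mathcal F$ and $D\in\widehat{\mathcal G}$ (classes of irreducible unitary representations) put $\Pi_D(F)=\int_{\mathcal G}\overline{\chi_D(g)}\,\alpha_g(F)\,dg$, $\chi_D(g)=\dim D\cdot\mathrm{Tr}\,\pi(g)$, $\pi\in D$, $dg$ normalized Haar measure. The system is a Hilbert C*-system if for each $D$ there is an $\alpha_{\mathcal G}$-invariant algebraic Hilbert space $\mathcal H_D\subset\Pi_D\mathcal F$ carrying a representation of class $D$. One identifies $\mathcal G$ with $\alpha_{\mathcal G}$ and writes $\{\mathcal F,\mathcal G\}$.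 $\mathcal A=\Pi_\iota\mathcal F$ is the fixed point algebra, $\iota$ the trivial representation. The $\mathcal A$-valued scalar product on $\mathcal F$ is $\langle F,G\rangle_{\mathcal A}:=\Pi_\iota(FG^* )$, and the $\mathcal A$-norm is $|F|_{\mathcal A}:=\|\langle F,F\rangle_{\mathcal A}\|^{1/2}$. Sums over $\widehat{\mathcal G}$ are limits of the nets of partial sums over finite subsets of $\widehat{\mathcal G}$; the sum in Parseval's equation is taken in the C*-norm of $\mathcal A$. *)

theory Defs
  imports "HOL-Analysis.Analysis" "Jordan_Normal_Form.Schur_Decomposition"
begin

section \<open>Unital C*-algebras\<close>

class cstar_algebra = banach + real_normed_algebra_1 +
  fixes scaleC :: "complex \<Rightarrow> 'a \<Rightarrow> 'a"  (infixr "*\<^sub>C" 75)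
    and star :: "'a \<Rightarrow> 'a"
  assumes scaleC_add_right: "c *\<^sub>C (x + y) = c *\<^sub>C x + c *\<^sub>C y"
    and scaleC_add_left: "(c + d) *\<^sub>C x = c *\<^sub>C x + d *\<^sub>C x"
    and scaleC_scaleC: "c *\<^sub>C d *\<^sub>C x = (c * d) *\<^sub>C x"
    and scaleC_of_real: "complex_of_real r *\<^sub>C x = r *\<^sub>R x"
    and norm_scaleC: "norm (c *\<^sub>C x) = cmod c * norm x"
    and mult_scaleC_left: "(c *\<^sub>C x) * y = c *\<^sub>C (x * y)"
    and mult_scaleC_right: "x * (c *\<^sub>C y) = c *\<^sub>C (x * y)"
    and star_star: "star (star x) = x"
    and star_add: "star (x + y) = star x + star y"
    and star_scaleC: "star (c *\<^sub>C x) = cnj c *\<^sub>C star x"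
    and star_mult: "star (x * y) = star y * star x"
    and norm_star_mult_self: "norm (star x * x) = (norm x)\<^sup>2"

interpretation complex_vector: vector_space "scaleC :: complex \<Rightarrow> 'a \<Rightarrow> 'a::cstar_algebra"
proof
  fix x :: 'a
  show "1 *\<^sub>C x = x"
    using scaleC_of_real[of 1 x] by simp
qed (simp_all add: scaleC_add_right scaleC_add_left scaleC_scaleC)

definition star_automorphism :: "('f::cstar_algebra \<Rightarrow> 'f) \<Rightarrow> bool" where
  "star_automorphism \<phi> \<longleftrightarrow> bij \<phi> \<and>
     (\<forall>x y. \<phi> (x + y) = \<phi> x + \<phi> y) \<and> (\<forall>c x. \<phi> (c *\<^sub>C x) = c *\<^sub>C \<phi> x) \<and>
     (\<forall>x y. \<phi> (x * y) = \<phi> x * \<phi> y) \<and> (\<forall>x. \<phi> (star x) = star (\<phi> x))"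

section \<open>Algebraic Hilbert spaces\<close>

definition orthonormal_basis :: "'f::cstar_algebra set \<Rightarrow> nat \<Rightarrow> (nat \<Rightarrow> 'f) \<Rightarrow> bool" where
  "orthonormal_basis H d \<Phi> \<longleftrightarrow> complex_vector.span (\<Phi> ` {..<d}) = H \<and>
     (\<forall>i<d. \<forall>j<d. star (\<Phi> i) * \<Phi> j = (if i = j then 1 else 0))"

text \<open>The sum \<open>\<Sum>\<^sub>j \<Phi>\<^sub>j \<Phi>\<^sub>j\<^sup>*\<close> is the same for all orthonormal bases, so the support condition
  is imposed on one of them.\<close>

definition algebraic_hilbert_space :: "'f::cstar_algebra set \<Rightarrow> bool" where
  "algebraic_hilbert_space H \<longleftrightarrow>
     complex_vector.subspace H \<and> (\<exists>B. finite B \<and> H = complex_vector.span B) \<and>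
     (\<forall>A\<in>H. \<forall>B\<in>H. \<exists>c. star A * B = c *\<^sub>C 1) \<and>
     (\<exists>d \<Phi>. orthonormal_basis H d \<Phi> \<and> (\<Sum>j<d. \<Phi> j * star (\<Phi> j)) = 1)"

section \<open>Haar measure and integration\<close>

text \<open>Groups are written additively, as in the class \<^class>\<open>topological_group_add\<close>, which does
  not assume commutativity.\<close>

definition normalized_haar_measure :: "'g::{topological_group_add, t2_space} measure \<Rightarrow> bool" where
  "normalized_haar_measure \<mu> \<longleftrightarrow>
     sets \<mu> = sets borel \<and> emeasure \<mu> UNIV = 1 \<and>
     (\<forall>g. \<forall>A\<in>sets borel. emeasure \<mu> ((+) g ` A) = emeasure \<mu> A) \<and>
     (\<forall>A\<in>sets borel. emeasure \<mu> A = (INF U\<in>{U. open U \<and> A \<subseteq> U}. emeasure \<mu> U)) \<and>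
     (\<forall>U. open U \<longrightarrow> emeasure \<mu> U = (SUP K\<in>{K. compact K \<and> K \<subseteq> U}. emeasure \<mu> K))"

text \<open>The following two definitions are those of \<^const>\<open>has_bochner_integral\<close> and
  \<^const>\<open>lebesgue_integral\<close>, except that the value space is not required to be second countable
  (C*-algebras are usually not separable).\<close>

inductive has_vector_integral :: "'g measure \<Rightarrow> ('g \<Rightarrow> 'b) \<Rightarrow> 'b::real_normed_vector \<Rightarrow> bool"
  for M f x where
  "f \<in> borel_measurable M \<Longrightarrow>
    (\<And>i. Bochner_Integration.simple_bochner_integrable M (s i)) \<Longrightarrow>
    (\<lambda>i. \<integral>\<^sup>+x. norm (f x - s i x) \<partial>M) \<longlonglongrightarrow> 0 \<Longrightarrow>
    (\<lambda>i. Bochner_Integration.simple_bochner_integral M (s i)) \<longlonglongrightarrow> x \<Longrightarrow>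
    has_vector_integral M f x"

definition vector_integral :: "'g measure \<Rightarrow> ('g \<Rightarrow> 'b) \<Rightarrow> 'b::real_normed_vector" where
  "vector_integral M f =
     (if \<exists>x. has_vector_integral M f x then THE x. has_vector_integral M f x else 0)"

section \<open>The dual of a compact group\<close>

text \<open>Irreducible unitary representations of a compact group are finite-dimensional; up to unitary
  equivalence they act by unitary matrices on \<open>\<complex>\<^sup>n\<close> with the standard scalar product.
  For matrices, strong continuity is continuity of the entries.\<close>

definition unitary_mat :: "nat \<Rightarrow> complex mat \<Rightarrow> bool" where
  "unitary_mat n U \<longleftrightarrow>
     U \<in> carrier_mat n n \<and> mat_adjoint U * U = 1\<^sub>m n \<and> U * mat_adjoint U = 1\<^sub>m n"

definition unitary_rep :: "nat \<Rightarrow> ('g::topological_group_add \<Rightarrow> complex mat) \<Rightarrow> bool" where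
  "unitary_rep n \<pi> \<longleftrightarrow> (\<forall>g. unitary_mat n (\<pi> g)) \<and> (\<forall>g h. \<pi> (g + h) = \<pi> g * \<pi> h) \<and>
     (\<forall>i<n. \<forall>j<n. continuous_on UNIV (\<lambda>g. \<pi> g $$ (i, j)))"

definition irreducible_unitary_rep :: "nat \<Rightarrow> ('g::topological_group_add \<Rightarrow> complex mat) \<Rightarrow> bool" where
  "irreducible_unitary_rep n \<pi> \<longleftrightarrow> 0 < n \<and> unitary_rep n \<pi> \<and>
     (\<forall>W. VectorSpace.subspace class_ring W (module_vec TYPE(complex) n) \<and>
          (\<forall>g. \<forall>w\<in>W. \<pi> g *\<^sub>v w \<in> W) \<longrightarrow> W = {0\<^sub>v n} \<or> W = carrier_vec n)"

definition rep_dim :: "('g::topological_group_add \<Rightarrow> complex mat) \<Rightarrow> nat" where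
  "rep_dim \<pi> = dim_row (\<pi> 0)"

definition irreps :: "('g::topological_group_add \<Rightarrow> complex mat) set" where
  "irreps = {\<pi>. \<exists>n. irreducible_unitary_rep n \<pi>}"

definition rep_equiv ::
    "(('g::topological_group_add \<Rightarrow> complex mat) \<times> ('g \<Rightarrow> complex mat)) set" where
  "rep_equiv = {(\<pi>, \<rho>). \<pi> \<in> irreps \<and> \<rho> \<in> irreps \<and> rep_dim \<pi> = rep_dim \<rho> \<and>
     (\<exists>U. unitary_mat (rep_dim \<pi>) U \<and> (\<forall>g. U * \<pi> g = \<rho> g * U))}"

definition dual :: "('g::topological_group_add \<Rightarrow> complex mat) set set" where
  "dual = irreps // rep_equiv"

definition trivial_class :: "('g::topological_group_add \<Rightarrow> complex mat) set" where
  "trivial_class = rep_equiv `` {\<lambda>_. 1\<^sub>m 1}"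

text \<open>\<open>\<chi>\<^sub>D(g) = dim D \<sqdot> Tr \<pi>(g)\<close>, where \<open>\<pi> \<in> D\<close> is arbitrary: the value depends only on the class.
  Note the factor \<open>dim D\<close>, which makes \<open>spectral_proj\<close> below idempotent.\<close>

definition char_class :: "('g::topological_group_add \<Rightarrow> complex mat) set \<Rightarrow> 'g \<Rightarrow> complex" where
  "char_class D g = (let \<pi> = (SOME \<pi>. \<pi> \<in> D) in
     of_nat (rep_dim \<pi>) * (\<Sum>i<rep_dim \<pi>. \<pi> g $$ (i, i)))"

section \<open>Hilbert C*-systems\<close>

definition spectral_proj ::
    "'g::topological_group_add measure \<Rightarrow> ('g \<Rightarrow> 'f \<Rightarrow> 'f) \<Rightarrow> ('g \<Rightarrow> complex mat) set \<Rightarrow> 'f \<Rightarrow> 'f::cstar_algebra"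
  where
  "spectral_proj \<mu> \<alpha> D F = vector_integral \<mu> (\<lambda>g. cnj (char_class D g) *\<^sub>C \<alpha> g F)"

definition carries_rep_of_class ::
    "('g::topological_group_add \<Rightarrow> 'f \<Rightarrow> 'f) \<Rightarrow> 'f::cstar_algebra set \<Rightarrow> ('g \<Rightarrow> complex mat) set \<Rightarrow> bool"
  where
  "carries_rep_of_class \<alpha> H D \<longleftrightarrow>
     (\<exists>\<Phi>. \<exists>\<pi>\<in>D. orthonormal_basis H (rep_dim \<pi>) \<Phi> \<and>
        (\<forall>g. \<forall>j<rep_dim \<pi>. \<alpha> g (\<Phi> j) = (\<Sum>i<rep_dim \<pi>. (\<pi> g $$ (i, j)) *\<^sub>C \<Phi> i)))"

locale hilbert_cstar_system =
  fixes \<mu> :: "'g::{topological_group_add, t2_space} measure"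
    and \<alpha> :: "'g \<Rightarrow> 'f \<Rightarrow> 'f::cstar_algebra"
  assumes compact_group: "compact (UNIV :: 'g set)"
    and haar: "normalized_haar_measure \<mu>"
    and automorphism: "star_automorphism (\<alpha> g)"
    and hom: "\<alpha> (g + h) = \<alpha> g \<circ> \<alpha> h"
    and pointwise_continuous: "continuous_on UNIV (\<lambda>g. \<alpha> g F)"
    and hilbert_space_exists:
      "D \<in> dual \<Longrightarrow> \<exists>H. algebraic_hilbert_space H \<and> (\<forall>g. \<alpha> g ` H \<subseteq> H) \<and>
         H \<subseteq> range (spectral_proj \<mu> \<alpha> D) \<and> carries_rep_of_class \<alpha> H D"

text \<open>The fixed point algebra is \<open>\<A> = range (spectral_proj \<mu> \<alpha> trivial_class)\<close>, with the norm of
  the ambient algebra; \<open>A_inner\<close> takes its values there.\<close>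

definition A_inner ::
    "'g::topological_group_add measure \<Rightarrow> ('g \<Rightarrow> 'f \<Rightarrow> 'f) \<Rightarrow> 'f \<Rightarrow> 'f \<Rightarrow> 'f::cstar_algebra" where
  "A_inner \<mu> \<alpha> F G = spectral_proj \<mu> \<alpha> trivial_class (F * star G)"

definition A_norm ::
    "'g::topological_group_add measure \<Rightarrow> ('g \<Rightarrow> 'f \<Rightarrow> 'f) \<Rightarrow> 'f::cstar_algebra \<Rightarrow> real" where
  "A_norm \<mu> \<alpha> F = sqrt (norm (A_inner \<mu> \<alpha> F F))"

end

theory Submission
  imports Defs "Jordan_Normal_Form.Spectral_Radius"
begin

text \<open>The projections \<open>\<Pi>\<^sub>D\<close> are orthogonal and self-adjoint for the \<open>\<A>\<close>-valued scalar product, because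
  the characters are orthogonal idempotents under convolution. Hence \<open>\<langle>F, F\<rangle>\<close> is the sum of
  \<open>\<langle>F - \<Pi>\<^sub>S F, F - \<Pi>\<^sub>S F\<rangle>\<close> and \<open>\<langle>\<Pi>\<^sub>S F, \<Pi>\<^sub>S F\<rangle>\<close> for every finite \<open>S\<close>. Both summands are positive, so that
  \<open>1 - \<Pi>\<^sub>S\<close> contracts the \<open>\<A>\<close>-norm uniformly in \<open>S\<close>, and it suffices to approximate \<open>F\<close> in norm by elements
  with finitely many spectral components. Such elements arise by averaging \<open>\<alpha>\<^sub>g F\<close> against a bump function,
  approximated in \<open>L\<^sup>2\<close> by coefficients of irreducible representations (Peter-Weyl).

  The Peter-Weyl theorem is proved without compact operators: if \<open>u = u\<^sup>*\<close> is orthogonal to all characters,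
  then its suitably scaled even convolution powers converge uniformly to a self-adjoint idempotent with
  the same property; its range is finite-dimensional and translation invariant, so it contains the
  coefficients of an irreducible representation.\<close>

section \<open>C*-algebras: positivity\<close>

text \<open>In the C*-norm the partial sums need not be uniformly bounded, as Fourier series of
  continuous functions show; it is the order behind the \<open>A\<close>-norm that yields a
  contraction. This order is extracted from the C*-identity: positivity is expressed by norm
  inequalities, and square roots and norms of powers take the place of spectral theory. On the group
  side every function stays continuous. Convolution with a continuous function turns
  \<open>L^2\<close>-Cauchy sequences into uniformly Cauchy ones, so limits are continuous again and
  the pre-Hilbert space is never completed. Two obstacles remain: the algebra may be nonseparable,
  and Borel sets of a product group need not be generated by rectangles. Both disappear because a
  continuous function on a compact space is uniformly close to its composite with a finite-valued
  rounding, so the basic rules for the integral follow from rules for finite sums.\<close>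

lemma star_zero [simp]: "star 0 = (0 :: 'a::cstar_algebra)"
proof -
  have "star (0 :: 'a) = star 0 + star 0"
    using star_add[of "0 :: 'a" 0] by simp
  then show ?thesis
    by simp
qed

lemma star_minus: "star (- x) = - star (x :: 'a::cstar_algebra)"
  using star_add[of x "- x"] by (simp add: eq_neg_iff_add_eq_0 add.commute)

lemma star_diff: "star (x - y) = star x - star (y :: 'a::cstar_algebra)"
  using star_add[of x "- y"] by (simp add: star_minus)

lemma star_scaleR: "star (r *\<^sub>R x) = r *\<^sub>R star (x :: 'a::cstar_algebra)"
  using star_scaleC[of "complex_of_real r" x] by (simp add: scaleC_of_real)

lemma star_one [simp]: "star 1 = (1 :: 'a::cstar_algebra)"
  by (metis mult_1_right star_mult star_star)

lemma star_of_real [simp]: "star (of_real r) = (of_real r :: 'a::cstar_algebra)"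
  by (simp add: of_real_def star_scaleR)

lemma star_power: "star (x ^ n) = star (x :: 'a::cstar_algebra) ^ n"
  by (induction n) (simp_all add: star_mult power_commutes)

lemma norm_star [simp]: "norm (star x) = norm (x :: 'a::cstar_algebra)"
proof -
  have *: "norm x \<le> norm (star x)" for x :: 'a
  proof (cases "x = 0")
    case False
    have "norm x * norm x \<le> norm (star x) * norm x"
      using norm_mult_ineq[of "star x" x] norm_star_mult_self[of x] by (simp add: power2_eq_square)
    then show ?thesis
      using False by simp
  qed simp
  show ?thesis
    using *[of x] *[of "star x"] by (simp add: star_star)
qed

lemma norm_mult_star_self: "norm (x * star x) = (norm (x :: 'a::cstar_algebra))\<^sup>2"
  using norm_star_mult_self[of "star x"] by (simp add: star_star)

lemma bounded_linear_star: "bounded_linear (star :: 'a::cstar_algebra \<Rightarrow> 'a)"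
  by (rule bounded_linear_intro[of _ 1]) (simp_all add: star_add star_scaleR)

lemma bounded_bilinear_scaleC: "bounded_bilinear (scaleC :: complex \<Rightarrow> 'a::cstar_algebra \<Rightarrow> 'a)"
proof
  show "(r *\<^sub>R a) *\<^sub>C b = r *\<^sub>R a *\<^sub>C b" for r a and b :: 'a
    by (simp add: scaleC_of_real[symmetric] scaleC_scaleC scaleR_conv_of_real[of r a])
  show "a *\<^sub>C (r *\<^sub>R b) = r *\<^sub>R a *\<^sub>C b" for r a and b :: 'a
    by (simp add: scaleC_of_real[symmetric] scaleC_scaleC mult.commute)
  show "\<exists>K. \<forall>a (b :: 'a). norm (a *\<^sub>C b) \<le> norm a * norm b * K"
    by (rule exI[of _ 1]) (simp add: norm_scaleC)
qed (simp_all add: scaleC_add_left scaleC_add_right)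

lemmas continuous_on_scaleC [continuous_intros] =
  bounded_bilinear.continuous_on[OF bounded_bilinear_scaleC]
lemmas continuous_on_star [continuous_intros] =
  bounded_linear.continuous_on[OF bounded_linear_star]

lemma scaleC_i_i [simp]: "\<i> *\<^sub>C \<i> *\<^sub>C x = - (x :: 'a::cstar_algebra)"
  using scaleC_of_real[of "-1" x] by (simp add: scaleC_scaleC)

subsection \<open>Square roots and the positive cone\<close>

text \<open>With \<open>y = 1 - s\<close>, the equation \<open>s\<^sup>2 = 1 - x\<close> reads \<open>y = (x + y\<^sup>2) / 2\<close>. The iterates are dominated
  by those of the scalar equation with \<open>x = 1\<close>, which increase to \<open>1\<close>.\<close>

primrec sqrt_iter :: "'a::real_normed_algebra_1 \<Rightarrow> nat \<Rightarrow> 'a" where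
  "sqrt_iter x 0 = 0"
| "sqrt_iter x (Suc n) = (x + sqrt_iter x n * sqrt_iter x n) /\<^sub>R 2"

lemma sqrt_iter_commute: "z * x = x * z \<Longrightarrow> z * sqrt_iter x n = sqrt_iter x n * z"
proof (induction n)
  case (Suc n)
  then have "z * (sqrt_iter x n * sqrt_iter x n) = sqrt_iter x n * sqrt_iter x n * z"
    by (metis mult.assoc)
  then show ?case
    using Suc.prems by (simp add: algebra_simps)
qed simp

lemma sqrt_iter_one_le: "0 \<le> sqrt_iter (1 :: real) n \<and> sqrt_iter (1 :: real) n \<le> 1"
proof (induction n)
  case (Suc n)
  then have "sqrt_iter (1 :: real) n * sqrt_iter 1 n \<le> 1"
    by (simp add: mult_le_one)
  then show ?case
    using Suc by simp
qed simp

text \<open>The iterates commute, so an increment factors as \<open>(y' - y) * (y' + y) / 2\<close>;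
  the scalar iterates obey the same recursion for their increments, and both bounds propagate
  together.\<close>

lemma sqrt_iter_bounds:
  fixes x :: "'a::real_normed_algebra_1"
  assumes x: "norm x \<le> 1"
  shows "norm (sqrt_iter x n) \<le> sqrt_iter 1 n \<and>
    norm (sqrt_iter x (Suc n) - sqrt_iter x n) \<le> sqrt_iter 1 (Suc n) - sqrt_iter (1 :: real) n"
proof (induction n)
  case (Suc n)
  define y y' where "y = sqrt_iter x n" and "y' = sqrt_iter x (Suc n)"
  define t t' :: real where "t = sqrt_iter 1 n" and "t' = sqrt_iter 1 (Suc n)"
  have IH: "norm y \<le> t" "norm (y' - y) \<le> t' - t"
    using Suc unfolding y_def y'_def t_def t'_def by blast+
  have y': "norm y' \<le> t'"
    using norm_triangle_sub[of y' y] IH by linarith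
  have "y' * y = y * y'"
    unfolding y_def y'_def by (intro sqrt_iter_commute sqrt_iter_commute[symmetric] refl)
  then have "(y' - y) * (y' + y) = y' * y' - y * y"
    by (simp add: algebra_simps)
  moreover have "sqrt_iter x (Suc (Suc n)) - y' = (y' * y' - y * y) /\<^sub>R 2"
    using sqrt_iter.simps(2)[of x "Suc n"] sqrt_iter.simps(2)[of x n]
    by (simp add: y_def[symmetric] y'_def[symmetric] scaleR_add_right scaleR_diff_right del: sqrt_iter.simps)
  ultimately have "norm (sqrt_iter x (Suc (Suc n)) - y') = norm ((y' - y) * (y' + y)) / 2"
    by simp
  also have "\<dots> \<le> (t' - t) * (t' + t) / 2"
  proof -
    have "norm (y' + y) \<le> t' + t" "0 \<le> t' - t"
      using norm_triangle_ineq[of y' y] IH y' norm_ge_zero[of "y' - y"] by linarith+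
    then have "norm (y' - y) * norm (y' + y) \<le> (t' - t) * (t' + t)"
      using IH by (intro mult_mono) simp_all
    then show ?thesis
      using norm_mult_ineq[of "y' - y" "y' + y"] by simp
  qed
  also have "\<dots> = sqrt_iter 1 (Suc (Suc n)) - t'"
    using sqrt_iter.simps(2)[of "1 :: real" "Suc n"] sqrt_iter.simps(2)[of "1 :: real" n]
    by (simp add: t_def[symmetric] t'_def[symmetric] field_simps del: sqrt_iter.simps)
  finally show ?case
    using y' by (simp add: y'_def t'_def del: sqrt_iter.simps)
qed (use x in simp)

text \<open>The bound on \<open>1 - s\<close> records that \<open>s\<close> is the positive root.
  The commutation clause holds because \<open>s\<close> is a limit of polynomials in
  \<open>x\<close>; it is what later lets two roots commute.\<close>

lemma exists_sqrt_one_minus: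
  fixes x :: "'a::cstar_algebra"
  assumes x: "norm x \<le> 1" and sx: "star x = x"
  obtains s where "star s = s" "s * s = 1 - x" "norm (1 - s) \<le> 1"
    "\<And>z. z * x = x * z \<Longrightarrow> z * s = s * z"
proof -
  let ?t = "sqrt_iter (1 :: real)" and ?y = "sqrt_iter x"
  have "incseq ?t"
    using sqrt_iter_bounds[of "1 :: real"] by (intro incseq_SucI) (smt (verit) norm_ge_zero norm_one)
  then obtain L where L: "?t \<longlonglongrightarrow> L"
    using incseq_convergent[of ?t 1] sqrt_iter_one_le by blast
  have diff: "norm (?y (n + k) - ?y n) \<le> ?t (n + k) - ?t n" for n k
  proof (induction k)
    case (Suc k)
    have "norm (?y (n + Suc k) - ?y n) \<le> norm (?y (Suc (n + k)) - ?y (n + k)) + norm (?y (n + k) - ?y n)"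
      using norm_triangle_ineq[of "?y (Suc (n + k)) - ?y (n + k)" "?y (n + k) - ?y n"] by simp
    then show ?case
      using sqrt_iter_bounds[OF x, of "n + k"] Suc by (simp del: sqrt_iter.simps)
  qed simp
  have "Cauchy ?y"
  proof (rule CauchyI)
    fix e :: real assume "0 < e"
    then obtain M where M: "\<And>m n. m \<ge> M \<Longrightarrow> n \<ge> M \<Longrightarrow> norm (?t m - ?t n) < e"
      using CauchyD[OF LIMSEQ_imp_Cauchy[OF L]] by blast
    have "norm (?y m - ?y n) < e" if "M \<le> m" "M \<le> n" for m n
    proof (cases m n rule: le_cases)
      case le
      then show ?thesis
        using diff[of m "n - m"] M[of n m] that by (simp add: norm_minus_commute)
    next
      case ge
      then show ?thesis
        using diff[of n "m - n"] M[of m n] that by simp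
    qed
    then show "\<exists>M. \<forall>m\<ge>M. \<forall>n\<ge>M. norm (?y m - ?y n) < e"
      by blast
  qed
  then obtain y where y: "?y \<longlonglongrightarrow> y"
    by (auto simp: Cauchy_convergent_iff convergent_def)
  have "(\<lambda>n. ?y (Suc n)) \<longlonglongrightarrow> (x + y * y) /\<^sub>R 2"
    unfolding sqrt_iter.simps by (intro tendsto_intros y)
  then have "y = (x + y * y) /\<^sub>R 2"
    using LIMSEQ_unique[OF LIMSEQ_Suc[OF y]] by blast
  then have "2 *\<^sub>R y = 2 *\<^sub>R ((x + y * y) /\<^sub>R 2)"
    by (rule arg_cong)
  then have "y + y = x + y * y"
    unfolding scaleR_2[of y] by simp
  then have yy: "y * y = y + y - x"
    by (simp add: algebra_simps)
  show ?thesis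
  proof (rule that[of "1 - y"])
    have "star (?y n) = ?y n" for n
      by (induction n) (simp_all add: star_scaleR star_add star_mult sx)
    then have "?y \<longlonglongrightarrow> star y"
      using bounded_linear.tendsto[OF bounded_linear_star y] by simp
    then have "star y = y"
      by (rule LIMSEQ_unique[OF _ y])
    then show "star (1 - y) = 1 - y"
      by (simp add: star_diff)
    show "(1 - y) * (1 - y) = 1 - x"
      using yy by (simp add: algebra_simps)
    have "norm (?y n) \<le> 1" for n
      using sqrt_iter_bounds[OF x, of n] sqrt_iter_one_le[of n] by linarith
    then show "norm (1 - (1 - y)) \<le> 1"
      using LIMSEQ_le_const2[OF tendsto_norm[OF y]] by auto
    show "z * (1 - y) = (1 - y) * z" if "z * x = x * z" for z
    proof -
      have "(\<lambda>n. z * ?y n) \<longlonglongrightarrow> z * y"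
        by (intro tendsto_intros y)
      moreover have "(\<lambda>n. z * ?y n) \<longlonglongrightarrow> y * z"
        unfolding sqrt_iter_commute[OF that] by (intro tendsto_intros y)
      ultimately have "z * y = y * z"
        by (rule LIMSEQ_unique)
      then show ?thesis
        by (simp add: algebra_simps)
    qed
  qed
qed

text \<open>For self-adjoint \<open>h\<close> the norm condition says that the spectrum lies in the
  interval from 0 to \<open>2 t\<close>. In this form sums and multiples are immediate, and
  closeness to a scalar is exactly what the square-root iteration consumes.\<close>

definition pos :: "'a::cstar_algebra \<Rightarrow> bool" where
  "pos h \<longleftrightarrow> star h = h \<and> (\<exists>t. norm (of_real t - h) \<le> t)"

lemma pos_star: "pos h \<Longrightarrow> star h = h"
  by (simp add: pos_def)

lemma pos_add:
  assumes "pos h" "pos k"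
  shows "pos (h + k)"
proof -
  obtain t u where "norm (of_real t - h) \<le> t" "norm (of_real u - k) \<le> u"
    using assms by (auto simp: pos_def)
  then have "norm (of_real (t + u) - (h + k)) \<le> t + u"
    using norm_triangle_ineq[of "of_real t - h" "of_real u - k"] by (simp add: algebra_simps)
  then show ?thesis
    using assms unfolding pos_def star_add by metis
qed

lemma pos_scaleR:
  assumes "pos h" "0 \<le> r"
  shows "pos (r *\<^sub>R h)"
proof -
  obtain t where t: "norm (of_real t - h) \<le> t"
    using assms by (auto simp: pos_def)
  have "norm (of_real (r * t) - r *\<^sub>R h) = r * norm (of_real t - h)"
    using assms by (simp add: of_real_def scaleR_diff_right[symmetric] flip: scaleR_scaleR)
  then have "norm (of_real (r * t) - r *\<^sub>R h) \<le> r * t"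
    using t assms by (simp add: mult_left_mono)
  then show ?thesis
    using assms unfolding pos_def star_scaleR by metis
qed

lemma pos_of_real_minus: "star h = h \<Longrightarrow> norm h \<le> c \<Longrightarrow> pos (of_real c - h)"
  by (auto simp: pos_def star_diff intro!: exI[of _ c])

text \<open>Dividing by \<open>t\<close> turns the defining inequality into
  \<open>norm x \<le> 1\<close> for \<open>x = 1 - h / t\<close>, so \<open>sqrt t\<close> times the
  root of \<open>1 - x\<close> is the root of \<open>h\<close>. If \<open>t = 0\<close>, then
  \<open>h = 0\<close>.\<close>

lemma pos_sqrt:
  assumes "pos h"
  obtains s where "star s = s" "s * s = h" "pos s" "\<And>z. z * h = h * z \<Longrightarrow> z * s = s * z"
proof -
  obtain t where t: "norm (of_real t - h) \<le> t" and sh: "star h = h"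
    using assms by (auto simp: pos_def)
  show ?thesis
  proof (cases "t = 0")
    case True
    then show ?thesis
      using t that[of 0] by (auto simp: pos_def intro: exI[of _ 0])
  next
    case False
    then have t0: "t > 0"
      using t norm_ge_zero[of "of_real t - h"] by linarith
    define x where "x = (1 / t) *\<^sub>R (of_real t - h)"
    have x: "1 - x = (1 / t) *\<^sub>R h"
      using t0 by (simp add: x_def of_real_def algebra_simps)
    have "norm x \<le> 1" "star x = x"
      using t t0 sh by (simp_all add: x_def star_scaleR star_diff)
    then obtain s where s: "star s = s" "s * s = 1 - x" "norm (1 - s) \<le> 1"
        "\<And>z. z * x = x * z \<Longrightarrow> z * s = s * z"
      by (rule exists_sqrt_one_minus) blast
    show ?thesis
    proof (rule that[of "sqrt t *\<^sub>R s"])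
      show "star (sqrt t *\<^sub>R s) = sqrt t *\<^sub>R s"
        by (simp add: star_scaleR s(1))
      show "sqrt t *\<^sub>R s * sqrt t *\<^sub>R s = h"
        using t0 by (simp add: s(2) x)
      show "pos (sqrt t *\<^sub>R s)"
        using s(1,3) t0 by (intro pos_scaleR) (auto simp: pos_def intro!: exI[of _ 1])
      show "z * sqrt t *\<^sub>R s = sqrt t *\<^sub>R s * z" if "z * h = h * z" for z
        using s(4)[of z] that by (simp add: x_def algebra_simps of_real_def)
    qed
  qed
qed

text \<open>If \<open>k\<close> has norm \<open>1\<close>, then \<open>u = k + i (1 - k\<^sup>2)\<^bsup>1/2\<^esup>\<close> is unitary with real part \<open>k\<close>,
  and \<open>2 k\<^sup>2 - 1\<close> is the real part of \<open>u\<^sup>2\<close>.\<close>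

lemma pos_square:
  fixes h :: "'a::cstar_algebra"
  assumes sh: "star h = h"
  shows "pos (h * h)"
proof (cases "h = 0")
  case True
  then show ?thesis
    by (auto simp: pos_def intro!: exI[of _ 0])
next
  case False
  define k where "k = h /\<^sub>R norm h"
  have k: "star k = k" "norm k = 1" "norm (k * k) \<le> 1"
    using False sh norm_mult_ineq[of k k] by (simp_all add: k_def star_scaleR)
  have "star (k * k) = k * k"
    by (simp add: star_mult k)
  then obtain s where s: "star s = s" "s * s = 1 - k * k" "\<And>z. z * (k * k) = k * k * z \<Longrightarrow> z * s = s * z"
    using exists_sqrt_one_minus[OF k(3)] by metis
  have ks: "k * s = s * k"
    by (rule s(3)) (simp add: mult.assoc)
  define u where "u = k + \<i> *\<^sub>C s"
  have su: "star u = k - \<i> *\<^sub>C s"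
    by (simp add: u_def star_add star_scaleC k s(1) complex_vector.scale_minus_left)
  have "star u * u = k * k + s * s"
    unfolding su by (simp add: u_def algebra_simps mult_scaleC_left mult_scaleC_right ks scaleC_add_right)
  then have "norm u = 1"
    using norm_star_mult_self[of u] s(2) by (simp add: power2_eq_1_iff) (smt (verit) norm_ge_zero)
  moreover have "(u * u + star u * star u) /\<^sub>R 2 = k * k - s * s"
    unfolding su by (simp add: u_def algebra_simps mult_scaleC_left mult_scaleC_right ks scaleC_add_right
        flip: scaleR_2)
  moreover have "norm (u * u) \<le> norm u * norm u" "norm (star u * star u) \<le> norm u * norm u"
    using norm_mult_ineq[of u u] norm_mult_ineq[of "star u" "star u"] by simp_all
  ultimately have u: "norm (u * u + star u * star u) \<le> 2" "(u * u + star u * star u) /\<^sub>R 2 = k * k - s * s"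
    using norm_triangle_ineq[of "u * u" "star u * star u"] by auto
  have "norm (k * k - s * s) \<le> 1"
    unfolding u(2)[symmetric] using u(1) by simp
  moreover have "k * k - s * s = 2 *\<^sub>R (k * k - of_real (1 / 2))"
    by (simp add: s(2) of_real_def algebra_simps scaleR_2)
  ultimately have "norm (k * k - of_real (1 / 2)) \<le> 1 / 2"
    by simp
  then have "pos (k * k)"
    using k by (auto simp: pos_def star_mult norm_minus_commute intro!: exI[of _ "1 / 2"])
  then have "pos ((norm h)\<^sup>2 *\<^sub>R (k * k))"
    by (rule pos_scaleR) simp
  moreover have "(norm h)\<^sup>2 *\<^sub>R (k * k) = h * h"
    using False by (simp add: k_def power2_eq_square field_simps)
  ultimately show ?thesis
    by simp
qed

lemma pos_of_real_iff: "pos (of_real c :: 'a::cstar_algebra) \<longleftrightarrow> 0 \<le> c"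
proof
  assume "pos (of_real c :: 'a)"
  then obtain t where "norm (of_real t - of_real c :: 'a) \<le> t"
    unfolding pos_def by blast
  then have "\<bar>t - c\<bar> \<le> t"
    unfolding of_real_diff[symmetric] norm_of_real .
  then show "0 \<le> c"
    by linarith
qed (auto simp: pos_def intro!: exI[of _ c])

text \<open>The square roots of \<open>h\<close> and \<open>c - h\<close> are the real and imaginary part of \<open>c\<^bsup>1/2\<^esup>\<close> times a
  unitary.\<close>

lemma pos_norm_le:
  fixes h :: "'a::cstar_algebra"
  assumes "pos h" "pos (of_real c - h)"
  shows "norm h \<le> c"
proof -
  have c: "0 \<le> c"
    using pos_add[OF assms] by (simp add: pos_of_real_iff)
  obtain s where s: "star s = s" "s * s = h" "\<And>z. z * h = h * z \<Longrightarrow> z * s = s * z"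
    using pos_sqrt[OF assms(1)] by metis
  obtain w where w: "star w = w" "w * w = of_real c - h"
      "\<And>z. z * (of_real c - h) = (of_real c - h) * z \<Longrightarrow> z * w = w * z"
    using pos_sqrt[OF assms(2)] by metis
  \<comment> \<open>\<open>s\<close> commutes with \<open>h\<close>, hence with
    \<open>c - h\<close>, hence with its root \<open>w\<close>; otherwise \<open>star z * z\<close>
    would retain a commutator of \<open>s\<close> and \<open>w\<close>.\<close>
  have "s * h = h * s"
    by (simp add: s(2)[symmetric] mult.assoc)
  then have sw: "s * w = w * s"
    by (intro w(3)) (simp add: algebra_simps of_real_def)
  define z where "z = s + \<i> *\<^sub>C w"
  have sz: "star z = s - \<i> *\<^sub>C w"
    by (simp add: z_def star_add star_scaleC w(1) s(1) complex_vector.scale_minus_left)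
  have "star z * z = of_real c"
    unfolding sz by (simp add: z_def algebra_simps mult_scaleC_left mult_scaleC_right sw scaleC_add_right
        s(2) w(2))
  then have z: "(norm z)\<^sup>2 = c"
    using norm_star_mult_self[of z] c by simp
  have "s = (z + star z) /\<^sub>R 2"
    unfolding sz by (simp add: z_def flip: scaleR_2)
  then have "norm s \<le> norm z"
    using norm_triangle_ineq[of z "star z"] by simp
  then have "norm s * norm s \<le> norm z * norm z"
    by (simp add: mult_mono)
  then show ?thesis
    using norm_mult_ineq[of s s] z s(2) by (simp add: power2_eq_square)
qed

text \<open>The element \<open>norm (h + k) - h\<close> is positive, being the sum of
  \<open>norm (h + k) - (h + k)\<close> and \<open>k\<close>. This monotonicity is what turns an
  orthogonal decomposition of the \<open>A\<close>-valued scalar product into a norm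
  estimate.\<close>

lemma norm_le_norm_add:
  fixes h k :: "'a::cstar_algebra"
  assumes "pos h" "pos k"
  shows "norm h \<le> norm (h + k)"
proof (rule pos_norm_le)
  have "pos (of_real (norm (h + k)) - (h + k))"
    using assms by (intro pos_of_real_minus) (auto simp: pos_def star_add)
  then show "pos (of_real (norm (h + k)) - h)"
    using pos_add[OF _ assms(2)] by fastforce
qed (fact assms)

lemma pos_antisym: "pos h \<Longrightarrow> pos (- h) \<Longrightarrow> h = 0"
  using pos_norm_le[of h 0] by simp

lemma pos_cube:
  assumes "pos v"
  shows "pos (v * v * v)"
proof -
  obtain r where r: "star r = r" "r * r = v"
    using pos_sqrt[OF assms] by metis
  have "v * v * v = (r * r * r) * (r * r * r)"
    by (simp add: r(2)[symmetric] mult.assoc)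
  then show ?thesis
    using pos_square[of "r * r * r"] by (simp add: star_mult r(1) mult.assoc)
qed

section \<open>Positivity read off from bounded powers\<close>

lemma pos_iff: "pos h \<longleftrightarrow> star h = h \<and> (\<exists>e>0. norm (1 - e *\<^sub>R h) \<le> 1)"
proof
  assume "pos h"
  then obtain t where t: "norm (of_real t - h) \<le> t" and sh: "star h = h"
    by (auto simp: pos_def)
  \<comment> \<open>Enlarging \<open>t\<close> to \<open>t + 1\<close> preserves the bound and
    allows division also when \<open>t = 0\<close>.\<close>
  have t': "norm (of_real (t + 1) - h) \<le> t + 1" "0 \<le> t"
    using t norm_triangle_ineq[of "of_real t - h" 1] order_trans[OF norm_ge_zero t]
    by (simp_all add: algebra_simps)
  have "1 - (1 / (t + 1)) *\<^sub>R h = (1 / (t + 1)) *\<^sub>R (of_real (t + 1) - h)"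
    using t'(2) by (simp add: of_real_def scaleR_diff_right del: scaleR_left.add)
  then have "norm (1 - (1 / (t + 1)) *\<^sub>R h) = \<bar>1 / (t + 1)\<bar> * norm (of_real (t + 1) - h)"
    by (simp only: norm_scaleR)
  also have "\<dots> \<le> \<bar>1 / (t + 1)\<bar> * (t + 1)"
    by (intro mult_left_mono t'(1)) simp
  also have "\<dots> = 1"
    using t'(2) by simp
  finally have "norm (1 - (1 / (t + 1)) *\<^sub>R h) \<le> 1" .
  then show "star h = h \<and> (\<exists>e>0. norm (1 - e *\<^sub>R h) \<le> 1)"
    using sh t'(2) by (intro conjI exI[of _ "1 / (t + 1)"]) simp_all
next
  assume "star h = h \<and> (\<exists>e>0. norm (1 - e *\<^sub>R h) \<le> 1)"
  then obtain e where e: "star h = h" "e > 0" "norm (1 - e *\<^sub>R h) \<le> 1"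
    by blast
  have "of_real (1 / e) - h = (1 / e) *\<^sub>R (1 - e *\<^sub>R h)"
    using e(2) by (simp add: of_real_def scaleR_diff_right)
  then have "norm (of_real (1 / e) - h) = norm (1 - e *\<^sub>R h) / e"
    using e(2) by simp
  then have "norm (of_real (1 / e) - h) \<le> 1 / e"
    using e(2,3) by (simp add: divide_right_mono)
  then show "pos h"
    using e(1) unfolding pos_def by blast
qed

lemma norm_power_two_power:
  fixes h :: "'a::cstar_algebra"
  assumes "star h = h"
  shows "norm (h ^ 2 ^ k) = norm h ^ 2 ^ k"
proof (induction k)
  case (Suc k)
  have "norm (h ^ 2 ^ Suc k) = norm (star (h ^ 2 ^ k) * h ^ 2 ^ k)"
    using assms by (simp add: star_power mult_2 power_add)
  also have "\<dots> = norm h ^ 2 ^ Suc k"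
    unfolding norm_star_mult_self using Suc by (simp add: power2_eq_square mult_2 power_add)
  finally show ?case .
qed simp

text \<open>For self-adjoint \<open>h\<close> the C*-identity gives the exact norm of the powers
  with exponent \<open>2 ^ k\<close>. A norm above 1 would grow exponentially along these exponents
  and outrun any linear bound.\<close>

lemma norm_le_one_of_linear_growth:
  fixes h :: "'a::cstar_algebra"
  assumes "star h = h" and growth: "\<And>n. norm (h ^ n) \<le> 1 + real n * C"
  shows "norm h \<le> 1"
proof (rule ccontr)
  assume "\<not> norm h \<le> 1"
  define x where "x = 1 / norm h"
  have "1 < norm h"
    using \<open>\<not> norm h \<le> 1\<close> by simp
  then have x: "0 < x" "x < 1"
    by (auto simp: x_def divide_less_eq)
  have "(\<lambda>n. x ^ n + real n * x ^ n * C) \<longlonglongrightarrow> 0 + 0 * C"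
    using x by (intro tendsto_intros LIMSEQ_realpow_zero powser_times_n_limit_0) simp_all
  moreover have "strict_mono (\<lambda>k. 2 ^ k :: nat)"
    by (simp add: strict_monoI)
  ultimately have "(\<lambda>k. x ^ 2 ^ k + real (2 ^ k) * x ^ 2 ^ k * C) \<longlonglongrightarrow> 0"
    using LIMSEQ_subseq_LIMSEQ[of "\<lambda>n. x ^ n + real n * x ^ n * C" 0 "\<lambda>k. 2 ^ k"] by (simp add: o_def)
  moreover have "1 \<le> x ^ 2 ^ k + real (2 ^ k) * x ^ 2 ^ k * C" for k
  proof -
    have "x ^ 2 ^ k * norm h ^ 2 ^ k \<le> x ^ 2 ^ k * (1 + real (2 ^ k) * C)"
      using growth[of "2 ^ k"] x by (intro mult_left_mono) (simp_all add: norm_power_two_power assms(1))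
    moreover have "x ^ 2 ^ k * norm h ^ 2 ^ k = 1"
      using x by (simp add: x_def flip: power_mult_distrib)
    ultimately show ?thesis
      by (simp add: algebra_simps)
  qed
  ultimately show False
    using LIMSEQ_le_const[of _ 0 1] by fastforce
qed

text \<open>\<open>(1 - v) ^ Suc n\<close> differs from \<open>(1 - v) ^ n\<close> by
  \<open>v * (1 - v) ^ n\<close>, so the norms grow at most linearly. The extra factor
  \<open>v\<close> is the point: it allows the powers to be rewritten before they are
  estimated.\<close>

lemma norm_one_minus_le_one:
  fixes v :: "'a::cstar_algebra"
  assumes sv: "star v = v" and bound: "\<And>n. norm (v * (1 - v) ^ n) \<le> C"
  shows "norm (1 - v) \<le> 1"
proof (rule norm_le_one_of_linear_growth[where C = C])
  show "star (1 - v) = 1 - v"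
    by (simp add: star_diff sv)
  show "norm ((1 - v) ^ n) \<le> 1 + real n * C" for n
  proof (induction n)
    case (Suc n)
    have "(1 - v) ^ Suc n = (1 - v) ^ n - v * (1 - v) ^ n"
      by (simp add: algebra_simps)
    then show ?case
      using norm_triangle_ineq4[of "(1 - v) ^ n" "v * (1 - v) ^ n"] Suc bound[of n]
      by (simp add: algebra_simps)
  qed simp
qed

text \<open>Multiplication by \<open>v\<close> annihilates \<open>u\<close>, so behind the factor
  \<open>v\<close> the powers of \<open>1 - e v\<close> may be replaced by powers of the contraction
  \<open>1 - e (u + v)\<close>.\<close>

lemma pos_orthogonal_part:
  fixes u v :: "'a::cstar_algebra"
  assumes "pos (u + v)" "star v = v" "v * u = 0"
  shows "pos v"
proof -
  obtain e where e: "e > 0" "norm (1 - e *\<^sub>R (u + v)) \<le> 1"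
    using assms by (auto simp: pos_iff)
  define w where "w = e *\<^sub>R v"
  have sw: "star w = w"
    by (simp add: w_def star_scaleR assms)
  have step: "w * (1 - e *\<^sub>R (u + v)) = (1 - w) * w"
    by (simp add: w_def algebra_simps assms)
  have "w * (1 - w) ^ n = w * (1 - e *\<^sub>R (u + v)) ^ n" for n
  proof (induction n)
    case (Suc n)
    have "w * (1 - w) ^ Suc n = (1 - w) * (w * (1 - w) ^ n)"
      by (simp add: algebra_simps)
    also have "\<dots> = (1 - w) * w * (1 - e *\<^sub>R (u + v)) ^ n"
      using Suc by (simp add: mult.assoc)
    also have "\<dots> = w * (1 - e *\<^sub>R (u + v)) ^ Suc n"
      unfolding step[symmetric] by (simp add: mult.assoc)
    finally show ?case .
  qed simp
  moreover have "norm (w * (1 - e *\<^sub>R (u + v)) ^ n) \<le> norm w * 1" for n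
    by (rule order_trans[OF norm_mult_ineq mult_left_mono])
      (use order_trans[OF norm_power_ineq power_le_one[OF norm_ge_zero e(2)]] in simp_all)
  ultimately have "norm (1 - w) \<le> 1"
    by (intro norm_one_minus_le_one[OF sw, of "norm w"]) simp
  then show ?thesis
    using assms e(1) by (auto simp: pos_iff w_def)
qed

text \<open>The inclusion \<open>\<sigma>(star y * y) \<subseteq> \<sigma>(y * star y) \<union> {0}\<close>, in the form needed here: powers of
  \<open>1 - e (star y * y)\<close> move past \<open>y\<close> to powers of \<open>1 - e (y * star y)\<close>, which are bounded.\<close>

lemma pos_star_mult_swap:
  fixes y :: "'a::cstar_algebra"
  assumes "pos (y * star y)"
  shows "pos (star y * y)"
proof -
  obtain e where e: "e > 0" "norm (1 - e *\<^sub>R (y * star y)) \<le> 1"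
    using assms by (auto simp: pos_iff)
  define w where "w = e *\<^sub>R (star y * y)"
  have sw: "star w = w"
    by (simp add: w_def star_scaleR star_mult star_star)
  have step: "y * (1 - w) = (1 - e *\<^sub>R (y * star y)) * y"
    by (simp add: w_def algebra_simps)
  have "y * (1 - w) ^ n = (1 - e *\<^sub>R (y * star y)) ^ n * y" for n
  proof (induction n)
    case (Suc n)
    have "y * (1 - w) ^ Suc n = (1 - e *\<^sub>R (y * star y)) * (y * (1 - w) ^ n)"
      using step by (simp flip: mult.assoc)
    also have "\<dots> = (1 - e *\<^sub>R (y * star y)) ^ Suc n * y"
      using Suc by (simp add: mult.assoc)
    finally show ?case .
  qed simp
  then have "w * (1 - w) ^ n = (e *\<^sub>R star y) * ((1 - e *\<^sub>R (y * star y)) ^ n * y)" for n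
    by (simp add: w_def mult.assoc)
  moreover have "norm ((1 - e *\<^sub>R (y * star y)) ^ n * y) \<le> 1 * norm y" for n
    by (rule order_trans[OF norm_mult_ineq mult_right_mono])
      (use order_trans[OF norm_power_ineq power_le_one[OF norm_ge_zero e(2)]] in simp_all)
  ultimately have "norm (w * (1 - w) ^ n) \<le> norm (e *\<^sub>R star y) * norm y" for n
    using norm_mult_ineq[of "e *\<^sub>R star y"] by (metis (no_types, lifting) dual_order.trans mult_1
      mult_left_mono norm_ge_zero)
  then have "norm (1 - w) \<le> 1"
    by (rule norm_one_minus_le_one[OF sw])
  then show ?thesis
    using e(1) by (auto simp: pos_iff w_def star_mult star_star)
qed

text \<open>Fukamiya's argument: with \<open>h = star x * x\<close> and \<open>v\<close> twice its negative part, \<open>y = x * v\<close> satisfies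
  \<open>star y * y = - v\<^sup>3 / 2\<close>, whence both \<open>star y * y\<close> and its negative are positive.\<close>

theorem pos_star_mult_self: "pos (star x * x :: 'a::cstar_algebra)"
proof -
  define h where "h = star x * x"
  have sh: "star h = h"
    by (simp add: h_def star_mult star_star)
  obtain s where s: "star s = s" "s * s = h * h" "pos s" "\<And>z. z * (h * h) = h * h * z \<Longrightarrow> z * s = s * z"
    using pos_sqrt[OF pos_square[OF sh]] by metis
  have hs: "h * s = s * h"
    by (rule s(4)) (simp add: mult.assoc)
  \<comment> \<open>\<open>s\<close> plays the role of the absolute value of \<open>h\<close>. Then
    \<open>u\<close> and \<open>v\<close> are orthogonal with positive sum, which forces
    \<open>v\<close> to be positive.\<close>
  define u v where "u = s + h" and "v = s - h"
  have sv: "star v = v"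
    by (simp add: v_def star_diff s(1) sh)
  have vu: "v * u = 0"
    by (simp add: u_def v_def algebra_simps hs s(2))
  have "u + v = 2 *\<^sub>R s"
    by (simp add: u_def v_def scaleR_2)
  then have pv: "pos v"
    using pos_scaleR[OF s(3), of 2] by (intro pos_orthogonal_part[OF _ sv vu]) simp
  define p where "p = (1 / 2) *\<^sub>R (v * v * v)"
  have pp: "pos p"
    unfolding p_def by (intro pos_scaleR pos_cube pv) simp
  define y where "y = x * v"
  have h2: "h = (1 / 2) *\<^sub>R (u - v)"
    by (simp add: u_def v_def flip: scaleR_2)
  have yy: "star y * y = - p"
  proof -
    have "star y * y = v * h * v"
      by (simp add: y_def h_def star_mult sv mult.assoc)
    also have "\<dots> = (1 / 2) *\<^sub>R ((v * u - v * v) * v)"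
      by (subst h2) (simp add: algebra_simps)
    also have "\<dots> = - p"
      by (simp add: vu p_def)
    finally show ?thesis .
  qed
  \<comment> \<open>Up to scaling, the real and imaginary part of \<open>y\<close>. As
    \<open>a * a + b * b\<close> is twice \<open>y * star y + star y * y\<close> and
    \<open>star y * y = - p\<close>, adding \<open>p\<close> to half of it leaves
    \<open>y * star y\<close>, which is therefore positive.\<close>
  define a b where "a = y + star y" and "b = \<i> *\<^sub>C (y - star y)"
  have "star a = a" "star b = b"
    by (simp_all add: a_def b_def star_add star_diff star_star star_scaleC complex_vector.scale_minus_left
        complex_vector.scale_right_diff_distrib)
  then have "pos (a * a + b * b)"
    by (intro pos_add pos_square)
  moreover have "a * a + b * b = 2 *\<^sub>R (y * star y + star y * y)"
    by (simp add: a_def b_def mult_scaleC_left mult_scaleC_right algebra_simps scaleR_2)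
  ultimately have "pos (2 *\<^sub>R (y * star y + star y * y))"
    by simp
  then have "pos ((1 / 2) *\<^sub>R 2 *\<^sub>R (y * star y + star y * y))"
    by (rule pos_scaleR) simp
  then have "pos (y * star y + star y * y + p)"
    using pos_add[OF _ pp] by simp
  then have "pos (- p)"
    using pos_star_mult_swap[of y] by (simp add: yy)
  then have "p = 0"
    using pos_antisym[OF pp] by blast
  then have "v * v * v = 0"
    by (simp add: p_def)
  then have "norm (star (v * v) * (v * v)) = 0"
    by (simp add: star_mult sv flip: mult.assoc)
  then have "v * v = 0"
    unfolding norm_star_mult_self by simp
  then have "norm (star v * v) = 0"
    by (simp add: sv)
  then have "v = 0"
    unfolding norm_star_mult_self by simp
  then show ?thesis
    using s(3) by (simp add: v_def h_def[symmetric])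
qed

lemma pos_mult_star_self: "pos (x * star x :: 'a::cstar_algebra)"
  using pos_star_mult_self[of "star x"] by (simp add: star_star)

section \<open>Contractivity of automorphisms\<close>

lemma star_automorphism_one:
  assumes "star_automorphism \<phi>"
  shows "\<phi> 1 = 1"
proof -
  obtain e where "\<phi> e = 1"
    using assms unfolding star_automorphism_def bij_def surj_def by metis
  moreover have "\<phi> (1 * e) = \<phi> 1 * \<phi> e"
    using assms unfolding star_automorphism_def by blast
  ultimately show ?thesis
    by simp
qed

text \<open>Positive elements are squares of self-adjoint ones, so \<open>\<phi>\<close> preserves
  positivity; the inequalities \<open>0 \<le> h \<le> c\<close> that bound the norm of
  \<open>h = star x * x\<close> therefore carry over to \<open>\<phi> h\<close>.\<close>

lemma star_automorphism_norm_le: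
  assumes \<phi>: "star_automorphism \<phi>"
  shows "norm (\<phi> x) \<le> norm x"
proof -
  have add: "\<phi> (a + b) = \<phi> a + \<phi> b" and scale: "\<phi> (c *\<^sub>C a) = c *\<^sub>C \<phi> a"
    and mult: "\<phi> (a * b) = \<phi> a * \<phi> b" and st: "\<phi> (star a) = star (\<phi> a)" for a b c
    using \<phi> by (auto simp: star_automorphism_def)
  have real: "\<phi> (of_real r) = of_real r" for r
    using scale[of "complex_of_real r" 1, unfolded scaleC_of_real] star_automorphism_one[OF \<phi>]
    by (simp add: of_real_def)
  have pos: "pos (\<phi> h)" if h: "pos h" for h
  proof -
    obtain s where "star s = s" "s * s = h"
      using pos_sqrt[OF h] by metis
    then show ?thesis
      using pos_square[of "\<phi> s"] by (metis mult st)
  qed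
  define h c where "h = star x * x" and "c = norm h"
  have "pos (\<phi> (of_real c - h))"
    by (intro pos pos_of_real_minus) (simp_all add: h_def c_def star_mult star_star)
  moreover have "\<phi> (of_real c - h) = of_real c - \<phi> h"
    using add[of "of_real c - h" h] by (simp add: real eq_diff_eq)
  ultimately have "norm (\<phi> h) \<le> c"
    using pos[of h] pos_star_mult_self[of x] by (intro pos_norm_le) (simp_all add: h_def)
  then have "(norm (\<phi> x))\<^sup>2 \<le> (norm x)\<^sup>2"
    by (simp add: h_def c_def mult st norm_star_mult_self)
  then show ?thesis
    by (simp add: power2_le_iff_abs_le)
qed

lemma star_automorphism_bounded_linear:
  assumes "star_automorphism \<phi>"
  shows "bounded_linear \<phi>"
proof (rule bounded_linear_intro[of _ 1])
  show "\<phi> (r *\<^sub>R x) = r *\<^sub>R \<phi> x" for r x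
    using assms by (metis scaleC_of_real star_automorphism_def)
qed (use assms star_automorphism_norm_le in \<open>auto simp: star_automorphism_def\<close>)

section \<open>Haar integration of continuous functions\<close>

abbreviation cont :: "('x::topological_space \<Rightarrow> 'y::topological_space) \<Rightarrow> bool" where
  "cont f \<equiv> continuous_on UNIV f"

lemma cont_compose:
  assumes "cont f" "continuous_on A t"
  shows "continuous_on A (\<lambda>z. f (t z))"
  by (rule continuous_on_compose2[OF assms]) simp

locale compact_group =
  fixes \<mu> :: "'g::{topological_group_add, t2_space} measure"
  assumes compact_UNIV: "compact (UNIV :: 'g set)"
    and haar: "normalized_haar_measure \<mu>"
begin

lemma sets_haar: "sets \<mu> = sets borel"
  using haar by (simp add: normalized_haar_measure_def)

lemma space_haar: "space \<mu> = UNIV"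
  using sets_eq_imp_space_eq[OF sets_haar] by simp

lemma emeasure_space_1: "emeasure \<mu> (space \<mu>) = 1"
  using haar by (simp add: normalized_haar_measure_def space_haar)

sublocale finite_measure \<mu>
  by (rule finite_measureI) (simp add: emeasure_space_1)

lemma measure_translate:
  assumes "A \<in> sets borel"
  shows "measure \<mu> ((+) g ` A) = measure \<mu> A"
  using haar assms by (simp add: normalized_haar_measure_def measure_def)

text \<open>A rounding moves every point to one of finitely many nodes; composing with it turns
  integrals into Riemann sums.\<close>

definition rounding :: "('g \<Rightarrow> 'g) \<Rightarrow> bool" where
  "rounding s \<longleftrightarrow> finite (range s) \<and> (\<forall>p. s -` {p} \<in> sets borel)"

definition riemann_sum :: "('g \<Rightarrow> 'g) \<Rightarrow> ('g \<Rightarrow> 'b) \<Rightarrow> 'b::real_vector" where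
  "riemann_sum s f = (\<Sum>p\<in>range s. measure \<mu> (s -` {p}) *\<^sub>R f p)"

text \<open>Compactness gives a finite subcover, and sending each point to the first node whose
  neighbourhood contains it makes the cells disjoint and Borel.\<close>

lemma rounding_exists:
  assumes U: "\<And>p. open (U p)" "\<And>p. p \<in> U p"
  obtains s where "rounding s" "\<And>y. y \<in> U (s y)"
proof -
  obtain C where C: "finite C" "UNIV \<subseteq> (\<Union>p\<in>C. U p)"
    using compactE_image[OF compact_UNIV, of UNIV U] U by (metis UNIV_I UN_I subsetI)
  then obtain p where p: "bij_betw p {..<card C} C"
    using ex_bij_betw_nat_finite by (metis lessThan_atLeast0)
  define k where "k y = (LEAST i. i < card C \<and> y \<in> U (p i))" for y
  have ex: "\<exists>i. i < card C \<and> y \<in> U (p i)" for y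
    using C(2) p unfolding bij_betw_def by (metis UNIV_I UN_E imageE lessThan_iff subsetD)
  have k: "k y < card C \<and> y \<in> U (p (k y))" for y
    unfolding k_def by (rule LeastI_ex[OF ex])
  have k_iff: "k y = i \<longleftrightarrow> i < card C \<and> y \<in> U (p i) \<and> (\<forall>j<i. y \<notin> U (p j))" for y i
  proof
    assume "k y = i"
    then show "i < card C \<and> y \<in> U (p i) \<and> (\<forall>j<i. y \<notin> U (p j))"
      using k[of y] not_less_Least[of _ "\<lambda>i. i < card C \<and> y \<in> U (p i)"]
      unfolding k_def by (metis order.strict_trans)
  next
    assume "i < card C \<and> y \<in> U (p i) \<and> (\<forall>j<i. y \<notin> U (p j))"
    then show "k y = i"
      unfolding k_def by (intro Least_equality) (auto simp: not_less[symmetric])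
  qed
  have "k -` {i} = (if i < card C then U (p i) - (\<Union>j<i. U (p j)) else {})" for i
    by (rule Set.set_eqI, unfold vimage_singleton_eq k_iff) auto
  then have k_borel: "k -` {i} \<in> sets borel" for i
    using U(1) by (auto intro!: sets.Diff sets.finite_UN borel_open)
  have fin: "finite (range k)"
    by (rule finite_subset[of _ "{..<card C}"]) (use k in auto)
  show ?thesis
  proof (rule that[of "\<lambda>y. p (k y)"])
    have "(\<lambda>y. p (k y)) -` {x} = (\<Union>i\<in>{i\<in>range k. p i = x}. k -` {i})" for x
      by auto
    then have "(\<lambda>y. p (k y)) -` {x} \<in> sets borel" for x
      using fin k_borel by auto
    moreover have "finite (range (\<lambda>y. p (k y)))"
      using finite_imageI[OF fin, of p] by (simp add: image_image)
    ultimately show "rounding (\<lambda>y. p (k y))"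
      by (simp add: rounding_def)
    show "y \<in> U (p (k y))" for y
      using k by blast
  qed
qed

abbreviation "simple_avg \<equiv> Bochner_Integration.simple_bochner_integral \<mu>"
abbreviation "simple_integrable \<equiv> Bochner_Integration.simple_bochner_integrable \<mu>"

lemma simple_function_rounding: "rounding s \<Longrightarrow> simple_function \<mu> (\<lambda>x. f (s x))"
proof (rule simple_function_compose1[of \<mu> s f])
  assume "rounding s"
  then show "simple_function \<mu> s"
    by (auto simp: simple_function_def rounding_def space_haar sets_haar)
qed

lemma simple_bochner_integrable_rounding:
  fixes f :: "'g \<Rightarrow> 'b::real_normed_vector"
  assumes "rounding s"
  shows "simple_integrable (\<lambda>x. f (s x))"
  using simple_function_rounding[OF assms, of f] by (intro simple_bochner_integrable.intros) simp_all

lemma simple_bochner_integral_rounding: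
  fixes f :: "'g \<Rightarrow> 'b::real_normed_vector"
  assumes "rounding s"
  shows "simple_avg (\<lambda>x. f (s x)) = riemann_sum s f"
proof -
  have "simple_avg (\<lambda>x. f (s x)) =
      (\<Sum>y\<in>s ` space \<mu>. measure \<mu> {x \<in> space \<mu>. s x = y} *\<^sub>R f y)"
    by (rule simple_bochner_integral_partition[OF simple_bochner_integrable_rounding[OF assms, of f]
          simple_function_rounding[OF assms, of "\<lambda>x. x"]]) auto
  also have "\<dots> = riemann_sum s f"
    by (simp add: riemann_sum_def space_haar vimage_def)
  finally show ?thesis .
qed

lemma sum_weights:
  assumes "rounding s"
  shows "(\<Sum>p\<in>range s. measure \<mu> (s -` {p})) = 1"
proof -
  have "(\<Sum>p\<in>range s. measure \<mu> (s -` {p})) = measure \<mu> (\<Union>p\<in>range s. s -` {p})"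
    using assms by (intro finite_measure_finite_Union[symmetric])
      (auto simp: rounding_def sets_haar disjoint_family_on_def)
  also have "(\<Union>p\<in>range s. s -` {p}) = space \<mu>"
    by (auto simp: space_haar)
  finally show ?thesis
    by (simp add: measure_def emeasure_space_1)
qed

lemma riemann_sum_const: "rounding s \<Longrightarrow> riemann_sum s (\<lambda>_. c) = c"
  by (simp add: riemann_sum_def sum_weights flip: scaleR_sum_left)

lemma riemann_sum_linear: "linear L \<Longrightarrow> riemann_sum s (\<lambda>x. L (f x)) = L (riemann_sum s f)"
  by (simp add: riemann_sum_def linear_sum linear_scale)

lemma norm_riemann_sum_le:
  fixes f :: "'g \<Rightarrow> 'b::real_normed_vector"
  shows "norm (riemann_sum s f) \<le> riemann_sum s (\<lambda>x. norm (f x))"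
  unfolding riemann_sum_def by (rule order_trans[OF norm_sum]) simp

text \<open>The simple functions defining the integral are compared in mean with the composite
  \<open>f (s y)\<close>. Since the total mass is 1, every admissible value \<open>x\<close> lies
  within \<open>e\<close> of the Riemann sum, which yields uniqueness as well as the later
  approximations.\<close>

lemma has_vector_integral_riemann:
  fixes f :: "'g \<Rightarrow> 'b::real_normed_vector"
  assumes f: "has_vector_integral \<mu> f x" and s: "rounding s"
    and osc: "\<And>y. norm (f y - f (s y)) \<le> e"
  shows "norm (x - riemann_sum s f) \<le> e"
  using f
proof cases
  case (1 t)
  have e: "0 \<le> e"
    using order_trans[OF norm_ge_zero osc] .
  let ?r = "riemann_sum s f"
  have bound: "ennreal (norm (simple_avg (t i) - ?r)) \<le>
      (\<integral>\<^sup>+y. norm (f y - t i y) \<partial>\<mu>) + ennreal e" for i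
  proof -
    have simp_t: "simple_function \<mu> (t i)"
      using 1(2)[of i] by (auto elim: simple_bochner_integrable.cases)
    \<comment> \<open>A difference of measurable functions into a nonseparable space need not be
      measurable; here it causes no trouble because \<open>t i\<close> takes only finitely many
      values.\<close>
    have "(\<lambda>y. norm (f y - t i y)) \<in> borel_measurable \<mu>"
    proof (rule measurable_compose_countable'[where f = "\<lambda>v y. norm (f y - v)" and g = "t i" and I = "t i ` space \<mu>"])
      show "(\<lambda>y. norm (f y - v)) \<in> borel_measurable \<mu>" for v
        by (rule measurable_compose[OF 1(1)]) (intro borel_measurable_continuous_onI continuous_intros)
      show "t i \<in> measurable \<mu> (count_space (t i ` space \<mu>))"
        using simp_t by (intro measurable_count_space_eq2[THEN iffD2]) (auto simp: simple_function_def)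
      show "countable (t i ` space \<mu>)"
        using simp_t by (simp add: simple_function_def countable_finite)
    qed
    then have meas: "(\<lambda>y. ennreal (norm (f y - t i y))) \<in> borel_measurable \<mu>"
      by (rule measurable_compose[OF _ measurable_ennreal])
    have int: "simple_integrable (\<lambda>y. f (s y))"
      by (rule simple_bochner_integrable_rounding[OF s])
    have "norm (simple_avg (t i) - ?r) =
        norm (simple_avg (\<lambda>y. t i y - f (s y)))"
      using 1(2)[of i] int by (simp add: simple_bochner_integral_diff simple_bochner_integral_rounding[OF s])
    also have "\<dots> \<le> simple_avg (\<lambda>y. norm (t i y - f (s y)))"
      using simple_bochner_integrable_compose2[of "(-)" \<mu> "t i" "\<lambda>y. f (s y)"] 1(2)[of i] int
      by (intro simple_bochner_integral_norm_bound) simp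
    finally have "ennreal (norm (simple_avg (t i) - ?r)) \<le>
        ennreal (simple_avg (\<lambda>y. norm (t i y - f (s y))))"
      by (rule ennreal_leI)
    also have "\<dots> = (\<integral>\<^sup>+y. norm (t i y - f (s y)) \<partial>\<mu>)"
      using simple_bochner_integrable_compose2[of "\<lambda>x y. norm (x - y)" \<mu> "t i" "\<lambda>y. f (s y)"] 1(2)[of i] int
      by (intro simple_bochner_integral_eq_nn_integral) simp_all
    also have "\<dots> \<le> (\<integral>\<^sup>+y. ennreal (norm (f y - t i y)) + ennreal e \<partial>\<mu>)"
    proof (rule nn_integral_mono)
      fix y
      have "norm (t i y - f (s y)) \<le> norm (f y - t i y) + norm (f y - f (s y))"
        using norm_triangle_ineq[of "t i y - f y" "f y - f (s y)"] by (simp add: norm_minus_commute)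
      then show "ennreal (norm (t i y - f (s y))) \<le> ennreal (norm (f y - t i y)) + ennreal e"
        using osc[of y] e by (simp flip: ennreal_plus)
    qed
    also have "\<dots> = (\<integral>\<^sup>+y. norm (f y - t i y) \<partial>\<mu>) + ennreal e"
      using meas by (subst nn_integral_add) (simp_all add: emeasure_space_1)
    finally show ?thesis .
  qed
  have "(\<lambda>i. ennreal (norm (simple_avg (t i) - ?r))) \<longlonglongrightarrow> ennreal (norm (x - ?r))"
    by (intro tendsto_ennrealI tendsto_intros 1(4))
  moreover have "(\<lambda>i. (\<integral>\<^sup>+y. norm (f y - t i y) \<partial>\<mu>) + ennreal e) \<longlonglongrightarrow> 0 + ennreal e"
    by (intro tendsto_intros 1(3))
  ultimately have "ennreal (norm (x - ?r)) \<le> 0 + ennreal e"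
    by (rule LIMSEQ_le) (use bound in blast)
  then show ?thesis
    using e by (simp add: ennreal_le_iff)
qed

section \<open>Existence, uniqueness and linearity of the integral of a continuous function\<close>

lemma fine_rounding:
  fixes f :: "'g \<Rightarrow> 'b::metric_space"
  assumes f: "cont f" and "0 < e"
  obtains s where "rounding s" "\<And>y. dist (f y) (f (s y)) \<le> e"
proof (rule rounding_exists[of "\<lambda>p. {y. dist (f y) (f p) < e}"])
  show "open {y. dist (f y) (f p) < e}" for p
    using f by (intro open_Collect_less continuous_intros)
qed (use assms that in \<open>auto intro: less_imp_le\<close>)

text \<open>Roundings with oscillation at most \<open>1 / (i + 1)\<close> give simple functions
  converging uniformly to \<open>f\<close>, hence in mean. Their integrals are Cauchy because two of
  these functions differ by at most the sum of the two oscillations.\<close>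

lemma has_vector_integral_exists:
  fixes f :: "'g \<Rightarrow> 'b::banach"
  assumes f: "cont f"
  shows "\<exists>x. has_vector_integral \<mu> f x"
proof -
  have "\<exists>s. rounding s \<and> (\<forall>y. norm (f y - f (s y)) \<le> inverse (real (Suc i)))" for i
    using fine_rounding[OF f, of "inverse (real (Suc i))"] by (auto simp: dist_norm)
  then obtain s where s: "\<And>i. rounding (s i)" "\<And>i y. norm (f y - f (s i y)) \<le> inverse (real (Suc i))"
    by metis
  let ?r = "\<lambda>i. riemann_sum (s i) f"
  have int: "simple_integrable (\<lambda>x. f (s i x))" for i
    by (rule simple_bochner_integrable_rounding[OF s(1)])
  have diff: "norm (?r i - ?r j) \<le> inverse (real (Suc i)) + inverse (real (Suc j))" for i j
  proof -
    let ?e = "inverse (real (Suc i)) + inverse (real (Suc j))"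
    have dint: "simple_integrable (\<lambda>x. f (s i x) - f (s j x))"
      by (rule simple_bochner_integrable_compose2[OF _ int int]) simp
    have nint: "simple_integrable (\<lambda>x. norm (f (s i x) - f (s j x)))"
      by (rule simple_bochner_integrable_compose2[OF _ int int, of "\<lambda>x y. norm (x - y)"]) simp
    have "norm (?r i - ?r j) = norm (simple_avg (\<lambda>x. f (s i x) - f (s j x)))"
      by (simp add: simple_bochner_integral_diff int simple_bochner_integral_rounding s(1))
    also have "\<dots> \<le> simple_avg (\<lambda>x. norm (f (s i x) - f (s j x)))"
      by (rule simple_bochner_integral_norm_bound[OF dint])
    finally have "ennreal (norm (?r i - ?r j)) \<le>
        ennreal (simple_avg (\<lambda>x. norm (f (s i x) - f (s j x))))"
      by (rule ennreal_leI)
    also have "\<dots> = (\<integral>\<^sup>+x. norm (f (s i x) - f (s j x)) \<partial>\<mu>)"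
      by (rule simple_bochner_integral_eq_nn_integral[OF nint]) simp
    also have "\<dots> \<le> (\<integral>\<^sup>+x. ennreal ?e \<partial>\<mu>)"
    proof (intro nn_integral_mono ennreal_leI)
      fix x
      show "norm (f (s i x) - f (s j x)) \<le> ?e"
        using norm_triangle_ineq[of "f (s i x) - f x" "f x - f (s j x)"] s(2)[of x i] s(2)[of x j]
        by (simp add: norm_minus_commute)
    qed
    also have "\<dots> = ennreal ?e"
      by (simp add: emeasure_space_1)
    finally show ?thesis
      by (subst (asm) ennreal_le_iff) auto
  qed
  have lim0: "(\<lambda>i. inverse (real (Suc i))) \<longlonglongrightarrow> 0"
    by (rule LIMSEQ_inverse_real_of_nat)
  have "Cauchy ?r"
  proof (rule CauchyI)
    fix e :: real assume "0 < e"
    then obtain M where M: "\<And>i. i \<ge> M \<Longrightarrow> inverse (real (Suc i)) < e / 2"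
      using order_tendstoD(2)[OF lim0, of "e / 2"] by (auto simp: eventually_sequentially)
    show "\<exists>M. \<forall>m\<ge>M. \<forall>n\<ge>M. norm (?r m - ?r n) < e"
    proof (intro exI[of _ M] allI impI)
      fix m n assume "M \<le> m" "M \<le> n"
      then show "norm (?r m - ?r n) < e"
        using diff[of m n] M[of m] M[of n] by linarith
    qed
  qed
  then obtain x where x: "?r \<longlonglongrightarrow> x"
    by (auto simp: Cauchy_convergent_iff convergent_def)
  have "has_vector_integral \<mu> f x"
  proof (rule has_vector_integral.intros)
    show "f \<in> borel_measurable \<mu>"
      using borel_measurable_continuous_onI[OF f] by (simp cong: measurable_cong_sets[OF sets_haar refl])
    show "simple_integrable (\<lambda>x. f (s i x))" for i
      by (rule int)
    show "(\<lambda>i. simple_avg (\<lambda>x. f (s i x))) \<longlonglongrightarrow> x"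
      using x by (simp add: simple_bochner_integral_rounding s(1))
    show "(\<lambda>i. \<integral>\<^sup>+x. norm (f x - f (s i x)) \<partial>\<mu>) \<longlonglongrightarrow> 0"
    proof (rule tendsto_sandwich[of "\<lambda>_. 0" _ _ "\<lambda>i. ennreal (inverse (real (Suc i)))"])
      show "(\<lambda>i. ennreal (inverse (real (Suc i)))) \<longlonglongrightarrow> 0"
        using tendsto_ennrealI[OF lim0] by simp
      have "(\<integral>\<^sup>+x. norm (f x - f (s i x)) \<partial>\<mu>) \<le> (\<integral>\<^sup>+x. ennreal (inverse (real (Suc i))) \<partial>\<mu>)" for i
        by (intro nn_integral_mono ennreal_leI s(2))
      then show "\<forall>\<^sub>F i in sequentially. (\<integral>\<^sup>+x. norm (f x - f (s i x)) \<partial>\<mu>) \<le> ennreal (inverse (real (Suc i)))"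
        by (simp add: emeasure_space_1)
    qed simp_all
  qed
  then show ?thesis ..
qed

lemma has_vector_integral_unique:
  fixes f :: "'g \<Rightarrow> 'b::banach"
  assumes f: "cont f" and "has_vector_integral \<mu> f x" "has_vector_integral \<mu> f y"
  shows "x = y"
proof -
  have "norm (x - y) \<le> 0 + e" if e: "0 < e" for e
  proof -
    obtain s where s: "rounding s" "\<And>y. norm (f y - f (s y)) \<le> e / 2"
      using fine_rounding[OF f half_gt_zero[OF e]] unfolding dist_norm by blast
    show ?thesis
      using has_vector_integral_riemann[OF assms(2) s] has_vector_integral_riemann[OF assms(3) s]
        norm_triangle_ineq4[of "x - riemann_sum s f" "y - riemann_sum s f"] by simp
  qed
  then have "norm (x - y) \<le> 0"
    by (rule field_le_epsilon)
  then show ?thesis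
    by simp
qed

abbreviation avg :: "('g \<Rightarrow> 'b) \<Rightarrow> 'b::real_normed_vector" where
  "avg f \<equiv> vector_integral \<mu> f"

lemma has_vector_integral_avg:
  fixes f :: "'g \<Rightarrow> 'b::banach"
  assumes "cont f"
  shows "has_vector_integral \<mu> f (avg f)"
proof -
  obtain x where x: "has_vector_integral \<mu> f x"
    using has_vector_integral_exists[OF assms] ..
  moreover from this have "(THE x. has_vector_integral \<mu> f x) = x"
    using has_vector_integral_unique[OF assms] by blast
  ultimately show ?thesis
    by (auto simp: vector_integral_def)
qed

lemma avg_riemann:
  fixes f :: "'g \<Rightarrow> 'b::banach"
  assumes "cont f" "rounding s" "\<And>y. norm (f y - f (s y)) \<le> e"
  shows "norm (avg f - riemann_sum s f) \<le> e"
  by (rule has_vector_integral_riemann[OF has_vector_integral_avg]) (use assms in auto)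

lemma avg_linear:
  fixes f :: "'g \<Rightarrow> 'b::banach" and L :: "'b \<Rightarrow> 'c::banach"
  assumes L: "bounded_linear L" and f: "cont f"
  shows "avg (\<lambda>x. L (f x)) = L (avg f)"
proof -
  interpret L: bounded_linear L by (rule L)
  obtain K where K: "K > 0" "\<And>x. norm (L x) \<le> norm x * K"
    using L.pos_bounded by blast
  have Lf: "cont (\<lambda>x. L (f x))"
    by (intro L.continuous_on f)
  have "norm (avg (\<lambda>x. L (f x)) - L (avg f)) \<le> 0 + e" if e: "0 < e" for e
  proof -
    define d where "d = e / (2 * K)"
    have d: "d > 0" "d * K = e / 2"
      using e K(1) by (simp_all add: d_def)
    obtain s where s: "rounding s" "\<And>y. norm (f y - f (s y)) \<le> d"
      using fine_rounding[OF f d(1)] unfolding dist_norm by auto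
    have scale: "norm (L x) \<le> e / 2" if "norm x \<le> d" for x
      using K(2)[of x] mult_right_mono[OF that, of K] K(1) d(2) by simp
    have "norm (avg (\<lambda>x. L (f x)) - riemann_sum s (\<lambda>x. L (f x))) \<le> e / 2"
      using scale[OF s(2)] by (intro avg_riemann Lf s(1)) (simp add: L.diff)
    moreover have "norm (L (avg f) - L (riemann_sum s f)) \<le> e / 2"
      using scale[OF avg_riemann[OF f s]] by (simp add: L.diff)
    moreover have "riemann_sum s (\<lambda>x. L (f x)) = L (riemann_sum s f)"
      by (rule riemann_sum_linear[OF L.linear])
    ultimately show ?thesis
      using norm_triangle_ineq4[of "avg (\<lambda>x. L (f x)) - L (riemann_sum s f)" "L (avg f) - L (riemann_sum s f)"]
      by simp
  qed
  then have "norm (avg (\<lambda>x. L (f x)) - L (avg f)) \<le> 0"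
    by (rule field_le_epsilon)
  then show ?thesis
    by simp
qed

text \<open>Additivity comes from linearity alone: the average of the pair \<open>(f, h)\<close> has
  the two averages as components, and addition is a bounded linear map on pairs.\<close>

lemma avg_add:
  fixes f h :: "'g \<Rightarrow> 'b::banach"
  assumes "cont f" "cont h"
  shows "avg (\<lambda>x. f x + h x) = avg f + avg h"
proof -
  have c: "cont (\<lambda>x. (f x, h x))"
    by (intro continuous_intros assms)
  show ?thesis
    using avg_linear[OF bounded_linear_fst c] avg_linear[OF bounded_linear_snd c]
      avg_linear[OF bounded_linear_add[OF bounded_linear_fst bounded_linear_snd] c] by simp
qed

lemma avg_diff:
  fixes f h :: "'g \<Rightarrow> 'b::banach"
  assumes "cont f" "cont h"
  shows "avg (\<lambda>x. f x - h x) = avg f - avg h"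
  using avg_add[OF assms(1), of "\<lambda>x. - h x"] avg_linear[OF bounded_linear_minus[OF bounded_linear_ident] assms(2)]
    assms(2) by (simp add: continuous_on_minus)

lemma avg_const: "avg (\<lambda>_. c) = (c :: 'b::banach)"
proof -
  obtain s where s: "rounding s"
    using rounding_exists[of "\<lambda>_. UNIV"] by auto
  have "norm (avg (\<lambda>_. c) - riemann_sum s (\<lambda>_. c)) \<le> 0"
    by (intro avg_riemann s continuous_on_const) simp
  then show ?thesis
    by (simp add: riemann_sum_const s)
qed

lemma avg_sum:
  fixes f :: "'i \<Rightarrow> 'g \<Rightarrow> 'b::banach"
  assumes "\<And>i. i \<in> A \<Longrightarrow> cont (f i)"
  shows "avg (\<lambda>x. \<Sum>i\<in>A. f i x) = (\<Sum>i\<in>A. avg (f i))"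
  using assms
proof (induction A rule: infinite_finite_induct)
  case (insert a A)
  then show ?case
    by (simp add: avg_add continuous_on_sum)
qed (simp_all add: avg_const)

lemma avg_mult_left:
  fixes f :: "'g \<Rightarrow> 'b::{banach, real_normed_algebra}"
  shows "cont f \<Longrightarrow> avg (\<lambda>x. c * f x) = c * avg f"
  by (rule avg_linear[OF bounded_linear_mult_right])

lemma avg_mult_right:
  fixes f :: "'g \<Rightarrow> 'b::{banach, real_normed_algebra}"
  shows "cont f \<Longrightarrow> avg (\<lambda>x. f x * c) = avg f * c"
  by (rule avg_linear[OF bounded_linear_mult_left])

lemma avg_cnj: "cont f \<Longrightarrow> avg (\<lambda>x. cnj (f x)) = cnj (avg f)"
  by (rule avg_linear[OF bounded_linear_cnj])

lemma norm_avg_le: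
  fixes f :: "'g \<Rightarrow> 'b::banach"
  assumes f: "cont f"
  shows "norm (avg f) \<le> avg (\<lambda>x. norm (f x))"
proof (rule field_le_epsilon)
  fix e :: real assume "0 < e"
  then obtain s where s: "rounding s" "\<And>y. norm (f y - f (s y)) \<le> e / 2"
    using fine_rounding[OF f half_gt_zero] unfolding dist_norm by blast
  have "norm (avg f - riemann_sum s f) \<le> e / 2"
    by (rule avg_riemann[OF f s])
  moreover have "norm (avg (\<lambda>x. norm (f x)) - riemann_sum s (\<lambda>x. norm (f x))) \<le> e / 2"
  proof (rule avg_riemann[OF _ s(1)])
    show "norm (norm (f y) - norm (f (s y))) \<le> e / 2" for y
      using norm_triangle_ineq3[of "f y" "f (s y)"] s(2)[of y] by simp
  qed (intro continuous_intros f)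
  ultimately show "norm (avg f) \<le> avg (\<lambda>x. norm (f x)) + e"
    using norm_riemann_sum_le[of s f] norm_triangle_ineq2[of "avg f" "riemann_sum s f"]
    unfolding real_norm_def by linarith
qed

lemma avg_nonneg:
  fixes f :: "'g \<Rightarrow> real"
  assumes f: "cont f" and "\<And>x. 0 \<le> f x"
  shows "0 \<le> avg f"
  using order_trans[OF norm_ge_zero norm_avg_le[OF f]] assms(2) by simp

lemma avg_mono:
  fixes f h :: "'g \<Rightarrow> real"
  assumes "cont f" "cont h" "\<And>x. f x \<le> h x"
  shows "avg f \<le> avg h"
  using avg_nonneg[of "\<lambda>x. h x - f x"] assms by (simp add: avg_diff continuous_on_diff)

lemma norm_avg_le_const:
  fixes f :: "'g \<Rightarrow> 'b::banach"
  assumes f: "cont f" and "\<And>x. norm (f x) \<le> c"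
  shows "norm (avg f) \<le> c"
  using norm_avg_le[OF f] avg_mono[of "\<lambda>x. norm (f x)" "\<lambda>_. c"] assms
  by (simp add: avg_const continuous_on_norm)

lemma norm_avg_diff_le:
  fixes f h :: "'g \<Rightarrow> 'b::banach"
  assumes "cont f" "cont h" "\<And>x. norm (f x - h x) \<le> c"
  shows "norm (avg f - avg h) \<le> c"
  unfolding avg_diff[OF assms(1,2), symmetric] using assms
  by (intro norm_avg_le_const continuous_on_diff)

lemma avg_translate:
  fixes f :: "'g \<Rightarrow> 'b::banach"
  assumes f: "cont f"
  shows "avg (\<lambda>x. f (a + x)) = avg f"
proof -
  have fa: "cont (\<lambda>x. f (a + x))"
    by (intro cont_compose[OF f] continuous_intros)
  have "norm (avg (\<lambda>x. f (a + x)) - avg f) \<le> 0 + e" if e: "0 < e" for e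
  proof -
    obtain s where s: "rounding s" "\<And>y. norm (f (a + y) - f (a + s y)) \<le> e / 2"
      using fine_rounding[OF fa half_gt_zero[OF e]] unfolding dist_norm by blast
    \<comment> \<open>The rounding \<open>s\<close> conjugated by the translation: nodes and cells
      are shifted by \<open>a\<close> and the weights are unchanged by invariance, so the Riemann
      sum of \<open>f\<close> along \<open>t\<close> is that of the shifted function along
      \<open>s\<close>.\<close>
    define t where "t y = a + s (- a + y)" for y
    have pre: "t -` {a + p} = (+) a ` (s -` {p})" for p
    proof (intro Set.set_eqI iffI)
      fix y assume "y \<in> t -` {a + p}"
      then have "- a + y \<in> s -` {p}"
        by (simp add: t_def)
      then show "y \<in> (+) a ` (s -` {p})"
        by (intro image_eqI[of _ _ "- a + y"]) (simp add: add.assoc[symmetric])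
    qed (auto simp: t_def add.assoc[symmetric])
    have range: "range t = (+) a ` range s"
    proof (intro Set.set_eqI iffI)
      fix p assume "p \<in> (+) a ` range s"
      then obtain y where "p = a + s y" by blast
      then show "p \<in> range t"
        by (intro image_eqI[of _ _ "a + y"]) (simp_all add: t_def add.assoc[symmetric])
    qed (auto simp: t_def)
    have borel: "(+) a ` A \<in> sets borel" if "A \<in> sets borel" for A
    proof -
      have "(+) a ` A = (\<lambda>x. - a + x) -` A \<inter> space borel"
      proof (intro Set.set_eqI iffI)
        fix x assume "x \<in> (\<lambda>x. - a + x) -` A \<inter> space borel"
        then show "x \<in> (+) a ` A"
          by (intro image_eqI[of _ _ "- a + x"]) (simp_all add: add.assoc[symmetric])
      qed (auto simp: add.assoc[symmetric])
      also have "\<dots> \<in> sets borel"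
        using that by (intro measurable_sets[of _ borel borel] borel_measurable_continuous_onI continuous_intros)
      finally show ?thesis .
    qed
    have "t -` {p} \<in> sets borel" for p
      using pre[of "- a + p"] s(1) borel[of "s -` {- a + p}"] by (simp add: add.assoc[symmetric] rounding_def)
    then have t: "rounding t"
      using s(1) by (simp add: rounding_def range)
    have "riemann_sum t f = (\<Sum>p\<in>range s. measure \<mu> (t -` {a + p}) *\<^sub>R f (a + p))"
      unfolding riemann_sum_def range by (subst sum.reindex) (auto simp: inj_on_def)
    also have "\<dots> = riemann_sum s (\<lambda>x. f (a + x))"
      unfolding riemann_sum_def pre using s(1) by (simp add: measure_translate rounding_def)
    finally have eq: "riemann_sum t f = riemann_sum s (\<lambda>x. f (a + x))" .
    have "norm (avg f - riemann_sum t f) \<le> e / 2"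
    proof (rule avg_riemann[OF f t])
      show "norm (f y - f (t y)) \<le> e / 2" for y
        using s(2)[of "- a + y"] by (simp add: t_def add.assoc[symmetric])
    qed
    moreover have "norm (avg (\<lambda>x. f (a + x)) - riemann_sum t f) \<le> e / 2"
      unfolding eq by (rule avg_riemann[OF fa s])
    ultimately show ?thesis
      using norm_triangle_ineq4[of "avg (\<lambda>x. f (a + x)) - riemann_sum t f" "avg f - riemann_sum t f"] by simp
  qed
  then have "norm (avg (\<lambda>x. f (a + x)) - avg f) \<le> 0"
    by (rule field_le_epsilon)
  then show ?thesis
    by simp
qed

section \<open>Averages depending on a parameter, and interchange of two averages\<close>

lemma continuous_on_section:
  assumes "cont (\<lambda>z. f (fst z) (snd z))"
  shows "cont (f x)" and "cont (\<lambda>x. f x y)"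
proof -
  have "cont (\<lambda>y. (x, y))" "cont (\<lambda>x. (x, y))"
    by (intro continuous_intros)+
  from this[THEN continuous_on_compose2[OF assms]]
  show "cont (f x)" "cont (\<lambda>x. f x y)"
    by simp_all
qed

lemma continuous_on_swap:
  assumes "cont (\<lambda>z. f (fst z) (snd z))"
  shows "cont (\<lambda>z. f (snd z) (fst z))"
proof -
  have "cont (\<lambda>z. (snd z, fst z))"
    by (intro continuous_intros)
  from continuous_on_compose2[OF assms this] show ?thesis
    by simp
qed

text \<open>The tube lemma: compactness of the group makes one neighbourhood of \<open>p\<close>
  serve for all \<open>y\<close>.\<close>

lemma uniform_neighbourhood:
  fixes f :: "'t::topological_space \<Rightarrow> 'g \<Rightarrow> 'b::metric_space"
  assumes f: "cont (\<lambda>z. f (fst z) (snd z))" and "0 < e"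
  shows "\<exists>T. p \<in> T \<and> open T \<and> (\<forall>x\<in>T. \<forall>y. dist (f x y) (f p y) \<le> e)"
proof -
  have "continuous_on (UNIV \<times> UNIV) (\<lambda>(x, y). f x y)"
    using f by (simp add: case_prod_beta)
  from continuous_on_prod_compactE[OF this compact_UNIV UNIV_I[of p] \<open>0 < e\<close>] show ?thesis
    by (metis IntI UNIV_I split_conv)
qed

lemma continuous_on_avg:
  fixes f :: "'g \<Rightarrow> 't::topological_space \<Rightarrow> 'b::banach"
  assumes f: "cont (\<lambda>z. f (fst z) (snd z))"
  shows "cont (\<lambda>y. avg (\<lambda>x. f x y))"
proof -
  have nbhd: "\<exists>T. open T \<and> y \<in> T \<and> (\<forall>y'\<in>T. dist (avg (\<lambda>x. f x y')) (avg (\<lambda>x. f x y)) < e)" if e: "0 < e" for e y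
  proof -
    obtain T where T: "y \<in> T" "open T" "\<forall>y'\<in>T. \<forall>x. dist (f x y') (f x y) \<le> e / 2"
      using uniform_neighbourhood[of "\<lambda>y x. f x y", OF continuous_on_swap[OF f] half_gt_zero[OF e]] by metis
    have "dist (avg (\<lambda>x. f x y')) (avg (\<lambda>x. f x y)) \<le> e / 2" if "y' \<in> T" for y'
      using T(3) that unfolding dist_norm by (intro norm_avg_diff_le continuous_on_section(2)[OF f]) blast
    then have "dist (avg (\<lambda>x. f x y')) (avg (\<lambda>x. f x y)) < e" if "y' \<in> T" for y'
      using le_less_trans[of _ "e / 2" e] e that by force
    then show ?thesis
      using T(1,2) by blast
  qed
  show ?thesis
    unfolding continuous_on_def
  proof (intro ballI tendstoI)
    fix y and e :: real
    assume "0 < e"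
    then obtain T where "open T" "y \<in> T" "\<forall>y'\<in>T. dist (avg (\<lambda>x. f x y')) (avg (\<lambda>x. f x y)) < e"
      using nbhd by metis
    then show "\<forall>\<^sub>F y' in at y within UNIV. dist (avg (\<lambda>x. f x y')) (avg (\<lambda>x. f x y)) < e"
      unfolding eventually_at_topological by (intro exI[of _ T] conjI ballI impI) simp_all
  qed
qed

text \<open>Rounding only the first variable replaces the outer average by a finite sum, which
  commutes with the inner average. The oscillation is uniform in \<open>y\<close> by
  \<open>uniform_neighbourhood\<close>.\<close>

lemma avg_swap:
  fixes f :: "'g \<Rightarrow> 'g \<Rightarrow> 'b::banach"
  assumes f: "cont (\<lambda>z. f (fst z) (snd z))"
  shows "avg (\<lambda>x. avg (\<lambda>y. f x y)) = avg (\<lambda>y. avg (\<lambda>x. f x y))"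
proof -
  have cy: "cont (f x)" and cx: "cont (\<lambda>x. f x y)" for x y
    by (rule continuous_on_section[OF f])+
  have ax: "cont (\<lambda>y. avg (\<lambda>x. f x y))"
    by (rule continuous_on_avg[OF f])
  have ay: "cont (\<lambda>x. avg (\<lambda>y. f x y))"
    by (rule continuous_on_avg[of "\<lambda>y x. f x y", OF continuous_on_swap[OF f]])
  have "norm (avg (\<lambda>x. avg (\<lambda>y. f x y)) - avg (\<lambda>y. avg (\<lambda>x. f x y))) \<le> 0 + e" if e: "0 < e" for e
  proof -
    obtain U where U: "\<And>p. p \<in> U p" "\<And>p. open (U p)" "\<And>p x y. x \<in> U p \<Longrightarrow> norm (f x y - f p y) \<le> e / 2"
      using uniform_neighbourhood[OF f half_gt_zero[OF e]]
      unfolding dist_norm by metis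
    then obtain s where s: "rounding s" "\<And>x. x \<in> U (s x)"
      using rounding_exists[of U] by metis
    have osc: "norm (f x y - f (s x) y) \<le> e / 2" for x y
      using U(3) s(2) by blast
    have "norm (avg (\<lambda>x. avg (f x)) - riemann_sum s (\<lambda>x. avg (f x))) \<le> e / 2"
      by (intro avg_riemann ay s(1) norm_avg_diff_le cy osc)
    moreover have "riemann_sum s (\<lambda>x. avg (f x)) = avg (\<lambda>y. riemann_sum s (\<lambda>x. f x y))"
      unfolding riemann_sum_def
      by (subst avg_sum) (auto intro!: cy continuous_intros avg_linear[OF bounded_linear_scaleR_right, symmetric] sum.cong)
    moreover have "norm (avg (\<lambda>y. avg (\<lambda>x. f x y)) - avg (\<lambda>y. riemann_sum s (\<lambda>x. f x y))) \<le> e / 2"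
    proof -
      have c: "cont (\<lambda>y. riemann_sum s (\<lambda>x. f x y))"
        unfolding riemann_sum_def by (intro continuous_intros cy)
      show ?thesis
        unfolding avg_diff[OF ax c, symmetric]
        by (rule norm_avg_le_const[OF continuous_on_diff[OF ax c]]) (rule avg_riemann[OF cx s(1) osc])
    qed
    ultimately show ?thesis
      using norm_triangle_ineq4[of "avg (\<lambda>x. avg (f x)) - riemann_sum s (\<lambda>x. avg (f x))"
          "avg (\<lambda>y. avg (\<lambda>x. f x y)) - riemann_sum s (\<lambda>x. avg (f x))"] by simp
  qed
  then have "norm (avg (\<lambda>x. avg (\<lambda>y. f x y)) - avg (\<lambda>y. avg (\<lambda>x. f x y))) \<le> 0"
    by (rule field_le_epsilon)
  then show ?thesis
    by simp
qed

text \<open>Unimodularity of a compact group: the double average of \<open>f (- y + x)\<close>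
  equals \<open>avg f\<close> when \<open>x\<close> is integrated first, and the average of
  \<open>f (- y)\<close> when \<open>y\<close> is integrated first, each time by left
  invariance.\<close>

lemma avg_uminus:
  fixes f :: "'g \<Rightarrow> 'b::banach"
  assumes f: "cont f"
  shows "avg (\<lambda>x. f (- x)) = avg f"
proof -
  have c: "cont (\<lambda>z. f (- fst z + snd z))"
    by (intro cont_compose[OF f] continuous_intros)
  have n: "cont (\<lambda>y. f (- y))"
    by (intro cont_compose[OF f] continuous_intros)
  have "avg f = avg (\<lambda>y. avg (\<lambda>x. f (- y + x)))"
    by (simp add: avg_translate[OF f] avg_const)
  also have "\<dots> = avg (\<lambda>x. avg (\<lambda>y. f (- y + x)))"
    by (rule avg_swap[OF c])
  also have "\<dots> = avg (\<lambda>x. avg (\<lambda>y. f (- y)))"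
  proof -
    have "avg (\<lambda>y. f (- (x + y) + x)) = avg (\<lambda>y. f (- y + x))" for x
      by (rule avg_translate[OF continuous_on_section(2)[OF c, simplified]])
    then show ?thesis
      by (simp add: minus_add add.assoc)
  qed
  finally show ?thesis
    by (simp add: avg_const)
qed

lemma avg_translate_right:
  fixes f :: "'g \<Rightarrow> 'b::banach"
  assumes f: "cont f"
  shows "avg (\<lambda>x. f (x + a)) = avg f"
proof -
  have n: "cont (\<lambda>y. f (- y))" "cont (\<lambda>y. f (y + a))"
    by (intro cont_compose[OF f] continuous_intros)+
  have "avg (\<lambda>x. f (x + a)) = avg (\<lambda>x. f (- x + a))"
    using avg_uminus[OF n(2)] by simp
  also have "\<dots> = avg (\<lambda>x. f (- (- a + x)))"
    by (simp add: minus_add)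
  also have "\<dots> = avg f"
    using avg_translate[OF n(1), of "- a"] avg_uminus[OF f] by simp
  finally show ?thesis .
qed

text \<open>Finitely many translates of the set where \<open>f\<close> exceeds
  \<open>f a / 2\<close> cover the group, so a finite sum of translates of \<open>f\<close> is
  bounded below by this constant, while each translate has the same average.\<close>

lemma avg_pos:
  fixes f :: "'g \<Rightarrow> real"
  assumes f: "cont f" and nonneg: "\<And>x. 0 \<le> f x" and "0 < f a"
  shows "0 < avg f"
proof -
  define c where "c = f a / 2"
  have c: "0 < c" "c < f a"
    using \<open>0 < f a\<close> by (simp_all add: c_def)
  have tr: "cont (\<lambda>x. f (b + x))" for b
    by (intro cont_compose[OF f] continuous_intros)
  let ?U = "\<lambda>b. {x. c < f (a + - b + x)}"
  have "open (?U b)" "b \<in> ?U b" for b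
    using c by (auto intro!: open_Collect_less continuous_on_const tr)
  then obtain B where B: "finite B" "UNIV \<subseteq> (\<Union>b\<in>B. ?U b)"
    using compactE_image[OF compact_UNIV, of UNIV ?U] by (metis (no_types, lifting) UNIV_I UN_I subsetI)
  have "c \<le> (\<Sum>b\<in>B. f (a + - b + x))" for x
  proof -
    obtain b where "b \<in> B" "c < f (a + - b + x)"
      using B(2) by blast
    moreover from this have "f (a + - b + x) \<le> (\<Sum>b\<in>B. f (a + - b + x))"
      using B(1) nonneg by (intro member_le_sum) auto
    ultimately show ?thesis
      by simp
  qed
  then have "c \<le> avg (\<lambda>x. \<Sum>b\<in>B. f (a + - b + x))"
    using avg_mono[of "\<lambda>_. c" "\<lambda>x. \<Sum>b\<in>B. f (a + - b + x)"]
    by (simp add: avg_const continuous_on_sum tr del: add_uminus_conv_diff)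
  also have "\<dots> = (\<Sum>b\<in>B. avg f)"
    by (subst avg_sum) (auto simp: avg_translate[OF f] tr simp del: add_uminus_conv_diff)
  finally have "0 < real (card B) * avg f"
    using c(1) by simp
  then show ?thesis
    by (simp add: zero_less_mult_iff)
qed

section \<open>Convolution and the L2 norm\<close>

definition ip :: "('g \<Rightarrow> complex) \<Rightarrow> ('g \<Rightarrow> complex) \<Rightarrow> complex" where
  "ip f h = avg (\<lambda>x. f x * cnj (h x))"

definition l2norm :: "('g \<Rightarrow> complex) \<Rightarrow> real" where
  "l2norm f = sqrt (Re (ip f f))"

definition conv :: "('g \<Rightarrow> complex) \<Rightarrow> ('g \<Rightarrow> complex) \<Rightarrow> 'g \<Rightarrow> complex" where
  "conv f h x = avg (\<lambda>y. f y * h (- y + x))"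

definition invol :: "('g \<Rightarrow> complex) \<Rightarrow> 'g \<Rightarrow> complex" where
  "invol f x = cnj (f (- x))"

definition translate :: "'g \<Rightarrow> ('g \<Rightarrow> 'b) \<Rightarrow> 'g \<Rightarrow> 'b" where
  "translate a f x = f (- a + x)"

lemma cont_translate:
  assumes f: "cont f"
  shows "cont (translate a f)"
  unfolding translate_def by (intro cont_compose[OF f] continuous_intros)

lemma cont_reflect:
  fixes f :: "'g \<Rightarrow> 'b::topological_space"
  assumes f: "cont f"
  shows "cont (\<lambda>y. f (- y + x))"
  by (intro cont_compose[OF f] continuous_intros)

lemma cont_invol:
  assumes f: "cont f"
  shows "cont (invol f)"
  unfolding invol_def by (intro continuous_on_cnj cont_compose[OF f] continuous_intros)

lemma cont_conv:
  assumes f: "cont f" and h: "cont h"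
  shows "cont (conv f h)"
  unfolding conv_def
  by (intro continuous_on_avg continuous_on_mult cont_compose[OF f] cont_compose[OF h] continuous_intros)

lemmas cont_intros = continuous_on_mult continuous_on_add continuous_on_diff continuous_on_const
  continuous_on_sum continuous_on_cnj cont_conv cont_invol cont_translate

lemma ip_cnj: "cont f \<Longrightarrow> cont h \<Longrightarrow> cnj (ip f h) = ip h f"
  unfolding ip_def by (subst avg_cnj[symmetric]) (auto intro!: cont_intros simp: mult.commute)

lemma ip_diff_left: "cont f \<Longrightarrow> cont h \<Longrightarrow> cont k \<Longrightarrow> ip (\<lambda>x. f x - h x) k = ip f k - ip h k"
  unfolding ip_def left_diff_distrib by (intro avg_diff cont_intros)

lemma ip_scale_left: "cont f \<Longrightarrow> cont k \<Longrightarrow> ip (\<lambda>x. c * f x) k = c * ip f k"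
  unfolding ip_def mult.assoc by (intro avg_mult_left cont_intros)

lemma ip_sum_left:
  assumes "\<And>i. i \<in> A \<Longrightarrow> cont (f i)" "cont k"
  shows "ip (\<lambda>x. \<Sum>i\<in>A. f i x) k = (\<Sum>i\<in>A. ip (f i) k)"
  unfolding ip_def sum_distrib_right by (intro avg_sum cont_intros assms)

lemma ip_diff_right: "cont f \<Longrightarrow> cont h \<Longrightarrow> cont k \<Longrightarrow> ip k (\<lambda>x. f x - h x) = ip k f - ip k h"
  unfolding ip_def complex_cnj_diff right_diff_distrib by (intro avg_diff cont_intros)

lemma ip_scale_right:
  assumes "cont f" "cont k"
  shows "ip k (\<lambda>x. c * f x) = cnj c * ip k f"
proof -
  have "(\<lambda>x. k x * cnj (c * f x)) = (\<lambda>x. cnj c * (k x * cnj (f x)))"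
    by auto
  then show ?thesis
    unfolding ip_def by (simp add: avg_mult_left cont_intros assms)
qed

lemma ip_sum_right:
  assumes "\<And>i. i \<in> A \<Longrightarrow> cont (f i)" "cont k"
  shows "ip k (\<lambda>x. \<Sum>i\<in>A. f i x) = (\<Sum>i\<in>A. ip k (f i))"
  unfolding ip_def cnj_sum sum_distrib_left by (intro avg_sum cont_intros assms)

lemma ip_self_avg: "cont f \<Longrightarrow> ip f f = of_real (avg (\<lambda>x. (cmod (f x))\<^sup>2))"
  unfolding ip_def complex_norm_square[symmetric]
  by (rule avg_linear[OF bounded_linear_of_real]) (intro continuous_intros)

lemma l2norm_square: "cont f \<Longrightarrow> (l2norm f)\<^sup>2 = avg (\<lambda>x. (cmod (f x))\<^sup>2)"
  unfolding l2norm_def using avg_nonneg[of "\<lambda>x. (cmod (f x))\<^sup>2"]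
  by (simp add: ip_self_avg continuous_intros)

lemma l2norm_nonneg: "cont f \<Longrightarrow> 0 \<le> l2norm f"
  unfolding l2norm_def using avg_nonneg[of "\<lambda>x. (cmod (f x))\<^sup>2"]
  by (simp add: ip_self_avg continuous_intros)

lemma ip_self: "cont f \<Longrightarrow> ip f f = of_real ((l2norm f)\<^sup>2)"
  by (simp add: l2norm_square ip_self_avg)

lemma l2norm_eq_0:
  assumes f: "cont f" and "l2norm f = 0"
  shows "f x = 0"
proof (rule ccontr)
  assume "f x \<noteq> 0"
  have "cont (\<lambda>x. (cmod (f x))\<^sup>2)"
    by (intro continuous_intros f)
  then have "0 < avg (\<lambda>x. (cmod (f x))\<^sup>2)"
    by (rule avg_pos[of _ x]) (use \<open>f x \<noteq> 0\<close> in simp_all)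
  then show False
    using assms by (simp flip: l2norm_square)
qed

lemma l2norm_le:
  assumes f: "cont f" and "\<And>x. cmod (f x) \<le> c"
  shows "l2norm f \<le> c"
proof (rule power2_le_imp_le)
  show c: "0 \<le> c"
    using order_trans[OF norm_ge_zero assms(2)] .
  have "avg (\<lambda>x. (cmod (f x))\<^sup>2) \<le> avg (\<lambda>_. c\<^sup>2)"
    using f assms(2) by (intro avg_mono continuous_intros power_mono) simp_all
  then show "(l2norm f)\<^sup>2 \<le> c\<^sup>2"
    by (simp add: l2norm_square f avg_const)
qed

lemma l2norm_square_diff:
  assumes f: "cont f" and h: "cont h"
  shows "(l2norm (\<lambda>x. f x - h x))\<^sup>2 = (l2norm f)\<^sup>2 - 2 * Re (ip f h) + (l2norm h)\<^sup>2"
proof -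
  have c: "cont (\<lambda>x. f x - h x)"
    by (intro cont_intros f h)
  have "ip (\<lambda>x. f x - h x) (\<lambda>x. f x - h x) = ip f f - ip f h - (cnj (ip f h) - ip h h)"
    by (simp add: ip_diff_left ip_diff_right f h c ip_cnj)
  then have "Re (ip (\<lambda>x. f x - h x) (\<lambda>x. f x - h x)) = Re (ip f f) - 2 * Re (ip f h) + Re (ip h h)"
    by simp
  then show ?thesis
    by (simp add: ip_self f h c)
qed

lemma cauchy_schwarz:
  assumes f: "cont f" and h: "cont h"
  shows "cmod (ip f h) \<le> l2norm f * l2norm h"
proof (cases "l2norm h = 0")
  case True
  have "h = (\<lambda>_. 0)"
    using l2norm_eq_0[OF h True] by auto
  then show ?thesis
    using l2norm_nonneg[OF f] l2norm_nonneg[OF h] by (simp add: ip_def avg_const)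
next
  case False
  then have pos: "0 < l2norm h"
    using l2norm_nonneg[OF h] by simp
  define c where "c = ip f h / of_real ((l2norm h)\<^sup>2)"
  have ch: "cont (\<lambda>x. c * h x)"
    by (intro cont_intros h)
  have "ip f (\<lambda>x. c * h x) = cnj c * ip f h"
    by (rule ip_scale_right[OF h f])
  also have "\<dots> = cnj (ip f h) * ip f h / of_real ((l2norm h)\<^sup>2)"
    by (simp add: c_def)
  finally have *: "ip f (\<lambda>x. c * h x) = of_real ((cmod (ip f h))\<^sup>2 / (l2norm h)\<^sup>2)"
    unfolding of_real_divide complex_norm_square by (simp add: mult.commute)
  have "ip (\<lambda>x. c * h x) (\<lambda>x. c * h x) = (c * cnj c) * ip h h"
    by (simp add: ip_scale_left ip_scale_right h ch)
  also have "\<dots> = of_real ((cmod c)\<^sup>2 * (l2norm h)\<^sup>2)"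
    unfolding of_real_mult complex_norm_square ip_self[OF h] ..
  finally have "(l2norm (\<lambda>x. c * h x))\<^sup>2 = (cmod c)\<^sup>2 * (l2norm h)\<^sup>2"
    unfolding ip_self[OF ch] of_real_eq_iff .
  also have "\<dots> = (cmod (ip f h))\<^sup>2 / (l2norm h)\<^sup>2"
  proof -
    have "cmod c = cmod (ip f h) / (l2norm h)\<^sup>2"
      unfolding c_def norm_divide norm_of_real by simp
    then show ?thesis
      using pos by (simp add: power2_eq_square)
  qed
  finally have "0 \<le> (l2norm f)\<^sup>2 - 2 * ((cmod (ip f h))\<^sup>2 / (l2norm h)\<^sup>2) + (cmod (ip f h))\<^sup>2 / (l2norm h)\<^sup>2"
    using l2norm_square_diff[OF f ch] zero_le_power2[of "l2norm (\<lambda>x. f x - c * h x)"] unfolding * by simp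
  then have "(cmod (ip f h))\<^sup>2 \<le> (l2norm f)\<^sup>2 * (l2norm h)\<^sup>2"
    using pos by (simp add: field_simps)
  then have "(cmod (ip f h))\<^sup>2 \<le> (l2norm f * l2norm h)\<^sup>2"
    by (simp add: power_mult_distrib)
  then show ?thesis
    by (rule power2_le_imp_le) (use l2norm_nonneg[OF f] l2norm_nonneg[OF h] in simp)
qed

lemma l2norm_triangle_diff:
  assumes f: "cont f" and h: "cont h"
  shows "l2norm (\<lambda>x. f x - h x) \<le> l2norm f + l2norm h"
proof (rule power2_le_imp_le)
  have "- Re (ip f h) \<le> l2norm f * l2norm h"
    using cauchy_schwarz[OF f h] abs_Re_le_cmod[of "ip f h"] by linarith
  then show "(l2norm (\<lambda>x. f x - h x))\<^sup>2 \<le> (l2norm f + l2norm h)\<^sup>2"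
    unfolding l2norm_square_diff[OF f h] power2_sum by linarith
qed (use l2norm_nonneg[OF f] l2norm_nonneg[OF h] in simp)

lemma l2norm_minus_commute: "l2norm (\<lambda>x. f x - h x) = l2norm (\<lambda>x. h x - f x)"
proof -
  have "(f x - h x) * cnj (f x - h x) = (h x - f x) * cnj (h x - f x)" for x
    by (simp add: algebra_simps)
  then show ?thesis
    by (simp add: l2norm_def ip_def)
qed

lemma l2norm_diff_trans:
  assumes "cont f" "cont h" "cont k"
  shows "l2norm (\<lambda>x. f x - k x) \<le> l2norm (\<lambda>x. f x - h x) + l2norm (\<lambda>x. h x - k x)"
  using l2norm_triangle_diff[of "\<lambda>x. f x - h x" "\<lambda>x. k x - h x"] assms
  by (simp add: cont_intros l2norm_minus_commute[of k h])

lemma avg_cmod_le_l2norm: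
  assumes f: "cont f"
  shows "avg (\<lambda>x. cmod (f x)) \<le> l2norm f"
proof -
  let ?a = "\<lambda>x. complex_of_real (cmod (f x))"
  have a: "cont ?a"
    by (intro continuous_intros f)
  have "ip ?a (\<lambda>_. 1) = of_real (avg (\<lambda>x. cmod (f x)))"
    unfolding ip_def using avg_linear[OF bounded_linear_of_real, of "\<lambda>x. cmod (f x)"] f
    by (simp add: continuous_on_norm)
  moreover have "l2norm (\<lambda>_. 1) = 1"
    by (simp add: l2norm_def ip_def avg_const)
  moreover have "l2norm ?a = l2norm f"
    unfolding l2norm_def ip_self_avg[OF a] ip_self_avg[OF f] by simp
  ultimately show ?thesis
    using cauchy_schwarz[OF a, of "\<lambda>_. 1"] by simp
qed

section \<open>The convolution algebra with its involution\<close>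

lemma invol_invol [simp]: "invol (invol f) = f"
  by (auto simp: invol_def)

lemma conv_eq_ip: "conv f h x = ip f (translate x (invol h))"
  by (simp add: conv_def ip_def invol_def translate_def minus_add)

lemma ip_eq_conv: "ip f h = conv f (invol h) 0"
  by (simp add: conv_def ip_def invol_def)

lemma l2norm_translate: "cont f \<Longrightarrow> l2norm (translate a f) = l2norm f"
  unfolding l2norm_def ip_def translate_def
  by (subst avg_translate[of "\<lambda>x. f x * cnj (f x)"]) (auto intro!: cont_intros)

lemma l2norm_invol: "cont f \<Longrightarrow> l2norm (invol f) = l2norm f"
  unfolding l2norm_def ip_def invol_def complex_cnj_cnj mult.commute[of "cnj _"]
  by (subst avg_uminus[of "\<lambda>x. f x * cnj (f x)"]) (auto intro!: cont_intros)

text \<open>A value of a convolution is a scalar product with a translated adjoint, so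
  Cauchy-Schwarz bounds it uniformly in \<open>x\<close>. Through this estimate convergence in
  \<open>l2norm\<close> becomes uniform after one convolution.\<close>

lemma cmod_conv_le:
  assumes f: "cont f" and h: "cont h"
  shows "cmod (conv f h x) \<le> l2norm f * l2norm h"
  using cauchy_schwarz[OF f cont_translate[OF cont_invol[OF h]], of x]
  by (simp add: conv_eq_ip l2norm_translate l2norm_invol cont_invol h)

lemma l2norm_conv_le: "cont f \<Longrightarrow> cont h \<Longrightarrow> l2norm (conv f h) \<le> l2norm f * l2norm h"
  by (intro l2norm_le cont_conv cmod_conv_le)

lemma conv_diff_left: "cont f \<Longrightarrow> cont h \<Longrightarrow> cont k \<Longrightarrow> conv (\<lambda>x. f x - h x) k x = conv f k x - conv h k x"
  unfolding conv_eq_ip by (intro ip_diff_left cont_intros)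

lemma conv_diff_right:
  assumes "cont f" "cont h" "cont k"
  shows "conv k (\<lambda>x. f x - h x) x = conv k f x - conv k h x"
proof -
  have "translate x (invol (\<lambda>x. f x - h x)) = (\<lambda>y. translate x (invol f) y - translate x (invol h) y)"
    by (simp add: translate_def invol_def fun_eq_iff)
  then show ?thesis
    unfolding conv_eq_ip by (simp add: ip_diff_right assms cont_intros)
qed

lemma conv_scale_left: "cont f \<Longrightarrow> cont k \<Longrightarrow> conv (\<lambda>x. c * f x) k x = c * conv f k x"
  unfolding conv_eq_ip by (intro ip_scale_left cont_intros)

lemma conv_scale_right:
  assumes "cont f" "cont k"
  shows "conv k (\<lambda>x. c * f x) x = c * conv k f x"
proof -
  have "translate x (invol (\<lambda>x. c * f x)) = (\<lambda>y. cnj c * translate x (invol f) y)"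
    by (simp add: translate_def invol_def fun_eq_iff)
  then show ?thesis
    unfolding conv_eq_ip by (simp add: ip_scale_right assms cont_intros)
qed

lemma conv_sum_left:
  assumes "\<And>i. i \<in> A \<Longrightarrow> cont (f i)" "cont k"
  shows "conv (\<lambda>x. \<Sum>i\<in>A. f i x) k x = (\<Sum>i\<in>A. conv (f i) k x)"
  unfolding conv_eq_ip by (intro ip_sum_left cont_intros assms)

lemma conv_sum_right:
  assumes "\<And>i. i \<in> A \<Longrightarrow> cont (f i)" "cont k"
  shows "conv k (\<lambda>x. \<Sum>i\<in>A. f i x) x = (\<Sum>i\<in>A. conv k (f i) x)"
proof -
  have "translate x (invol (\<lambda>x. \<Sum>i\<in>A. f i x)) = (\<lambda>y. \<Sum>i\<in>A. translate x (invol (f i)) y)"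
    by (simp add: translate_def invol_def fun_eq_iff)
  then show ?thesis
    unfolding conv_eq_ip by (simp add: ip_sum_right assms cont_intros)
qed

lemma conv_zero_left: "conv (\<lambda>_. 0) k = (\<lambda>_. 0)"
  by (rule ext) (simp add: conv_def avg_const)

lemma conv_zero_right: "conv k (\<lambda>_. 0) = (\<lambda>_. 0)"
  by (rule ext) (simp add: conv_def avg_const)

lemma conv_assoc:
  assumes f: "cont f" and h: "cont h" and k: "cont k"
  shows "conv (conv f h) k = conv f (conv h k)"
proof
  fix x
  have c: "cont (\<lambda>z. f (snd z) * h (- snd z + fst z) * k (- fst z + x))"
    by (intro continuous_on_mult cont_compose[OF f] cont_compose[OF h] cont_compose[OF k] continuous_intros)
  have hk: "cont (\<lambda>y. h (- z + y) * k (- y + x))" for z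
    by (intro continuous_on_mult cont_reflect[OF k] cont_compose[OF h] continuous_intros)
  have inner: "avg (\<lambda>y. h (- z + y) * k (- y + x)) = conv h k (- z + x)" for z
    using avg_translate[OF hk[of z], of z] by (simp add: conv_def minus_add add.assoc[symmetric])
  have fh: "cont (\<lambda>z. f z * h (- z + y))" for y
    by (intro continuous_on_mult f cont_reflect[OF h])
  have "conv (conv f h) k x = avg (\<lambda>y. avg (\<lambda>z. f z * h (- z + y) * k (- y + x)))"
    unfolding conv_def by (simp add: avg_mult_right fh)
  also have "\<dots> = avg (\<lambda>z. avg (\<lambda>y. f z * h (- z + y) * k (- y + x)))"
    by (rule avg_swap[OF c])
  also have "\<dots> = avg (\<lambda>z. f z * avg (\<lambda>y. h (- z + y) * k (- y + x)))"
    unfolding mult.assoc by (simp add: avg_mult_left hk)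
  also have "\<dots> = avg (\<lambda>z. f z * conv h k (- z + x))"
    unfolding inner ..
  finally show "conv (conv f h) k x = conv f (conv h k) x"
    by (simp add: conv_def)
qed

lemma invol_conv:
  assumes f: "cont f" and h: "cont h"
  shows "invol (conv f h) = conv (invol h) (invol f)"
proof
  fix x
  have c: "cont (\<lambda>y. f y * h (- y + - x))"
    by (intro continuous_on_mult f cont_reflect[OF h])
  have c': "cont (\<lambda>y. f (- x + y) * h (- y))"
    by (intro continuous_on_mult cont_compose[OF f] cont_compose[OF h] continuous_intros)
  have "invol (conv f h) x = cnj (avg (\<lambda>y. f (- x + y) * h (- (- x + y) + - x)))"
    unfolding invol_def conv_def using avg_translate[OF c, of "- x"] by simp
  also have "\<dots> = cnj (avg (\<lambda>y. f (- x + y) * h (- y)))"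
    by (simp add: minus_add add.assoc)
  also have "\<dots> = conv (invol h) (invol f) x"
    unfolding avg_cnj[OF c', symmetric] by (simp add: invol_def conv_def minus_add mult.commute)
  finally show "invol (conv f h) x = conv (invol h) (invol f) x" .
qed

lemma ip_conv_left:
  assumes "cont f" "cont h" "cont k"
  shows "ip (conv f h) k = ip f (conv k (invol h))"
  by (simp add: ip_eq_conv conv_assoc assms cont_intros invol_conv)

lemma conv_translate:
  assumes f: "cont f" and h: "cont h"
  shows "conv (translate a f) h = translate a (conv f h)"
proof
  fix x
  have c: "cont (\<lambda>y. translate a f y * h (- y + x))"
    by (intro continuous_on_mult cont_translate f cont_reflect[OF h])
  have "conv (translate a f) h x = avg (\<lambda>y. translate a f (a + y) * h (- (a + y) + x))"
    unfolding conv_def by (rule avg_translate[OF c, symmetric])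
  then show "conv (translate a f) h x = translate a (conv f h) x"
    by (simp add: translate_def conv_def minus_add add.assoc[symmetric])
qed

text \<open>Replace \<open>y\<close> by \<open>x - y\<close>; centrality then turns
  \<open>e (x - y)\<close> into \<open>e (- y + x)\<close>.\<close>

lemma conv_commute:
  assumes f: "cont f" and e: "cont e" and central: "\<And>x y. e (x + y) = e (y + x)"
  shows "conv e f = conv f e"
proof
  fix x
  have c: "cont (\<lambda>y. e y * f (- y + x))"
    by (intro continuous_on_mult e cont_reflect[OF f])
  have c': "cont (\<lambda>y. e (x + y) * f (- (x + y) + x))"
    by (intro continuous_on_mult cont_compose[OF e] cont_compose[OF f] continuous_intros)
  have "conv e f x = avg (\<lambda>y. e (x + y) * f (- (x + y) + x))"
    unfolding conv_def by (rule avg_translate[OF c, symmetric])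
  also have "\<dots> = avg (\<lambda>y. e (x + - y) * f (- (x + - y) + x))"
    by (rule avg_uminus[OF c', symmetric])
  also have "\<dots> = conv f e x"
    unfolding conv_def using central[of x] by (simp add: minus_add add.assoc mult.commute del: add_uminus_conv_diff)
  finally show "conv e f x = conv f e x" .
qed

lemma conv_tendsto:
  assumes lim: "uniform_limit UNIV F f sequentially" and c: "\<And>n. cont (F n)" "cont f" and h: "cont h"
  shows "(\<lambda>n. conv (F n) h x) \<longlonglongrightarrow> conv f h x" and "(\<lambda>n. conv h (F n) x) \<longlonglongrightarrow> conv h f x"
proof -
  have small: "\<forall>\<^sub>F n in sequentially. l2norm (\<lambda>x. F n x - f x) * l2norm h < e" if e: "0 < e" for e
  proof -
    define d where "d = e / (l2norm h + 1)"
    have h0: "0 \<le> l2norm h"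
      by (rule l2norm_nonneg[OF h])
    have d: "0 < d" "d * l2norm h < e"
      using e h0 by (auto simp: d_def field_simps)
    have "\<forall>\<^sub>F n in sequentially. \<forall>x\<in>UNIV. dist (F n x) (f x) < d"
      using lim d(1) by (auto simp: uniform_limit_iff)
    then show ?thesis
    proof eventually_elim
      case (elim n)
      have "l2norm (\<lambda>x. F n x - f x) \<le> d"
        using elim by (intro l2norm_le cont_intros c) (auto simp: dist_norm less_imp_le)
      then show ?case
        using d(2) mult_right_mono[OF _ h0] by fastforce
    qed
  qed
  show "(\<lambda>n. conv (F n) h x) \<longlonglongrightarrow> conv f h x"
  proof (rule tendstoI)
    fix e :: real assume "0 < e"
    from small[OF this] show "\<forall>\<^sub>F n in sequentially. dist (conv (F n) h x) (conv f h x) < e"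
    proof eventually_elim
      case (elim n)
      then show ?case
        using cmod_conv_le[of "\<lambda>x. F n x - f x" h x] c h
        by (simp add: dist_norm conv_diff_left cont_intros)
    qed
  qed
  show "(\<lambda>n. conv h (F n) x) \<longlonglongrightarrow> conv h f x"
  proof (rule tendstoI)
    fix e :: real assume "0 < e"
    from small[OF this] show "\<forall>\<^sub>F n in sequentially. dist (conv h (F n) x) (conv h f x) < e"
    proof eventually_elim
      case (elim n)
      then show ?case
        using cmod_conv_le[of h "\<lambda>x. F n x - f x" x] c h
        by (simp add: dist_norm conv_diff_right cont_intros mult.commute)
    qed
  qed
qed

end

section \<open>Representations and Schur orthogonality\<close>

lemma index_mult_mat_sum:
  assumes "A \<in> carrier_mat n k" "B \<in> carrier_mat k m" "i < n" "j < m"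
  shows "(A * B) $$ (i, j) = (\<Sum>l<k. A $$ (i, l) * B $$ (l, j))"
  using assms by (auto simp: scalar_prod_def lessThan_atLeast0 intro!: sum.cong)

lemma index_mult_mat_vec_sum:
  assumes "A \<in> carrier_mat n k" "v \<in> carrier_vec k" "i < n"
  shows "(A *\<^sub>v v) $ i = (\<Sum>l<k. A $$ (i, l) * v $ l)"
  using assms by (auto simp: scalar_prod_def lessThan_atLeast0 intro!: sum.cong)

lemma dim_mat_adjoint [simp]: "dim_row (mat_adjoint A) = dim_col A" "dim_col (mat_adjoint A) = dim_row A"
  by (auto simp: mat_adjoint_def)

lemma mat_adjoint_carrier [simp]: "A \<in> carrier_mat n m \<Longrightarrow> mat_adjoint A \<in> carrier_mat m n"
  by (auto simp: mat_adjoint_def)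

lemma index_mat_adjoint:
  fixes A :: "complex mat"
  assumes "A \<in> carrier_mat n m" "i < m" "j < n"
  shows "mat_adjoint A $$ (i, j) = cnj (A $$ (j, i))"
  using assms by (auto simp: mat_adjoint_def mat_of_rows_def)

lemma mat_adjoint_mult:
  fixes A B :: "complex mat"
  assumes A: "A \<in> carrier_mat n k" and B: "B \<in> carrier_mat k m"
  shows "mat_adjoint (A * B) = mat_adjoint B * mat_adjoint A"
proof (rule eq_matI)
  have AB: "A * B \<in> carrier_mat n m"
    using A B by simp
  fix i j assume "i < dim_row (mat_adjoint B * mat_adjoint A)" "j < dim_col (mat_adjoint B * mat_adjoint A)"
  then have ij: "i < m" "j < n"
    using mat_adjoint_carrier[OF A] mat_adjoint_carrier[OF B] by auto
  have "mat_adjoint (A * B) $$ (i, j) = (\<Sum>l<k. cnj (A $$ (j, l)) * cnj (B $$ (l, i)))"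
    using ij by (simp add: index_mat_adjoint[OF AB] index_mult_mat_sum[OF A B])
  also have "\<dots> = (mat_adjoint B * mat_adjoint A) $$ (i, j)"
    using ij by (simp add: index_mult_mat_sum[OF mat_adjoint_carrier[OF B] mat_adjoint_carrier[OF A]]
        index_mat_adjoint[OF A] index_mat_adjoint[OF B] mult.commute)
  finally show "mat_adjoint (A * B) $$ (i, j) = (mat_adjoint B * mat_adjoint A) $$ (i, j)" .
qed (use mat_adjoint_carrier[OF A] mat_adjoint_carrier[OF B] mat_adjoint_carrier[of "A * B" n m] A B in auto)

lemma mat_adjoint_adjoint:
  fixes A :: "complex mat"
  assumes A: "A \<in> carrier_mat n m"
  shows "mat_adjoint (mat_adjoint A) = A"
  using A mat_adjoint_carrier[OF A] mat_adjoint_carrier[OF mat_adjoint_carrier[OF A]]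
  by (intro eq_matI) (auto simp: index_mat_adjoint[OF A] index_mat_adjoint[OF mat_adjoint_carrier[OF A]])

lemma sum_diag_mult_commute:
  fixes A B :: "complex mat"
  assumes A: "A \<in> carrier_mat n m" and B: "B \<in> carrier_mat m n"
  shows "(\<Sum>i<n. (A * B) $$ (i, i)) = (\<Sum>j<m. (B * A) $$ (j, j))"
proof -
  have "(\<Sum>i<n. (A * B) $$ (i, i)) = (\<Sum>i<n. \<Sum>j<m. A $$ (i, j) * B $$ (j, i))"
    by (simp add: index_mult_mat_sum[OF A B])
  also have "\<dots> = (\<Sum>j<m. \<Sum>i<n. B $$ (j, i) * A $$ (i, j))"
    by (subst sum.swap) (simp add: mult.commute)
  finally show ?thesis
    by (simp add: index_mult_mat_sum[OF B A])
qed

subsection \<open>Schur's lemma\<close>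

lemma rep_carrier: "unitary_rep n \<pi> \<Longrightarrow> \<pi> g \<in> carrier_mat n n"
  by (simp add: unitary_rep_def unitary_mat_def)

lemma rep_add: "unitary_rep n \<pi> \<Longrightarrow> \<pi> (g + h) = \<pi> g * \<pi> h"
  by (simp add: unitary_rep_def)

lemma rep_zero:
  assumes "unitary_rep n \<pi>"
  shows "\<pi> 0 = 1\<^sub>m n"
proof -
  have c: "\<pi> 0 \<in> carrier_mat n n" and a: "mat_adjoint (\<pi> 0) * \<pi> 0 = 1\<^sub>m n"
    using assms by (auto simp: unitary_rep_def unitary_mat_def)
  have "\<pi> 0 = mat_adjoint (\<pi> 0) * \<pi> 0 * \<pi> 0"
    unfolding a by (rule left_mult_one_mat[OF c, symmetric])
  also have "\<dots> = mat_adjoint (\<pi> 0) * \<pi> (0 + 0)"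
    unfolding rep_add[OF assms] by (rule assoc_mult_mat[OF mat_adjoint_carrier[OF c] c c])
  finally show ?thesis
    using a by simp
qed

lemma rep_uminus:
  assumes "unitary_rep n \<pi>"
  shows "\<pi> (- g) = mat_adjoint (\<pi> g)"
proof -
  have c: "\<pi> h \<in> carrier_mat n n" and a: "mat_adjoint (\<pi> h) * \<pi> h = 1\<^sub>m n" for h
    using assms by (auto simp: unitary_rep_def unitary_mat_def)
  have "\<pi> (- g) = mat_adjoint (\<pi> g) * \<pi> g * \<pi> (- g)"
    unfolding a by (rule left_mult_one_mat[OF c, symmetric])
  also have "\<dots> = mat_adjoint (\<pi> g) * \<pi> (g + - g)"
    unfolding rep_add[OF assms] by (rule assoc_mult_mat[OF mat_adjoint_carrier[OF c] c c])
  finally show ?thesis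
    using right_mult_one_mat[OF mat_adjoint_carrier[OF c[of g]]] by (simp add: rep_zero[OF assms])
qed

lemma rep_uminus_index:
  assumes "unitary_rep n \<pi>" "i < n" "j < n"
  shows "\<pi> (- g) $$ (i, j) = cnj (\<pi> g $$ (j, i))"
  using assms by (simp add: rep_uminus index_mat_adjoint[OF rep_carrier])

lemma rep_add_index:
  assumes "unitary_rep n \<pi>" "i < n" "j < n"
  shows "\<pi> (g + h) $$ (i, j) = (\<Sum>k<n. \<pi> g $$ (i, k) * \<pi> h $$ (k, j))"
  using assms by (simp add: rep_add index_mult_mat_sum[OF rep_carrier rep_carrier])

lemma rep_dim: "unitary_rep n \<pi> \<Longrightarrow> rep_dim \<pi> = n"
  using rep_carrier[of n \<pi> 0] by (simp add: rep_dim_def)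

lemma subspaceI_vec:
  fixes W :: "complex vec set"
  assumes "W \<subseteq> carrier_vec n" "0\<^sub>v n \<in> W" "\<And>v w. v \<in> W \<Longrightarrow> w \<in> W \<Longrightarrow> v + w \<in> W"
    "\<And>c v. v \<in> W \<Longrightarrow> c \<cdot>\<^sub>v v \<in> W"
  shows "VectorSpace.subspace class_ring W (module_vec TYPE(complex) n)"
  using assms vec_vs[of n] vec_module[of n]
  by (auto simp: VectorSpace.subspace_def LinearCombinations.submodule_def module_vec_simps class_ring_simps)

lemma subspaceD_vec:
  fixes W :: "complex vec set"
  assumes "VectorSpace.subspace class_ring W (module_vec TYPE(complex) n)"
  shows "W \<subseteq> carrier_vec n" "0\<^sub>v n \<in> W" "v \<in> W \<Longrightarrow> w \<in> W \<Longrightarrow> v + w \<in> W" "v \<in> W \<Longrightarrow> c \<cdot>\<^sub>v v \<in> W"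
  using assms
  by (auto simp: VectorSpace.subspace_def LinearCombinations.submodule_def module_vec_simps class_ring_simps)

text \<open>\<open>X\<close> has an eigenvalue because \<open>0 < n\<close>; the eigenspace is
  nonzero and invariant under all \<open>\<rho> g\<close>, hence the whole space.\<close>

lemma schur_scalar:
  assumes \<rho>: "irreducible_unitary_rep n \<rho>" and X: "X \<in> carrier_mat n n"
    and comm: "\<And>g. X * \<rho> g = \<rho> g * X"
  obtains c where "X = c \<cdot>\<^sub>m 1\<^sub>m n"
proof -
  have n: "0 < n" and rep: "unitary_rep n \<rho>"
    using \<rho> by (auto simp: irreducible_unitary_rep_def)
  obtain c v where v: "v \<in> carrier_vec n" "v \<noteq> 0\<^sub>v n" "X *\<^sub>v v = c \<cdot>\<^sub>v v"
    using spectrum_non_empty[OF X n] X by (auto simp: spectrum_def eigenvalue_def eigenvector_def)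
  define W where "W = {w \<in> carrier_vec n. X *\<^sub>v w = c \<cdot>\<^sub>v w}"
  have "VectorSpace.subspace class_ring W (module_vec TYPE(complex) n)"
  proof (rule subspaceI_vec)
    show "u + w \<in> W" if "u \<in> W" "w \<in> W" for u w
      using that X by (auto simp: W_def mult_add_distrib_mat_vec smult_add_distrib_vec)
    show "a \<cdot>\<^sub>v w \<in> W" if "w \<in> W" for a w
      using that X by (auto simp: W_def mult_mat_vec smult_smult_assoc mult.commute)
  qed (use X in \<open>auto simp: W_def\<close>)
  moreover have "\<rho> g *\<^sub>v w \<in> W" if w: "w \<in> W" for g w
  proof -
    have c: "\<rho> g \<in> carrier_mat n n"
      by (rule rep_carrier[OF rep])
    have "X *\<^sub>v (\<rho> g *\<^sub>v w) = (\<rho> g * X) *\<^sub>v w"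
      using w X c by (simp add: W_def flip: comm)
    also have "\<dots> = c \<cdot>\<^sub>v (\<rho> g *\<^sub>v w)"
      using w X c by (simp add: W_def mult_mat_vec)
    finally show ?thesis
      using w c by (simp add: W_def)
  qed
  moreover have "v \<in> W"
    using v by (simp add: W_def)
  ultimately have W: "W = carrier_vec n"
    using \<rho> v(2) unfolding irreducible_unitary_rep_def by blast
  have "X $$ (i, j) = (c \<cdot>\<^sub>m 1\<^sub>m n) $$ (i, j)" if "i < n" "j < n" for i j
  proof -
    have "unit_vec n j \<in> W"
      by (simp add: W)
    then have "(X *\<^sub>v unit_vec n j) $ i = (c \<cdot>\<^sub>v unit_vec n j) $ i"
      by (simp add: W_def)
    moreover have "(X *\<^sub>v unit_vec n j) $ i = X $$ (i, j)"
      using that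
      by (subst index_mult_mat_vec_sum[OF X unit_vec_carrier]) (auto simp: if_distrib cong: if_cong)
    ultimately show ?thesis
      using that by simp
  qed
  then have "X = c \<cdot>\<^sub>m 1\<^sub>m n"
    using X by (intro eq_matI) auto
  then show ?thesis
    by (rule that)
qed

text \<open>Both \<open>mat_adjoint T * T\<close> and \<open>T * mat_adjoint T\<close> commute with
  an irreducible representation and are scalar. The scalars agree, a trace comparison equates the
  dimensions, and rescaling makes \<open>T\<close> unitary, as \<open>rep_equiv\<close>
  demands.\<close>

lemma schur_intertwiner:
  assumes \<pi>: "irreducible_unitary_rep n \<pi>" and \<rho>: "irreducible_unitary_rep m \<rho>"
    and T: "T \<in> carrier_mat n m" and inter: "\<And>g. \<pi> g * T = T * \<rho> g" and "T \<noteq> 0\<^sub>m n m"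
  shows "(\<rho>, \<pi>) \<in> rep_equiv"
proof -
  have rep: "unitary_rep n \<pi>" "unitary_rep m \<rho>"
    using \<pi> \<rho> by (auto simp: irreducible_unitary_rep_def)
  note c\<pi> = rep_carrier[OF rep(1)] and c\<rho> = rep_carrier[OF rep(2)]
  define A where "A = mat_adjoint T"
  have A: "A \<in> carrier_mat m n"
    using T by (simp add: A_def)
  \<comment> \<open>Adjoints are taken in the intertwining relation at \<open>- g\<close>, since
    \<open>\<pi> (- g)\<close> is the adjoint of \<open>\<pi> g\<close>.\<close>
  have inter': "A * \<pi> g = \<rho> g * A" for g
  proof -
    have "mat_adjoint (\<pi> (- g) * T) = mat_adjoint (T * \<rho> (- g))"
      by (simp add: inter)
    then have "A * mat_adjoint (\<pi> (- g)) = mat_adjoint (\<rho> (- g)) * A"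
      by (simp add: A_def mat_adjoint_mult[OF c\<pi> T] mat_adjoint_mult[OF T c\<rho>])
    then show ?thesis
      using rep_uminus[OF rep(1), of "- g"] rep_uminus[OF rep(2), of "- g"] by simp
  qed
  have "A * T * \<rho> g = \<rho> g * (A * T)" for g
  proof -
    have "A * T * \<rho> g = A * (\<pi> g * T)"
      unfolding inter by (rule assoc_mult_mat[OF A T c\<rho>])
    also have "\<dots> = \<rho> g * A * T"
      unfolding inter'[symmetric] by (rule assoc_mult_mat[OF A c\<pi> T, symmetric])
    finally show ?thesis
      using assoc_mult_mat[OF c\<rho> A T] by simp
  qed
  then obtain c where c: "A * T = c \<cdot>\<^sub>m 1\<^sub>m m"
    using schur_scalar[OF \<rho>, of "A * T"] A T by auto
  have "T * A * \<pi> g = \<pi> g * (T * A)" for g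
  proof -
    have "T * A * \<pi> g = T * (\<rho> g * A)"
      unfolding inter'[symmetric] by (rule assoc_mult_mat[OF T A c\<pi>])
    also have "\<dots> = \<pi> g * T * A"
      unfolding inter by (rule assoc_mult_mat[OF T c\<rho> A, symmetric])
    finally show ?thesis
      using assoc_mult_mat[OF c\<pi> T A] by simp
  qed
  then obtain d where d: "T * A = d \<cdot>\<^sub>m 1\<^sub>m n"
    using schur_scalar[OF \<pi>, of "T * A"] A T by auto
  obtain i j where ij: "i < n" "j < m" "T $$ (i, j) \<noteq> 0"
    using \<open>T \<noteq> 0\<^sub>m n m\<close> T by (metis eq_matI carrier_matD index_zero_mat)
  have "T * (A * T) = (T * A) * T"
    by (rule assoc_mult_mat[OF T A T, symmetric])
  then have "c \<cdot>\<^sub>m T = d \<cdot>\<^sub>m T"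
    using T by (simp add: c d mult_smult_distrib[OF T one_carrier_mat] mult_smult_assoc_mat[OF one_carrier_mat T])
  then have "(c \<cdot>\<^sub>m T) $$ (i, j) = (d \<cdot>\<^sub>m T) $$ (i, j)"
    by simp
  then have cd: "c = d"
    using ij T by simp
  have diag: "(A * T) $$ (l, l) = of_real (\<Sum>k<n. (cmod (T $$ (k, l)))\<^sup>2)" if "l < m" for l
    unfolding index_mult_mat_sum[OF A T that that]
    using that by (simp add: A_def index_mat_adjoint[OF T] complex_norm_square mult.commute del: of_real_power)
  then have cj: "c = of_real (\<Sum>k<n. (cmod (T $$ (k, j)))\<^sup>2)"
    using ij(2) by (simp add: c)
  \<comment> \<open>The common scalar is the squared length of a column with a nonzero entry, hence
    real and positive, so that its square root can be divided out.\<close>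
  define r where "r = (\<Sum>k<n. (cmod (T $$ (k, j)))\<^sup>2)"
  have r: "0 < r" "c = of_real r"
    using ij cj by (auto simp: r_def intro!: sum_pos2[of _ i])
  have "of_nat n * d = (\<Sum>k<n. (T * A) $$ (k, k))"
    by (simp add: d)
  also have "\<dots> = (\<Sum>l<m. (A * T) $$ (l, l))"
    by (rule sum_diag_mult_commute[OF T A])
  also have "\<dots> = of_nat m * c"
    by (simp add: c)
  finally have "of_nat n * c = of_nat m * c"
    using cd by simp
  moreover have "c \<noteq> 0"
    using r by simp
  ultimately have nm: "n = m"
    by simp
  define U where "U = of_real (1 / sqrt r) \<cdot>\<^sub>m T"
  have U: "U \<in> carrier_mat n n"
    using T nm by (simp add: U_def)
  have adj: "mat_adjoint U = of_real (1 / sqrt r) \<cdot>\<^sub>m A"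
    using T A mat_adjoint_carrier[OF U] nm
    by (intro eq_matI) (auto simp: U_def A_def index_mat_adjoint[of _ n m])
  have sq: "complex_of_real (1 / sqrt r) * (complex_of_real (1 / sqrt r) * c) = 1"
    using r by (simp add: field_simps flip: of_real_mult)
  have "mat_adjoint U * U = 1\<^sub>m n" "U * mat_adjoint U = 1\<^sub>m n"
    unfolding adj using A T sq nm
    by (auto simp: U_def mult_smult_assoc_mat[of _ n n _ n] mult_smult_distrib[of _ n n _ n] c d cd[symmetric] intro!: eq_matI)
  then have "unitary_mat n U"
    using U by (simp add: unitary_mat_def)
  moreover have "U * \<rho> g = \<pi> g * U" for g
    unfolding U_def mult_smult_assoc_mat[OF T c\<rho>] mult_smult_distrib[OF c\<pi> T] inter ..
  ultimately show ?thesis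
    using \<pi> \<rho> nm by (auto simp: rep_equiv_def irreps_def rep_dim[OF rep(1)] rep_dim[OF rep(2)])
qed

section \<open>Unitary equivalence, characters of classes and the trivial class\<close>

lemma rep_equivD:
  assumes "(\<pi>, \<rho>) \<in> rep_equiv"
  shows "\<exists>n U. irreducible_unitary_rep n \<pi> \<and> irreducible_unitary_rep n \<rho> \<and> unitary_mat n U \<and>
    (\<forall>g. U * \<pi> g = \<rho> g * U)"
proof -
  obtain n m where "irreducible_unitary_rep n \<pi>" "irreducible_unitary_rep m \<rho>"
    using assms unfolding rep_equiv_def irreps_def by blast
  moreover from this have "rep_dim \<pi> = n" "rep_dim \<rho> = m"
    by (auto simp: irreducible_unitary_rep_def intro: rep_dim)
  moreover obtain U where "unitary_mat (rep_dim \<pi>) U" "\<forall>g. U * \<pi> g = \<rho> g * U" "rep_dim \<pi> = rep_dim \<rho>"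
    using assms unfolding rep_equiv_def by blast
  ultimately show ?thesis
    by metis
qed

lemma unitary_mat_one: "unitary_mat n (1\<^sub>m n)"
proof -
  have "mat_adjoint (1\<^sub>m n) = (1\<^sub>m n :: complex mat)"
    using mat_adjoint_carrier[OF one_carrier_mat, of n]
    by (intro eq_matI) (auto simp: index_mat_adjoint[OF one_carrier_mat])
  then show ?thesis
    by (simp add: unitary_mat_def)
qed

lemma equiv_rep_equiv:
  "equiv irreps (rep_equiv :: (('g::topological_group_add \<Rightarrow> complex mat) \<times> ('g \<Rightarrow> complex mat)) set)" (is "equiv ?I ?R")
proof (rule Equiv_Relations.equivI)
  show "refl_on ?I ?R"
  proof (rule refl_onI)
    fix \<pi> :: "'g \<Rightarrow> complex mat" assume "\<pi> \<in> irreps"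
    then obtain n where n: "irreducible_unitary_rep n \<pi>"
      by (auto simp: irreps_def)
    then have rep: "unitary_rep n \<pi>"
      by (simp add: irreducible_unitary_rep_def)
    have "1\<^sub>m n * \<pi> g = \<pi> g * 1\<^sub>m n" for g
      using left_mult_one_mat[OF rep_carrier[OF rep]] right_mult_one_mat[OF rep_carrier[OF rep]] by metis
    then show "(\<pi>, \<pi>) \<in> rep_equiv"
      using \<open>\<pi> \<in> irreps\<close> unitary_mat_one[of n] by (auto simp: rep_equiv_def rep_dim[OF rep])
  qed
  show "sym ?R"
  proof (rule symI)
    fix \<pi> \<rho> :: "'g \<Rightarrow> complex mat" assume "(\<pi>, \<rho>) \<in> rep_equiv"
    then obtain n U where n: "irreducible_unitary_rep n \<pi>" "irreducible_unitary_rep n \<rho>" "unitary_mat n U"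
        "\<forall>g. U * \<pi> g = \<rho> g * U"
      using rep_equivD by metis
    then have r: "unitary_rep n \<pi>" "unitary_rep n \<rho>"
      unfolding irreducible_unitary_rep_def by blast+
    have U: "U \<in> carrier_mat n n" "mat_adjoint U * U = 1\<^sub>m n" "U * mat_adjoint U = 1\<^sub>m n"
      using n(3) by (auto simp: unitary_mat_def)
    have "mat_adjoint U * \<rho> g = \<pi> g * mat_adjoint U" for g
    proof -
      note c = rep_carrier[OF r(1), of g] rep_carrier[OF r(2), of g] U(1) mat_adjoint_carrier[OF U(1)]
      have "mat_adjoint U * \<rho> g = mat_adjoint U * (\<rho> g * (U * mat_adjoint U))"
        unfolding U(3) using c by simp
      also have "\<dots> = mat_adjoint U * (\<rho> g * U) * mat_adjoint U"
        using c by (simp add: assoc_mult_mat[of _ n n _ n _ n])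
      also have "\<dots> = (mat_adjoint U * U) * \<pi> g * mat_adjoint U"
        unfolding n(4)[rule_format, symmetric] using c by (simp add: assoc_mult_mat[of _ n n _ n _ n])
      finally show ?thesis
        unfolding U(2) using c by simp
    qed
    moreover have "unitary_mat n (mat_adjoint U)"
      using U by (simp add: unitary_mat_def mat_adjoint_adjoint)
    ultimately show "(\<rho>, \<pi>) \<in> rep_equiv"
      using n(1,2) by (auto simp: rep_equiv_def irreps_def rep_dim[OF r(1)] rep_dim[OF r(2)])
  qed
  show "trans ?R"
  proof (rule transI)
    fix \<pi> \<rho> \<sigma> :: "'g \<Rightarrow> complex mat" assume "(\<pi>, \<rho>) \<in> rep_equiv" "(\<rho>, \<sigma>) \<in> rep_equiv"
    obtain n U where n: "irreducible_unitary_rep n \<pi>" "irreducible_unitary_rep n \<rho>" "unitary_mat n U"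
        "\<forall>g. U * \<pi> g = \<rho> g * U"
      using rep_equivD[OF \<open>(\<pi>, \<rho>) \<in> rep_equiv\<close>] by metis
    obtain m V where m: "irreducible_unitary_rep m \<rho>" "irreducible_unitary_rep m \<sigma>" "unitary_mat m V"
        "\<forall>g. V * \<rho> g = \<sigma> g * V"
      using rep_equivD[OF \<open>(\<rho>, \<sigma>) \<in> rep_equiv\<close>] by metis
    have r: "unitary_rep n \<pi>" "unitary_rep n \<rho>" "unitary_rep m \<rho>" "unitary_rep m \<sigma>"
      using n(1,2) m(1,2) by (auto simp: irreducible_unitary_rep_def)
    then have mn: "m = n"
      using rep_dim by metis
    have U: "U \<in> carrier_mat n n" "mat_adjoint U * U = 1\<^sub>m n" "U * mat_adjoint U = 1\<^sub>m n"
      using n(3) by (auto simp: unitary_mat_def)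
    have V: "V \<in> carrier_mat n n" "mat_adjoint V * V = 1\<^sub>m n" "V * mat_adjoint V = 1\<^sub>m n"
      using m(3) mn by (auto simp: unitary_mat_def)
    note c = rep_carrier[OF r(1)] rep_carrier[OF r(2)] rep_carrier[OF r(4), unfolded mn]
      U(1) V(1) mat_adjoint_carrier[OF U(1)] mat_adjoint_carrier[OF V(1)]
    note assoc = assoc_mult_mat[of _ n n _ n _ n]
    have "V * U * \<pi> g = \<sigma> g * (V * U)" for g
    proof -
      have "V * U * \<pi> g = V * (\<rho> g * U)"
        unfolding n(4)[rule_format, symmetric] using c by (simp add: assoc)
      also have "\<dots> = (\<sigma> g * V) * U"
        unfolding m(4)[rule_format, symmetric] using c by (simp add: assoc)
      finally show ?thesis
        using c by (simp add: assoc)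
    qed
    moreover have "unitary_mat n (V * U)"
    proof -
      have "mat_adjoint U * mat_adjoint V * (V * U) = mat_adjoint U * ((mat_adjoint V * V) * U)"
        using c by (simp add: assoc)
      moreover have "V * U * (mat_adjoint U * mat_adjoint V) = V * ((U * mat_adjoint U) * mat_adjoint V)"
        using assoc_mult_mat[OF V(1) U(1) mult_carrier_mat[OF c(6,7)]] assoc_mult_mat[OF U(1) c(6,7)] by simp
      ultimately show ?thesis
        using U V by (simp add: unitary_mat_def mat_adjoint_mult[OF V(1) U(1)])
    qed
    ultimately show "(\<pi>, \<sigma>) \<in> rep_equiv"
      using n(1) m(2) mn by (auto simp: rep_equiv_def irreps_def rep_dim[OF r(1)] rep_dim[OF r(4)])
  qed
qed (auto simp: rep_equiv_def)

text \<open>Conjugation by a unitary preserves the trace, so the value does not depend on the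
  representative chosen by \<open>SOME\<close>.\<close>

lemma char_class_eq:
  assumes D: "D \<in> dual" and \<pi>: "\<pi> \<in> D" "unitary_rep n \<pi>"
  shows "char_class D g = of_nat n * (\<Sum>i<n. \<pi> g $$ (i, i))"
proof -
  define \<rho> where "\<rho> = (SOME \<rho>. \<rho> \<in> D)"
  have "\<rho> \<in> D"
    unfolding \<rho>_def using \<pi>(1) by (rule someI[where P = "\<lambda>\<rho>. \<rho> \<in> D"])
  then have "(\<pi>, \<rho>) \<in> rep_equiv"
    using quotient_eq_iff[OF equiv_rep_equiv, of D D \<pi> \<rho>] D \<pi>(1) by (simp add: dual_def)
  then obtain m U where m: "irreducible_unitary_rep m \<pi>" "irreducible_unitary_rep m \<rho>" "unitary_mat m U"
      "\<forall>g. U * \<pi> g = \<rho> g * U"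
    using rep_equivD by metis
  then have r: "unitary_rep m \<pi>" "unitary_rep m \<rho>"
    unfolding irreducible_unitary_rep_def by blast+
  have mn: "m = n"
    using rep_dim[OF r(1)] rep_dim[OF \<pi>(2)] by simp
  have U: "U \<in> carrier_mat n n" "mat_adjoint U * U = 1\<^sub>m n" "U * mat_adjoint U = 1\<^sub>m n"
    using m(3) mn by (auto simp: unitary_mat_def)
  note c = rep_carrier[OF r(1), of g, unfolded mn] rep_carrier[OF r(2), of g, unfolded mn] U(1) mat_adjoint_carrier[OF U(1)]
  have "(\<Sum>i<n. \<rho> g $$ (i, i)) = (\<Sum>i<n. (\<rho> g * (U * mat_adjoint U)) $$ (i, i))"
    unfolding U(3) using c by simp
  also have "\<dots> = (\<Sum>i<n. ((U * \<pi> g) * mat_adjoint U) $$ (i, i))"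
    unfolding m(4)[rule_format] using assoc_mult_mat[OF c(2) c(3) c(4)] by simp
  also have "\<dots> = (\<Sum>i<n. (mat_adjoint U * (U * \<pi> g)) $$ (i, i))"
    using c by (intro sum_diag_mult_commute) auto
  also have "mat_adjoint U * (U * \<pi> g) = \<pi> g"
    using assoc_mult_mat[OF c(4) c(3) c(1)] c(1) by (simp add: U(2))
  finally show ?thesis
    unfolding char_class_def Let_def \<rho>_def[symmetric] by (simp add: rep_dim[OF r(2)] mn)
qed

lemma dual_rep:
  assumes "D \<in> dual"
  obtains n \<pi> where "\<pi> \<in> D" "irreducible_unitary_rep n \<pi>" "unitary_rep n \<pi>"
proof -
  obtain \<pi> where \<pi>: "\<pi> \<in> D"
    using in_quotient_imp_non_empty[OF equiv_rep_equiv] assms by (auto simp: dual_def)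
  then have "\<pi> \<in> irreps"
    using in_quotient_imp_subset[OF equiv_rep_equiv] assms by (auto simp: dual_def)
  then show ?thesis
    using \<pi> that by (auto simp: irreps_def irreducible_unitary_rep_def)
qed

lemma irreducible_trivial: "irreducible_unitary_rep 1 (\<lambda>_. 1\<^sub>m 1)"
proof -
  have "W = {0\<^sub>v 1} \<or> W = carrier_vec 1"
    if W: "VectorSpace.subspace class_ring W (module_vec TYPE(complex) 1)" for W
  proof (cases "W \<subseteq> {0\<^sub>v 1}")
    case True
    then show ?thesis
      using subspaceD_vec(2)[OF W] by blast
  next
    case False
    then obtain w where w: "w \<in> W" "w \<noteq> 0\<^sub>v 1"
      by blast
    then have dim: "dim_vec w = 1"
      using subspaceD_vec(1)[OF W] by auto
    have w0: "w $ 0 \<noteq> 0"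
    proof
      assume "w $ 0 = 0"
      then have "w = 0\<^sub>v 1"
        using dim by (intro eq_vecI) auto
      then show False
        using w(2) by simp
    qed
    have "v \<in> W" if "v \<in> carrier_vec 1" for v
    proof -
      have "v = (v $ 0 / w $ 0) \<cdot>\<^sub>v w"
        using that dim w0 by (intro eq_vecI) auto
      then show ?thesis
        using subspaceD_vec(4)[OF W w(1)] by metis
    qed
    then show ?thesis
      using subspaceD_vec(1)[OF W] by blast
  qed
  moreover have "unitary_rep 1 (\<lambda>_. 1\<^sub>m 1)"
    using unitary_mat_one[of 1] by (simp add: unitary_rep_def)
  ultimately show ?thesis
    unfolding irreducible_unitary_rep_def by auto
qed

lemma trivial_class_dual: "trivial_class \<in> dual"
  using irreducible_trivial by (auto simp: trivial_class_def dual_def irreps_def intro!: quotientI)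

lemma char_class_trivial: "char_class trivial_class g = 1"
proof -
  have "(\<lambda>_. 1\<^sub>m 1) \<in> trivial_class"
    unfolding trivial_class_def using equiv_class_self[OF equiv_rep_equiv] irreducible_trivial
    by (auto simp: irreps_def)
  moreover have "unitary_rep 1 (\<lambda>_. 1\<^sub>m 1)"
    using irreducible_trivial unfolding irreducible_unitary_rep_def by blast
  ultimately have "char_class trivial_class g = of_nat 1 * (\<Sum>i<1. 1\<^sub>m 1 $$ (i, i))"
    by (rule char_class_eq[OF trivial_class_dual])
  then show ?thesis
    by simp
qed

context compact_group
begin

section \<open>Schur orthogonality relations\<close>

lemma rep_continuous:
  assumes "unitary_rep n \<pi>" "i < n" "j < n"
  shows "cont (\<lambda>g. \<pi> g $$ (i, j))"
  using assms by (simp add: unitary_rep_def)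

text \<open>The average of \<open>\<pi> g * E * mat_adjoint (\<rho> g)\<close>, where
  \<open>E\<close> is the matrix unit with entry 1 at \<open>(k, i)\<close>: the usual averaging
  that turns an arbitrary matrix into an intertwiner.\<close>

definition schur_mat where
  "schur_mat n \<pi> m \<rho> k i = mat n m (\<lambda>(l, j). avg (\<lambda>g. \<pi> g $$ (l, k) * cnj (\<rho> g $$ (j, i))))"

lemma schur_mat_intertwines:
  assumes \<pi>: "unitary_rep n \<pi>" and \<rho>: "unitary_rep m \<rho>" and k: "k < n" and i: "i < m"
  shows "\<pi> h * schur_mat n \<pi> m \<rho> k i = schur_mat n \<pi> m \<rho> k i * \<rho> h"
proof (rule eq_matI)
  let ?T = "schur_mat n \<pi> m \<rho> k i"
  have T: "?T \<in> carrier_mat n m"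
    by (simp add: schur_mat_def)
  have c\<pi>: "\<pi> g \<in> carrier_mat n n" and c\<rho>: "\<rho> g \<in> carrier_mat m m" for g
    by (rule rep_carrier[OF \<pi>] rep_carrier[OF \<rho>])+
  fix l j assume "l < dim_row (?T * \<rho> h)" "j < dim_col (?T * \<rho> h)"
  then have l: "l < n" and j: "j < m"
    using T c\<rho>[of h] by auto
  have cont: "cont (\<lambda>g. \<pi> g $$ (a, k) * cnj (\<rho> g $$ (b, i)))" if "a < n" "b < m" for a b
    using that k i by (intro continuous_intros rep_continuous[OF \<pi>] rep_continuous[OF \<rho>])
  have c': "cont (\<lambda>g. \<pi> (h + g) $$ (l, k) * cnj (\<rho> g $$ (j, i)))"
    by (intro continuous_intros rep_continuous[OF \<rho>] cont_compose[OF rep_continuous[OF \<pi>]] k i l j)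
  have "(\<pi> h * ?T) $$ (l, j) = (\<Sum>a<n. \<pi> h $$ (l, a) * avg (\<lambda>g. \<pi> g $$ (a, k) * cnj (\<rho> g $$ (j, i))))"
    using l j by (simp add: index_mult_mat_sum[OF c\<pi> T]) (simp add: schur_mat_def)
  also have "\<dots> = (\<Sum>a<n. avg (\<lambda>g. \<pi> h $$ (l, a) * (\<pi> g $$ (a, k) * cnj (\<rho> g $$ (j, i)))))"
    using cont j by (simp add: avg_mult_left)
  also have "\<dots> = avg (\<lambda>g. \<Sum>a<n. \<pi> h $$ (l, a) * (\<pi> g $$ (a, k) * cnj (\<rho> g $$ (j, i))))"
    by (rule avg_sum[symmetric], rule continuous_on_mult_left, rule cont) (use j in auto)
  also have "\<dots> = avg (\<lambda>g. \<pi> (h + g) $$ (l, k) * cnj (\<rho> g $$ (j, i)))"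
    using l k by (simp add: rep_add_index[OF \<pi>] sum_distrib_right mult.assoc)
  \<comment> \<open>Substituting \<open>- h + g\<close> for \<open>g\<close> moves \<open>h\<close>
    from the first factor to the second, where the conjugated entries of \<open>\<rho> (- h)\<close>
    are entries of \<open>\<rho> h\<close>.\<close>
  also have "\<dots> = avg (\<lambda>g. \<pi> (h + (- h + g)) $$ (l, k) * cnj (\<rho> (- h + g) $$ (j, i)))"
    by (rule avg_translate[OF c', symmetric])
  also have "\<dots> = avg (\<lambda>g. \<Sum>b<m. (\<pi> g $$ (l, k) * cnj (\<rho> g $$ (b, i))) * \<rho> h $$ (b, j))"
    using i j by (simp add: rep_add_index[OF \<rho>] rep_uminus_index[OF \<rho>] sum_distrib_left
        add.assoc[symmetric] mult_ac)
  also have "\<dots> = (\<Sum>b<m. avg (\<lambda>g. \<pi> g $$ (l, k) * cnj (\<rho> g $$ (b, i))) * \<rho> h $$ (b, j))"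
    using cont l by (subst avg_sum) (auto intro!: continuous_on_mult_right avg_mult_right sum.cong)
  also have "\<dots> = (?T * \<rho> h) $$ (l, j)"
    using l j by (simp add: index_mult_mat_sum[OF T c\<rho>]) (simp add: schur_mat_def)
  finally show "(\<pi> h * ?T) $$ (l, j) = (?T * \<rho> h) $$ (l, j)" .
qed (use rep_carrier[OF \<pi>, of h] rep_carrier[OF \<rho>, of h] in \<open>auto simp: schur_mat_def\<close>)

lemma schur_orthogonality_inequivalent:
  assumes \<pi>: "irreducible_unitary_rep n \<pi>" and \<rho>: "irreducible_unitary_rep m \<rho>" and "(\<rho>, \<pi>) \<notin> rep_equiv"
    and "l < n" "k < n" "j < m" "i < m"
  shows "avg (\<lambda>g. \<pi> g $$ (l, k) * cnj (\<rho> g $$ (j, i))) = 0"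
proof -
  have rep: "unitary_rep n \<pi>" "unitary_rep m \<rho>"
    using \<pi> \<rho> by (auto simp: irreducible_unitary_rep_def)
  have T: "schur_mat n \<pi> m \<rho> k i \<in> carrier_mat n m"
    by (simp add: schur_mat_def)
  have "schur_mat n \<pi> m \<rho> k i = 0\<^sub>m n m"
    using schur_intertwiner[OF \<pi> \<rho> T schur_mat_intertwines[OF rep \<open>k < n\<close> \<open>i < m\<close>]] assms(3) by blast
  from arg_cong[OF this, of "\<lambda>T. T $$ (l, j)"] show ?thesis
    using assms by (simp add: schur_mat_def)
qed

lemma schur_orthogonality:
  assumes \<pi>: "irreducible_unitary_rep n \<pi>" and "l < n" "k < n" "j < n" "i < n"
  shows "avg (\<lambda>g. \<pi> g $$ (l, k) * cnj (\<pi> g $$ (j, i))) = (if l = j \<and> k = i then 1 / of_nat n else 0)"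
proof -
  have n: "0 < n" and rep: "unitary_rep n \<pi>"
    using \<pi> by (auto simp: irreducible_unitary_rep_def)
  let ?T = "schur_mat n \<pi> n \<pi> k i"
  obtain c where c: "?T = c \<cdot>\<^sub>m 1\<^sub>m n"
    using schur_scalar[OF \<pi>, of ?T] schur_mat_intertwines[OF rep rep \<open>k < n\<close> \<open>i < n\<close>]
    by (auto simp: schur_mat_def)
  have entry: "avg (\<lambda>g. \<pi> g $$ (a, k) * cnj (\<pi> g $$ (b, i))) = (if a = b then c else 0)" if "a < n" "b < n" for a b
    using arg_cong[OF c, of "\<lambda>T. T $$ (a, b)"] that by (simp add: schur_mat_def)
  \<comment> \<open>The scalar is found from the trace: summing over \<open>a\<close> produces the
    entry \<open>(i, k)\<close> of \<open>\<pi> (- g + g)\<close>, the identity matrix.\<close>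
  have "of_nat n * c = (\<Sum>a<n. avg (\<lambda>g. \<pi> g $$ (a, k) * cnj (\<pi> g $$ (a, i))))"
    by (simp add: entry)
  also have "\<dots> = avg (\<lambda>g. \<Sum>a<n. \<pi> g $$ (a, k) * cnj (\<pi> g $$ (a, i)))"
    using assms by (intro avg_sum[symmetric] continuous_intros rep_continuous[OF rep]) auto
  also have "\<dots> = avg (\<lambda>g. \<pi> (- g + g) $$ (i, k))"
    using assms by (simp only: rep_add_index[OF rep]) (simp add: rep_uminus_index[OF rep] mult.commute)
  also have "\<dots> = (if k = i then 1 else 0)"
    using assms by (auto simp: rep_zero[OF rep] avg_const)
  finally have "c = (if k = i then 1 / of_nat n else 0)"
    using n by (auto simp: field_simps)
  then show ?thesis
    using entry[OF \<open>l < n\<close> \<open>j < n\<close>] by auto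
qed

end

section \<open>Idempotents of convolution operators\<close>

text \<open>Here \<open>c n\<close> plays the role of the trace of the \<open>(n + 1)\<close>-st
  power of a positive operator, and \<open>\<rho>\<close> that of its largest eigenvalue.
  Log-convexity makes the ratios \<open>q\<close> increase, submultiplicativity bounds them, and
  \<open>\<rho>\<close> is their limit.\<close>

lemma log_convex_submultiplicative_growth:
  fixes c :: "nat \<Rightarrow> real"
  assumes pos: "\<And>n. 0 < c n" and log_convex: "\<And>n. (c (Suc n))\<^sup>2 \<le> c n * c (Suc (Suc n))"
    and submult: "\<And>m n. c (Suc (m + n)) \<le> c m * c n"
  obtains \<rho> where "0 < \<rho>" "\<And>n. c (Suc n) \<le> \<rho> * c n" "\<And>n. \<rho> ^ Suc n \<le> c n"
proof -
  define q where "q n = c (Suc n) / c n" for n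
  have q_pos: "0 < q n" for n
    by (simp add: q_def pos)
  have "incseq q"
  proof (rule incseq_SucI)
    show "q n \<le> q (Suc n)" for n
      using log_convex[of n] pos[of n] pos[of "Suc n"] by (simp add: q_def field_simps power2_eq_square)
  qed
  have q_bound: "q n \<le> c 0" for n
    using submult[of n 0] pos[of n] by (simp add: q_def field_simps)
  obtain \<rho> where lim: "q \<longlonglongrightarrow> \<rho>" and le: "\<And>n. q n \<le> \<rho>"
    using incseq_convergent[OF \<open>incseq q\<close>, of "c 0"] q_bound by blast
  \<comment> \<open>The index \<open>n\<close> stands for an \<open>(n + 1)\<close>-st power, so
    \<open>k + 1\<close> blocks of length \<open>n + 1\<close> end at the index
    \<open>k * Suc n + n\<close>.\<close>
  have power: "c (k * Suc n + n) \<le> c n ^ Suc k" for n k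
  proof (induction k)
    case (Suc k)
    have "c (Suc k * Suc n + n) = c (Suc ((k * Suc n + n) + n))"
      by (simp add: algebra_simps)
    also have "\<dots> \<le> c (k * Suc n + n) * c n"
      by (rule submult)
    also have "\<dots> \<le> c n ^ Suc k * c n"
      by (rule mult_right_mono[OF Suc less_imp_le[OF pos]])
    finally show ?case
      by (simp add: mult_ac)
  qed simp
  have lower: "c j * q j ^ i \<le> c (j + i)" for i j
  proof (induction i)
    case (Suc i)
    have "c j * q j ^ Suc i = q j * (c j * q j ^ i)"
      by simp
    also have "\<dots> \<le> q (j + i) * c (j + i)"
      using Suc q_pos[of j] q_pos[of "j + i"] pos[of j] \<open>incseq q\<close> by (intro mult_mono) (auto simp: incseqD)
    also have "\<dots> = c (j + Suc i)"
      using pos[of "j + i"] by (simp add: q_def)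
    finally show ?case .
  qed simp
  \<comment> \<open>If this failed, the geometric lower bound \<open>lower\<close> and the block
    bound \<open>power\<close> would squeeze a fixed positive number below all high powers of some
    \<open>r < 1\<close>.\<close>
  have "q j ^ Suc n \<le> c n" for j n
  proof (rule ccontr)
    assume "\<not> q j ^ Suc n \<le> c n"
    define r where "r = c n / q j ^ Suc n"
    have r: "0 < r" "r < 1"
      using \<open>\<not> q j ^ Suc n \<le> c n\<close> pos[of n] q_pos[of j] by (auto simp: r_def divide_less_eq not_le)
    have "c j / q j ^ Suc j \<le> r ^ Suc k" if "j \<le> k" for k
    proof -
      define i where "i = k * Suc n + n - j"
      have i: "j + i = k * Suc n + n"
        using that by (simp add: i_def algebra_simps)
      then have exp: "Suc j + i = Suc n * Suc k"
        by (simp add: algebra_simps)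
      have "c j * q j ^ i \<le> c n ^ Suc k"
        using order_trans[OF lower[of j i] power[of k n, folded i]] .
      then have "q j ^ Suc j * (c j * q j ^ i) \<le> q j ^ Suc j * c n ^ Suc k"
        using q_pos[of j] by (intro mult_left_mono) simp_all
      also have "q j ^ Suc j * (c j * q j ^ i) = c j * (q j ^ Suc n) ^ Suc k"
        unfolding power_mult[symmetric] exp[symmetric] power_add by (simp add: mult_ac)
      finally show ?thesis
        unfolding r_def power_divide using q_pos[of j] by (simp add: divide_simps mult_ac del: power_Suc)
    qed
    then have "\<exists>N. \<forall>k\<ge>N. c j / q j ^ Suc j \<le> r ^ Suc k"
      by blast
    then have "c j / q j ^ Suc j \<le> 0"
      using r by (intro LIMSEQ_le_const[OF LIMSEQ_Suc[OF LIMSEQ_realpow_zero]]) simp_all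
    moreover have "0 < c j / q j ^ Suc j"
      by (intro divide_pos_pos pos zero_less_power q_pos)
    ultimately show False
      by linarith
  qed
  then have "\<rho> ^ Suc n \<le> c n" for n
    by (intro LIMSEQ_le_const2[OF tendsto_power[OF lim]]) blast
  moreover have "c (Suc n) \<le> \<rho> * c n" for n
    using le[of n] pos[of n] by (simp add: q_def field_simps)
  moreover have "0 < \<rho>"
    using le[of 0] q_pos[of 0] by linarith
  ultimately show ?thesis
    using that by blast
qed

context compact_group
begin

text \<open>Continuous functions in general contain no unit for \<open>conv\<close>, so the
  recursion starts at \<open>u\<close>: the index \<open>n\<close> means the
  \<open>(n + 1)\<close>-fold power, and exponents are shifted by one throughout.\<close>

primrec conv_power :: "('g \<Rightarrow> complex) \<Rightarrow> nat \<Rightarrow> 'g \<Rightarrow> complex" where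
  "conv_power u 0 = u"
| "conv_power u (Suc n) = conv (conv_power u n) u"

lemma cont_conv_power: "cont u \<Longrightarrow> cont (conv_power u n)"
  by (induction n) (auto intro: cont_conv)

lemma conv_conv_power:
  assumes u: "cont u"
  shows "conv (conv_power u m) (conv_power u n) = conv_power u (Suc (m + n))"
proof (induction n)
  case (Suc n)
  have "conv (conv_power u m) (conv_power u (Suc n)) = conv (conv (conv_power u m) (conv_power u n)) u"
    by (simp add: conv_assoc cont_conv_power u)
  then show ?case
    unfolding Suc by simp
qed simp

lemma invol_conv_power:
  assumes u: "cont u" "invol u = u"
  shows "invol (conv_power u n) = conv_power u n"
proof (induction n)
  case (Suc n)
  have "invol (conv_power u (Suc n)) = conv (conv_power u 0) (conv_power u n)"
    using Suc by (simp add: invol_conv cont_conv_power u)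
  also have "\<dots> = conv_power u (Suc n)"
    unfolding conv_conv_power[OF u(1)] by simp
  finally show ?case .
qed (simp add: u)

lemma ip_conv_power:
  assumes u: "cont u" "invol u = u"
  shows "ip (conv_power u m) (conv_power u n) = conv_power u (Suc (m + n)) 0"
  by (simp add: ip_eq_conv invol_conv_power u conv_conv_power del: conv_power.simps)

text \<open>The spectral projection of convolution by \<open>u * u\<close> for its largest eigenvalue \<open>\<rho>\<close>, obtained as the limit
  of the powers of \<open>u * u\<close> scaled by \<open>1 / \<rho>\<close>. Their squared distances are governed by the decreasing
  sequence \<open>d\<close>.\<close>

lemma exists_idempotent:
  assumes u: "cont u" "invol u = u" and "u a \<noteq> 0"
  obtains p where "cont p" "invol p = p" "conv p p = p" "1 \<le> Re (p 0)"
    "\<And>e. cont e \<Longrightarrow> conv u e = (\<lambda>_. 0) \<Longrightarrow> conv p e = (\<lambda>_. 0)"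
proof -
  let ?u = "conv_power u"
  note cu = cont_conv_power[OF u(1)]
  \<comment> \<open>By self-adjointness this is the value at 0 of the \<open>(2 n + 2)\<close>-fold
    convolution power, in other words the trace of the \<open>(n + 1)\<close>-st power of
    convolution by \<open>conv u u\<close>.\<close>
  define c where "c n = (l2norm (?u n))\<^sup>2" for n
  have c_eq: "complex_of_real (c n) = ?u (Suc (n + n)) 0" for n
    unfolding c_def ip_self[OF cu, symmetric] by (rule ip_conv_power[OF u])
  have c_mid: "c (Suc n) \<le> l2norm (?u n) * l2norm (?u (Suc (Suc n)))" for n
  proof -
    have "ip (?u n) (?u (Suc (Suc n))) = complex_of_real (c (Suc n))"
      unfolding c_eq ip_conv_power[OF u] by simp
    then have "cmod (ip (?u n) (?u (Suc (Suc n)))) = c (Suc n)"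
      by (simp only: norm_of_real) (simp add: c_def)
    then show ?thesis
      using cauchy_schwarz[OF cu[of n] cu[of "Suc (Suc n)"]] by simp
  qed
  have log_convex: "(c (Suc n))\<^sup>2 \<le> c n * c (Suc (Suc n))" for n
  proof -
    have "(c (Suc n))\<^sup>2 \<le> (l2norm (?u n) * l2norm (?u (Suc (Suc n))))\<^sup>2"
      by (rule power_mono[OF c_mid]) (simp add: c_def)
    then show ?thesis
      by (simp only: c_def power_mult_distrib)
  qed
  have u_pos: "0 < l2norm u"
    using l2norm_eq_0[OF u(1)] l2norm_nonneg[OF u(1)] \<open>u a \<noteq> 0\<close> by (metis less_eq_real_def)
  have c_pos: "0 < c n \<and> 0 < c (Suc n)" for n
  proof (induction n)
    case 0
    have "?u (Suc 0) 0 \<noteq> 0"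
      using c_eq[of 0] u_pos by (auto simp: c_def)
    then have "l2norm (?u (Suc 0)) \<noteq> 0"
      using l2norm_eq_0[OF cu] by blast
    then show ?case
      using u_pos by (simp add: c_def)
  next
    case (Suc n)
    then have "0 < (c (Suc n))\<^sup>2"
      by simp
    then have "0 < c n * c (Suc (Suc n))"
      using log_convex[of n] by linarith
    then show ?case
      using Suc by (simp add: zero_less_mult_iff)
  qed
  have submult: "c (Suc (m + n)) \<le> c m * c n" for m n
  proof -
    have "(l2norm (conv (?u m) (?u n)))\<^sup>2 \<le> (l2norm (?u m) * l2norm (?u n))\<^sup>2"
      by (rule power_mono[OF l2norm_conv_le[OF cu cu] l2norm_nonneg[OF cont_conv[OF cu cu]]])
    then show ?thesis
      unfolding conv_conv_power[OF u(1)] c_def power_mult_distrib .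
  qed
  obtain \<rho> where \<rho>: "0 < \<rho>" "\<And>n. c (Suc n) \<le> \<rho> * c n" "\<And>n. \<rho> ^ Suc n \<le> c n"
    using log_convex_submultiplicative_growth[of c] c_pos log_convex submult by blast
  \<comment> \<open>In spectral terms the limit is the multiplicity of the eigenvalue
    \<open>\<rho>\<close>. The lower bound 1 keeps the limiting idempotent from vanishing.\<close>
  define d where "d n = c n / \<rho> ^ Suc n" for n
  have d1: "1 \<le> d n" for n
    using \<rho>(1) \<rho>(3)[of n] by (simp add: d_def)
  have "decseq d"
  proof (rule decseq_SucI)
    show "d (Suc n) \<le> d n" for n
      using \<rho>(1) \<rho>(2)[of n] by (simp add: d_def divide_simps mult_ac)
  qed
  then obtain L where L: "d \<longlonglongrightarrow> L"
    using decseq_convergent[of d 1] d1 by blast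
  \<comment> \<open>With even powers only, eigenvalues of \<open>u\<close> of opposite sign cannot
    make the sequence oscillate. The index \<open>Suc (2 * n)\<close> is the
    \<open>(2 n + 2)\<close>-fold power.\<close>
  define P where "P n x = complex_of_real (1 / \<rho> ^ Suc n) * ?u (Suc (2 * n)) x" for n x
  have cP: "cont (P n)" for n
    unfolding P_def by (intro cont_intros cu)
  have P_fun: "P n = (\<lambda>x. complex_of_real (1 / \<rho> ^ Suc n) * ?u (Suc (2 * n)) x)" for n
    by (simp add: P_def fun_eq_iff)
  have convP: "conv (P n) (P m) x = P (Suc (n + m)) x" for n m x
  proof -
    have "conv (P n) (P m) x = complex_of_real (1 / \<rho> ^ Suc n) * (complex_of_real (1 / \<rho> ^ Suc m) *
        conv (?u (Suc (2 * n))) (?u (Suc (2 * m))) x)"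
      unfolding P_fun by (subst conv_scale_left, (intro cont_intros cu)+, subst conv_scale_right, (intro cu)+, rule refl)
    also have "\<dots> = P (Suc (n + m)) x"
      unfolding conv_conv_power[OF u(1)] P_def by (simp add: power_add mult_ac del: conv_power.simps)
    finally show ?thesis .
  qed
  have P0: "P n 0 = complex_of_real (d n)" for n
    using c_eq[of n] by (simp add: P_def d_def mult_2 del: conv_power.simps)
  have involP: "invol (P n) = P n" for n
    using fun_cong[OF invol_conv_power[OF u, of "Suc (2 * n)"]]
    by (auto simp: P_fun invol_def fun_eq_iff simp del: conv_power.simps)
  have ipP: "ip (P n) (P m) = complex_of_real (d (Suc (n + m)))" for n m
    by (simp add: ip_eq_conv involP convP P0)
  have distP: "(l2norm (\<lambda>x. P n x - P m x))\<^sup>2 = d (Suc (n + n)) - 2 * d (Suc (n + m)) + d (Suc (m + m))" for n m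
  proof -
    have "(l2norm (P k))\<^sup>2 = d (Suc (k + k))" for k
      using ip_self[OF cP[of k]] unfolding ipP of_real_eq_iff by simp
    then show ?thesis
      unfolding l2norm_square_diff[OF cP cP] ipP by simp
  qed
  define K where "K = l2norm (P 0)"
  have K: "0 \<le> K"
    unfolding K_def by (rule l2norm_nonneg[OF cP])
  \<comment> \<open>The shift by one supplies a factor to convolve with:
    \<open>P (Suc m) - P (Suc n)\<close> is the convolution of \<open>P m - P n\<close> with
    \<open>P 0\<close>, which turns the \<open>l2norm\<close> estimate into a uniform one.\<close>
  have "uniformly_Cauchy_on UNIV (\<lambda>n. P (Suc n))"
  proof (rule uniformly_Cauchy_onI)
    fix e :: real assume e: "0 < e"
    \<comment> \<open>Counted with multiplicity, \<open>distP\<close> involves four deviations of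
      \<open>d\<close> from \<open>L\<close>, whence the division by 4; \<open>K + 1\<close> avoids
      dividing by zero.\<close>
    define \<epsilon> where "\<epsilon> = (e / (K + 1))\<^sup>2 / 4"
    have "0 < \<epsilon>"
      using e K by (simp add: \<epsilon>_def)
    then obtain M where M: "\<And>n. n \<ge> M \<Longrightarrow> \<bar>d n - L\<bar> < \<epsilon>"
      using LIMSEQ_D[OF L, of \<epsilon>] by auto
    have "dist (P (Suc m) x) (P (Suc n) x) < e" if "M \<le> m" "M \<le> n" for m n x
    proof -
      have "(l2norm (\<lambda>x. P m x - P n x))\<^sup>2 < 4 * \<epsilon>"
        unfolding distP using M[of "Suc (m + m)"] M[of "Suc (m + n)"] M[of "Suc (n + n)"] that by linarith
      also have "4 * \<epsilon> = (e / (K + 1))\<^sup>2"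
        by (simp add: \<epsilon>_def)
      finally have l: "l2norm (\<lambda>x. P m x - P n x) < e / (K + 1)"
        by (rule power2_less_imp_less) (use e K in simp)
      have "P (Suc m) x - P (Suc n) x = conv (\<lambda>x. P m x - P n x) (P 0) x"
        using convP[of m 0 x] convP[of n 0 x] by (simp add: conv_diff_left cP)
      then have "cmod (P (Suc m) x - P (Suc n) x) \<le> l2norm (\<lambda>x. P m x - P n x) * K"
        using cmod_conv_le[of "\<lambda>x. P m x - P n x" "P 0" x] cP by (simp add: K_def cont_intros)
      also have "\<dots> \<le> e / (K + 1) * K"
        using l K by (intro mult_right_mono) simp_all
      also have "\<dots> < e"
        using e K by (simp add: field_simps)
      finally show ?thesis
        by (simp add: dist_norm)
    qed
    then show "\<exists>M. \<forall>x\<in>UNIV. \<forall>m\<ge>M. \<forall>n\<ge>M. dist (P (Suc m) x) (P (Suc n) x) < e"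
      by blast
  qed
  then obtain p where unif: "uniform_limit UNIV (\<lambda>n. P (Suc n)) p sequentially"
    using Cauchy_uniformly_convergent unfolding uniformly_convergent_on_def by blast
  have cp: "cont p"
    using uniform_limit_theorem[OF _ unif] cP by simp
  have lim: "(\<lambda>n. P (Suc n) x) \<longlonglongrightarrow> p x" for x
    using tendsto_uniform_limitI[OF unif] by simp
  have lim': "(\<lambda>n. P (Suc (Suc n + Suc m)) x) \<longlonglongrightarrow> p x" for m x
    using LIMSEQ_ignore_initial_segment[OF lim[of x], of "Suc (Suc m)"] by simp
  show ?thesis
  proof (rule that[of p])
    show "cont p"
      by (rule cp)
    show "1 \<le> Re (p 0)"
      by (rule LIMSEQ_le_const[OF tendsto_Re[OF lim[of 0]]]) (auto simp: P0 d1)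
    show "invol p = p"
    proof
      fix x
      have "(\<lambda>n. invol (P (Suc n)) x) \<longlonglongrightarrow> invol p x"
        unfolding invol_def by (intro tendsto_cnj lim)
      then show "invol p x = p x"
        unfolding involP using lim by (rule LIMSEQ_unique)
    qed
    show "conv p p = p"
    proof
      fix x
      have "conv p (P (Suc m)) x = p x" for m
      proof (rule LIMSEQ_unique)
        show "(\<lambda>n. conv (P (Suc n)) (P (Suc m)) x) \<longlonglongrightarrow> conv p (P (Suc m)) x"
          by (intro conv_tendsto(1)[OF unif] cP cp)
        show "(\<lambda>n. conv (P (Suc n)) (P (Suc m)) x) \<longlonglongrightarrow> p x"
          unfolding convP by (rule lim')
      qed
      moreover have "(\<lambda>m. conv p (P (Suc m)) x) \<longlonglongrightarrow> conv p p x"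
        by (intro conv_tendsto(2)[OF unif] cP cp)
      ultimately show "conv p p x = p x"
        by (simp add: LIMSEQ_const_iff)
    qed
    show "conv p e = (\<lambda>_. 0)" if e: "cont e" "conv u e = (\<lambda>_. 0)" for e
    proof
      fix x
      have "conv (P (Suc n)) e x = 0" for n
      proof -
        have "conv (?u (Suc (2 * Suc n))) e = conv (?u (2 * Suc n)) (conv u e)"
          unfolding conv_power.simps(2)[of u "2 * Suc n"] by (rule conv_assoc[OF cu u(1) e(1)])
        then show ?thesis
          unfolding P_fun using e by (subst conv_scale_left) (auto simp: cu conv_zero_right simp del: conv_power.simps)
      qed
      moreover have "(\<lambda>n. conv (P (Suc n)) e x) \<longlonglongrightarrow> conv p e x"
        by (intro conv_tendsto(1)[OF unif] cP cp e(1))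
      ultimately show "conv p e x = 0"
        by (simp add: LIMSEQ_const_iff)
    qed
  qed
qed

section \<open>Irreducible representations from idempotents\<close>

definition orthonormal_family :: "nat \<Rightarrow> (nat \<Rightarrow> 'g \<Rightarrow> complex) \<Rightarrow> bool" where
  "orthonormal_family n f \<longleftrightarrow>
     (\<forall>i<n. cont (f i)) \<and> (\<forall>i<n. \<forall>j<n. ip (f i) (f j) = (if i = j then 1 else 0))"

lemma orthonormal_family_cont: "orthonormal_family n f \<Longrightarrow> i < n \<Longrightarrow> cont (f i)"
  by (simp add: orthonormal_family_def)

lemma cont_lincomb: "orthonormal_family n f \<Longrightarrow> cont (\<lambda>x. \<Sum>i<n. c i * f i x)"
  by (intro cont_intros) (simp add: orthonormal_family_cont)

lemma ip_lincomb_left: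
  assumes f: "orthonormal_family n f" and i: "i < n"
  shows "ip (\<lambda>x. \<Sum>j<n. c j * f j x) (f i) = c i"
proof -
  note c = orthonormal_family_cont[OF f]
  have "ip (\<lambda>x. \<Sum>j<n. c j * f j x) (f i) = (\<Sum>j<n. c j * ip (f j) (f i))"
    using c i by (subst ip_sum_left) (auto intro!: continuous_on_mult continuous_on_const simp: ip_scale_left)
  also have "\<dots> = (\<Sum>j<n. if j = i then c j else 0)"
    using f i by (intro sum.cong) (auto simp: orthonormal_family_def)
  finally show ?thesis
    using i by simp
qed

text \<open>Bessel's identity; nonnegativity of the left side gives the inequality behind the
  dimension bound.\<close>

lemma l2norm_lincomb_diff:
  assumes f: "orthonormal_family n f" and q: "cont q"
  shows "(l2norm (\<lambda>x. q x - (\<Sum>i<n. ip q (f i) * f i x)))\<^sup>2 = (l2norm q)\<^sup>2 - (\<Sum>i<n. (cmod (ip q (f i)))\<^sup>2)"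
proof -
  let ?s = "\<lambda>x. \<Sum>i<n. ip q (f i) * f i x"
  let ?A = "complex_of_real (\<Sum>i<n. (cmod (ip q (f i)))\<^sup>2)"
  note c = orthonormal_family_cont[OF f]
  have cs: "cont ?s"
    by (rule cont_lincomb[OF f])
  have expand: "ip k ?s = (\<Sum>i<n. cnj (ip q (f i)) * ip k (f i))" if k: "cont k" for k
    using c k by (subst ip_sum_right) (auto intro!: continuous_on_mult continuous_on_const simp: ip_scale_right)
  have "ip q ?s = ?A"
    unfolding expand[OF q] of_real_sum complex_norm_square by (simp add: mult.commute)
  moreover have "ip ?s ?s = ?A"
    unfolding expand[OF cs] of_real_sum complex_norm_square
    by (intro sum.cong refl, subst ip_lincomb_left[OF f]) (simp_all only: lessThan_iff mult.commute)
  ultimately have "(l2norm ?s)\<^sup>2 = (\<Sum>i<n. (cmod (ip q (f i)))\<^sup>2)" "Re (ip q ?s) = (\<Sum>i<n. (cmod (ip q (f i)))\<^sup>2)"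
    unfolding ip_self[OF cs] of_real_eq_iff by simp_all
  then show ?thesis
    unfolding l2norm_square_diff[OF q cs] by simp
qed

text \<open>Reproducing property: \<open>f i x\<close> is the scalar product of \<open>f i\<close>
  with a translate of \<open>p\<close>. Bessel's inequality for that translate bounds the sum of the
  squares of \<open>cmod (f i x)\<close> by \<open>p 0\<close>, and averaging over \<open>x\<close>
  turns this sum into \<open>n\<close>.\<close>

lemma orthonormal_family_bound:
  assumes p: "cont p" "invol p = p" "conv p p = p" and f: "orthonormal_family n f"
    and fp: "\<And>i. i < n \<Longrightarrow> conv (f i) p = f i"
  shows "real n \<le> Re (p 0)"
proof -
  note c = orthonormal_family_cont[OF f]
  have p0: "(l2norm p)\<^sup>2 = Re (p 0)"
    using ip_self[OF p(1)] ip_eq_conv[of p p] by (simp add: p flip: of_real_power)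
  have bound: "(\<Sum>i<n. (cmod (f i x))\<^sup>2) \<le> Re (p 0)" for x
  proof -
    have ct: "cont (translate x p)"
      by (rule cont_translate[OF p(1)])
    have "cmod (f i x) = cmod (ip (translate x p) (f i))" if "i < n" for i
    proof -
      have "f i x = ip (f i) (translate x p)"
        using fun_cong[OF fp[OF that], of x] by (simp add: conv_eq_ip p(2))
      also have "\<dots> = cnj (ip (translate x p) (f i))"
        by (rule ip_cnj[OF ct c[OF that], symmetric])
      finally show ?thesis
        by simp
    qed
    then have "(\<Sum>i<n. (cmod (f i x))\<^sup>2) = (\<Sum>i<n. (cmod (ip (translate x p) (f i)))\<^sup>2)"
      by simp
    also have "\<dots> \<le> (l2norm (translate x p))\<^sup>2"
      using l2norm_lincomb_diff[OF f ct] zero_le_power2 by (smt (verit))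
    finally show ?thesis
      by (simp add: l2norm_translate p p0)
  qed
  have sq: "cont (\<lambda>x. (cmod (f i x))\<^sup>2)" if "i < n" for i
    by (intro continuous_intros c[OF that])
  have "real n = (\<Sum>i<n. avg (\<lambda>x. (cmod (f i x))\<^sup>2))"
  proof -
    have "avg (\<lambda>x. (cmod (f i x))\<^sup>2) = 1" if "i < n" for i
      using ip_self_avg[OF c[OF that]] f that by (simp add: orthonormal_family_def)
    then show ?thesis
      by simp
  qed
  also have "\<dots> = avg (\<lambda>x. \<Sum>i<n. (cmod (f i x))\<^sup>2)"
    using sq by (intro avg_sum[symmetric]) simp
  also have "\<dots> \<le> avg (\<lambda>_. Re (p 0))"
    using sq by (intro avg_mono bound continuous_on_sum continuous_on_const) simp
  finally show ?thesis
    by (simp add: avg_const)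
qed

text \<open>Left translations commute with right convolution by \<open>p\<close>. Such spaces lie in
  the range of that convolution, where orthonormal families have bounded size.\<close>

definition invariant_space :: "('g \<Rightarrow> complex) \<Rightarrow> ('g \<Rightarrow> complex) set \<Rightarrow> bool" where
  "invariant_space p E \<longleftrightarrow> (\<forall>f\<in>E. cont f \<and> conv f p = f) \<and> (\<lambda>_. 0) \<in> E \<and>
     (\<forall>f\<in>E. \<forall>h\<in>E. (\<lambda>x. f x + h x) \<in> E) \<and> (\<forall>f\<in>E. \<forall>c. (\<lambda>x. c * f x) \<in> E) \<and>
     (\<forall>f\<in>E. \<forall>a. translate a f \<in> E)"

lemma invariant_space_add: "invariant_space p E \<Longrightarrow> f \<in> E \<Longrightarrow> h \<in> E \<Longrightarrow> (\<lambda>x. f x + h x) \<in> E"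
  by (simp add: invariant_space_def)

lemma invariant_space_scale: "invariant_space p E \<Longrightarrow> f \<in> E \<Longrightarrow> (\<lambda>x. c * f x) \<in> E"
  by (simp add: invariant_space_def)

lemma invariant_space_lincomb:
  fixes n :: nat
  assumes E: "invariant_space p E" and "\<And>i. i < n \<Longrightarrow> f i \<in> E"
  shows "(\<lambda>x. \<Sum>i<n. c i * f i x) \<in> E"
  using assms(2)
proof (induction n)
  case (Suc n)
  have "(\<lambda>x. (\<Sum>i<n. c i * f i x) + c n * f n x) \<in> E"
    by (intro invariant_space_add[OF E] invariant_space_scale[OF E] Suc) simp_all
  then show ?case
    by simp
qed (use E in \<open>simp add: invariant_space_def\<close>)

text \<open>A nonzero residual of \<open>h\<close>, once normalised, would extend the family by one
  member, against maximality.\<close>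

lemma maximal_orthonormal_family_spans:
  assumes E: "invariant_space p E" and f: "orthonormal_family n f" "\<And>i. i < n \<Longrightarrow> f i \<in> E"
    and max: "\<And>m k. orthonormal_family m k \<Longrightarrow> (\<And>i. i < m \<Longrightarrow> k i \<in> E) \<Longrightarrow> m \<le> n"
    and h: "h \<in> E"
  shows "h = (\<lambda>x. \<Sum>i<n. ip h (f i) * f i x)"
proof (rule ccontr)
  assume neq: "h \<noteq> (\<lambda>x. \<Sum>i<n. ip h (f i) * f i x)"
  note c = orthonormal_family_cont[OF f(1)]
  have ch: "cont h"
    using E h by (simp add: invariant_space_def)
  let ?s = "\<lambda>x. \<Sum>i<n. ip h (f i) * f i x"
  have cs: "cont ?s"
    by (rule cont_lincomb[OF f(1)])
  define r where "r = (\<lambda>x. h x - ?s x)"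
  have cr: "cont r"
    unfolding r_def by (rule continuous_on_diff[OF ch cs])
  have rE: "r \<in> E"
  proof -
    have "(\<lambda>x. h x + - 1 * ?s x) \<in> E"
      by (intro invariant_space_add[OF E h] invariant_space_scale[OF E] invariant_space_lincomb[OF E] f(2))
    then show ?thesis
      by (simp add: r_def)
  qed
  have r_orth: "ip r (f i) = 0" if "i < n" for i
    using that unfolding r_def by (simp add: ip_diff_left[OF ch cs c] ip_lincomb_left[OF f(1)])
  have r0: "0 < l2norm r"
    using l2norm_eq_0[OF cr] l2norm_nonneg[OF cr] neq unfolding r_def
    by (metis (no_types, lifting) eq_iff_diff_eq_0 ext less_eq_real_def)
  define k where "k = (\<lambda>x. complex_of_real (1 / l2norm r) * r x)"
  have ck: "cont k"
    unfolding k_def by (intro continuous_on_mult continuous_on_const cr)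
  have kE: "k \<in> E"
    unfolding k_def by (rule invariant_space_scale[OF E rE])
  have "ip k k = complex_of_real (1 / l2norm r) * (complex_of_real (1 / l2norm r) * ip r r)"
    unfolding k_def by (subst ip_scale_left[OF cr ck[unfolded k_def]], subst ip_scale_right[OF cr cr]) simp
  also have "\<dots> = 1"
    using r0 by (simp add: ip_self[OF cr] power2_eq_square)
  finally have kk: "ip k k = 1" .
  have kf: "ip k (f i) = 0" "ip (f i) k = 0" if "i < n" for i
  proof -
    show "ip k (f i) = 0"
      unfolding k_def ip_scale_left[OF cr c[OF that]] r_orth[OF that] by simp
    then show "ip (f i) k = 0"
      using ip_cnj[OF ck c[OF that]] by simp
  qed
  have "orthonormal_family (Suc n) (f(n := k))"
    using f(1) ck kk kf by (auto simp: orthonormal_family_def less_Suc_eq)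
  moreover have "(f(n := k)) i \<in> E" if "i < Suc n" for i
    using that f(2) kE by (auto simp: less_Suc_eq)
  ultimately show False
    using max by force
qed

lemma ip_translate: "cont f \<Longrightarrow> cont h \<Longrightarrow> ip (translate a f) (translate a h) = ip f h"
  unfolding ip_def translate_def
  by (rule avg_translate[of "\<lambda>x. f x * cnj (h x)"]) (intro continuous_on_mult continuous_on_cnj)

lemma translate_translate: "translate a (translate b f) = translate (a + b) f"
  by (simp add: translate_def fun_eq_iff minus_add add.assoc del: add_uminus_conv_diff)

lemma translate_zero: "translate 0 f = f"
  by (simp add: translate_def fun_eq_iff)

text \<open>A nonzero invariant space of least dimension carries an irreducible representation by
  left translations. Dimension is measured by the largest size of an orthonormal family, which
  \<open>orthonormal_family_bound\<close> keeps finite.\<close>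

lemma exists_irreducible_coefficients:
  assumes p: "cont p" "invol p = p" "conv p p = p" "1 \<le> Re (p 0)"
  shows "\<exists>n f \<pi>. irreducible_unitary_rep n \<pi> \<and> orthonormal_family n f \<and> (\<forall>i<n. conv (f i) p = f i) \<and>
    (\<forall>j<n. \<forall>x. f j x = (\<Sum>i<n. f i 0 * cnj (\<pi> x $$ (j, i))))"
proof -
  define fams where "fams E = {n. \<exists>f. orthonormal_family n f \<and> (\<forall>i<n. f i \<in> E)}" for E
  have fin: "finite (fams E)" if "invariant_space p E" for E
  proof (rule finite_subset)
    show "fams E \<subseteq> {..nat \<lfloor>Re (p 0)\<rfloor>}"
      using orthonormal_family_bound[OF p(1-3)] that
      by (auto simp: fams_def invariant_space_def le_nat_floor)
  qed simp
  have ne: "0 \<in> fams E" for E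
    by (simp add: fams_def orthonormal_family_def)
  define good where "good E \<longleftrightarrow> invariant_space p E \<and> (\<exists>f\<in>E. f \<noteq> (\<lambda>_. 0))" for E
  have "p \<noteq> (\<lambda>_. 0)"
    using p(4) by auto
  have "good {f. cont f \<and> conv f p = f}"
    unfolding good_def invariant_space_def
  proof (intro conjI ballI allI)
    show "\<exists>f\<in>{f. cont f \<and> conv f p = f}. f \<noteq> (\<lambda>_. 0)"
      using p \<open>p \<noteq> (\<lambda>_. 0)\<close> by blast
    show "(\<lambda>x. f x + h x) \<in> {f. cont f \<and> conv f p = f}"
      if "f \<in> {f. cont f \<and> conv f p = f}" "h \<in> {f. cont f \<and> conv f p = f}" for f h
    proof -
      have f: "cont f" "conv f p = f" and h: "cont h" "conv h p = h" "cont (\<lambda>x. - h x)"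
        using that by (auto intro: continuous_on_minus)
      have "conv (\<lambda>x. - 1 * h x) p x = - 1 * conv h p x" for x
        by (rule conv_scale_left[OF h(1) p(1)])
      then have "conv (\<lambda>x. f x - - h x) p x = f x + h x" for x
        by (subst conv_diff_left[OF f(1) h(3) p(1)]) (simp add: f h)
      then show ?thesis
        using f h by (auto intro: continuous_on_add)
    qed
    show "(\<lambda>x. c * f x) \<in> {f. cont f \<and> conv f p = f}" if "f \<in> {f. cont f \<and> conv f p = f}" for f c
      using that p(1) by (auto simp: conv_scale_left intro: continuous_on_mult_left)
    show "translate a f \<in> {f. cont f \<and> conv f p = f}" if "f \<in> {f. cont f \<and> conv f p = f}" for f a
      using that p(1) by (auto simp: conv_translate cont_translate)
  qed (auto simp: conv_zero_left)
  then obtain E where E: "good E" and least: "\<And>E'. good E' \<Longrightarrow> Max (fams E) \<le> Max (fams E')"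
    using ex_has_least_nat[of good _ "\<lambda>E. Max (fams E)"] by blast
  have inv: "invariant_space p E"
    using E by (simp add: good_def)
  define n where "n = Max (fams E)"
  have "n \<in> fams E"
    unfolding n_def using fin[OF inv] ne by (intro Max_in) auto
  then obtain f where f: "orthonormal_family n f" "\<And>i. i < n \<Longrightarrow> f i \<in> E"
    by (auto simp: fams_def)
  note cf = orthonormal_family_cont[OF f(1)]
  have max: "m \<le> n" if "orthonormal_family m k" "\<And>i. i < m \<Longrightarrow> k i \<in> E" for m k
    unfolding n_def using that by (intro Max_ge fin[OF inv]) (auto simp: fams_def)
  have spans: "h = (\<lambda>x. \<Sum>i<n. ip h (k i) * k i x)"
    if "orthonormal_family n k" "\<And>i. i < n \<Longrightarrow> k i \<in> E" "h \<in> E" for h k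
    by (rule maximal_orthonormal_family_spans[OF inv that(1,2) max that(3)])
  have "0 < n"
  proof (rule ccontr)
    assume "\<not> 0 < n"
    obtain h where "h \<in> E" "h \<noteq> (\<lambda>_. 0)"
      using E by (auto simp: good_def)
    then show False
      using spans[OF f, of h] \<open>\<not> 0 < n\<close> by simp
  qed
  \<comment> \<open>The matrix of left translation by \<open>g\<close> in the orthonormal basis
    \<open>f\<close> of \<open>E\<close>; unitarity comes from translation invariance of the scalar
    product.\<close>
  define \<pi> where "\<pi> g = mat n n (\<lambda>(i, j). ip (translate g (f j)) (f i))" for g
  have \<pi>c: "\<pi> g \<in> carrier_mat n n" for g
    by (simp add: \<pi>_def)
  have \<pi>_index: "\<pi> g $$ (i, j) = ip (translate g (f j)) (f i)" if "i < n" "j < n" for g i j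
    using that by (simp add: \<pi>_def)
  have translate_f: "translate g (f j) x = (\<Sum>i<n. \<pi> g $$ (i, j) * f i x)" if "j < n" for g j x
  proof -
    have "translate g (f j) \<in> E"
      using inv f(2)[OF that] by (simp add: invariant_space_def)
    from fun_cong[OF spans[OF f this], of x] show ?thesis
      using that by (simp add: \<pi>_index)
  qed
  have \<pi>_add: "\<pi> (g + h) = \<pi> g * \<pi> h" for g h
  proof (rule eq_matI)
    fix i j assume "i < dim_row (\<pi> g * \<pi> h)" "j < dim_col (\<pi> g * \<pi> h)"
    then have i: "i < n" and j: "j < n"
      using \<pi>c[of g] \<pi>c[of h] by auto
    have "translate (g + h) (f j) = (\<lambda>x. \<Sum>k<n. \<pi> h $$ (k, j) * translate g (f k) x)"
    proof
      fix x
      have "translate (g + h) (f j) x = translate h (f j) (- g + x)"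
        by (simp add: translate_def minus_add add.assoc del: add_uminus_conv_diff)
      then show "translate (g + h) (f j) x = (\<Sum>k<n. \<pi> h $$ (k, j) * translate g (f k) x)"
        by (simp add: translate_f[OF j]) (simp add: translate_def)
    qed
    then have "\<pi> (g + h) $$ (i, j) = ip (\<lambda>x. \<Sum>k<n. \<pi> h $$ (k, j) * translate g (f k) x) (f i)"
      using i j by (simp add: \<pi>_index)
    also have "\<dots> = (\<Sum>k<n. \<pi> h $$ (k, j) * ip (translate g (f k)) (f i))"
      using cf i by (subst ip_sum_left) (auto intro!: continuous_on_mult continuous_on_const cont_translate simp: ip_scale_left cont_translate)
    also have "\<dots> = (\<pi> g * \<pi> h) $$ (i, j)"
      unfolding index_mult_mat_sum[OF \<pi>c \<pi>c i j] using i by (simp add: \<pi>_index mult.commute)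
    finally show "\<pi> (g + h) $$ (i, j) = (\<pi> g * \<pi> h) $$ (i, j)" .
  qed (use \<pi>c in \<open>simp_all add: \<pi>_def\<close>)
  have \<pi>_zero: "\<pi> 0 = 1\<^sub>m n"
    using f(1) by (intro eq_matI) (auto simp: \<pi>_def translate_zero orthonormal_family_def)
  have \<pi>_adj: "mat_adjoint (\<pi> g) = \<pi> (- g)" for g
  proof (rule eq_matI)
    fix i j assume "i < dim_row (\<pi> (- g))" "j < dim_col (\<pi> (- g))"
    then have i: "i < n" and j: "j < n"
      using \<pi>c[of "- g"] by auto
    have "\<pi> (- g) $$ (i, j) = ip (translate g (translate (- g) (f j))) (translate g (f i))"
      using i j by (simp add: \<pi>_index ip_translate cont_translate cf)
    also have "\<dots> = cnj (\<pi> g $$ (j, i))"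
      using i j by (simp add: translate_translate translate_zero \<pi>_index ip_cnj cont_translate cf)
    finally show "mat_adjoint (\<pi> g) $$ (i, j) = \<pi> (- g) $$ (i, j)"
      by (simp add: index_mat_adjoint[OF \<pi>c i j])
  qed (simp_all add: \<pi>_def)
  have rep: "unitary_rep n \<pi>"
    unfolding unitary_rep_def unitary_mat_def
  proof (intro conjI allI impI)
    show "mat_adjoint (\<pi> g) * \<pi> g = 1\<^sub>m n" "\<pi> g * mat_adjoint (\<pi> g) = 1\<^sub>m n" for g
      by (simp_all add: \<pi>_adj \<pi>_zero flip: \<pi>_add)
    show "cont (\<lambda>g. \<pi> g $$ (i, j))" if "i < n" "j < n" for i j
    proof -
      have "cont (\<lambda>g. avg (\<lambda>x. f j (- g + x) * cnj (f i x)))"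
        by (intro continuous_on_avg continuous_on_mult continuous_on_cnj cont_compose[OF cf[OF that(1)]]
            cont_compose[OF cf[OF that(2)]] continuous_intros)
      then show ?thesis
        using that by (simp add: \<pi>_index ip_def translate_def)
    qed
  qed (fact \<pi>c \<pi>_add)+
  have "W = {0\<^sub>v n} \<or> W = carrier_vec n"
    if W: "VectorSpace.subspace class_ring W (module_vec TYPE(complex) n)"
      and W_inv: "\<forall>g. \<forall>w\<in>W. \<pi> g *\<^sub>v w \<in> W" for W
  proof (cases "W = {0\<^sub>v n}")
    case False
    note sub = subspaceD_vec[OF W]
    \<comment> \<open>The coordinate map: it transports a \<open>\<pi>\<close>-invariant subspace of
      vectors to a translation-invariant subspace of \<open>E\<close>, to which minimality
      applies.\<close>
    define L where "L w x = (\<Sum>j<n. w $ j * f j x)" for w and x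
    have L_ip: "ip (L w) (f i) = w $ i" if "i < n" for w i
      unfolding L_def by (rule ip_lincomb_left[OF f(1) that])
    have LE: "L w \<in> E" for w
      unfolding L_def[abs_def] by (rule invariant_space_lincomb[OF inv f(2)])
    have LWE: "h \<in> E" if "h \<in> L ` W" for h
      using that LE by blast
    have inv': "invariant_space p (L ` W)"
      unfolding invariant_space_def
    proof (intro conjI ballI allI)
      show "cont h" "conv h p = h" if "h \<in> L ` W" for h
        using that LE inv by (auto simp: invariant_space_def)
      have "L (0\<^sub>v n) = (\<lambda>_. 0)"
        by (simp add: L_def fun_eq_iff)
      then show "(\<lambda>_. 0) \<in> L ` W"
        using sub(2) by force
      show "(\<lambda>x. h x + k x) \<in> L ` W" if hk: "h \<in> L ` W" "k \<in> L ` W" for h k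
      proof -
        obtain v w where vw: "v \<in> W" "w \<in> W" "h = L v" "k = L w"
          using hk by blast
        then have "v \<in> carrier_vec n" "w \<in> carrier_vec n"
          using sub(1) by auto
        then have "(\<lambda>x. h x + k x) = L (v + w)"
          by (auto simp: vw L_def fun_eq_iff algebra_simps sum.distrib)
        then show ?thesis
          using sub(3)[OF vw(1,2)] by blast
      qed
      show "(\<lambda>x. c * h x) \<in> L ` W" if h: "h \<in> L ` W" for h c
      proof -
        obtain v where v: "v \<in> W" "h = L v"
          using h by blast
        then have "v \<in> carrier_vec n"
          using sub(1) by auto
        then have "(\<lambda>x. c * h x) = L (c \<cdot>\<^sub>v v)"
          by (auto simp: v L_def fun_eq_iff sum_distrib_left mult.assoc)
        then show ?thesis
          using sub(4)[OF v(1)] by blast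
      qed
      show "translate a h \<in> L ` W" if h: "h \<in> L ` W" for h a
      proof -
        obtain v where v: "v \<in> W" "h = L v"
          using h by blast
        then have vc: "v \<in> carrier_vec n"
          using sub(1) by auto
        have "translate a h x = L (\<pi> a *\<^sub>v v) x" for x
        proof -
          have "translate a h x = (\<Sum>j<n. v $ j * translate a (f j) x)"
            by (simp add: v L_def translate_def)
          also have "\<dots> = (\<Sum>j<n. \<Sum>i<n. \<pi> a $$ (i, j) * v $ j * f i x)"
            by (simp add: translate_f sum_distrib_left mult_ac)
          also have "\<dots> = (\<Sum>i<n. (\<Sum>j<n. \<pi> a $$ (i, j) * v $ j) * f i x)"
            by (subst sum.swap) (simp add: sum_distrib_right)
          also have "\<dots> = L (\<pi> a *\<^sub>v v) x"
            unfolding L_def by (intro sum.cong refl, subst index_mult_mat_vec_sum[OF \<pi>c vc]) simp_all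
          finally show ?thesis .
        qed
        then have "translate a h = L (\<pi> a *\<^sub>v v)"
          by blast
        then show ?thesis
          using W_inv v(1) by blast
      qed
    qed
    obtain w where w: "w \<in> W" "w \<noteq> 0\<^sub>v n"
      using False sub(2) by blast
    then have wc: "w \<in> carrier_vec n"
      using sub(1) by auto
    have "L w \<noteq> (\<lambda>_. 0)"
    proof
      assume L0: "L w = (\<lambda>_. 0)"
      have "w $ i = 0" if "i < n" for i
        using L_ip[OF that, of w] unfolding L0 by (simp add: ip_def avg_const)
      then show False
        using w(2) wc by (auto intro!: eq_vecI)
    qed
    then have "good (L ` W)"
      using inv' w(1) by (auto simp: good_def)
    \<comment> \<open>Minimality provides an orthonormal family of full size \<open>n\<close> inside
      the image of \<open>W\<close>. It spans \<open>E\<close>, so the image is all of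
      \<open>E\<close> and \<open>W\<close> is the full space.\<close>
    then have "n \<le> Max (fams (L ` W))"
      unfolding n_def by (rule least)
    moreover have "Max (fams (L ` W)) \<in> fams (L ` W)"
      using fin[OF inv'] ne by (intro Max_in) auto
    then obtain k where k: "orthonormal_family (Max (fams (L ` W))) k"
        "\<And>i. i < Max (fams (L ` W)) \<Longrightarrow> k i \<in> L ` W"
      by (auto simp: fams_def)
    moreover have "Max (fams (L ` W)) \<le> n"
      by (rule max[OF k(1) LWE[OF k(2)]])
    ultimately have k: "orthonormal_family n k" "\<And>i. i < n \<Longrightarrow> k i \<in> L ` W"
      by auto
    have "v \<in> W" if v: "v \<in> carrier_vec n" for v
    proof -
      have "L v = (\<lambda>x. \<Sum>i<n. ip (L v) (k i) * k i x)"
        by (rule spans[OF k(1) LWE[OF k(2)] LE])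
      moreover have "(\<lambda>x. \<Sum>i<n. ip (L v) (k i) * k i x) \<in> L ` W"
        by (rule invariant_space_lincomb[OF inv' k(2)])
      ultimately obtain w where w: "w \<in> W" "L v = L w"
        by auto
      then have "dim_vec w = n" "dim_vec v = n"
        using v sub(1) by auto
      then have "v = w"
        using L_ip[of _ v] L_ip[of _ w] w(2) by (intro eq_vecI) simp_all
      then show ?thesis
        using w(1) by simp
    qed
    then show ?thesis
      using sub(1) by auto
  qed simp
  then have irr: "irreducible_unitary_rep n \<pi>"
    using rep \<open>0 < n\<close> by (simp add: irreducible_unitary_rep_def)
  show ?thesis
  proof (intro exI conjI allI impI)
    show "irreducible_unitary_rep n \<pi>" "orthonormal_family n f"
      by (fact irr f(1))+
    show "conv (f i) p = f i" if "i < n" for i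
      using inv f(2)[OF that] by (simp add: invariant_space_def)
    show "f j x = (\<Sum>i<n. f i 0 * cnj (\<pi> x $$ (j, i)))" if j: "j < n" for j x
    proof -
      \<comment> \<open>Evaluating a translate at 0 expresses the basis functions through
        coefficients of \<open>\<pi>\<close>.\<close>
      have "f j x = translate (- x) (f j) 0"
        by (simp add: translate_def)
      then show ?thesis
        using j by (simp add: translate_f rep_uminus_index[OF rep] mult.commute)
    qed
  qed
qed

section \<open>Characters and the Peter-Weyl theorem\<close>

text \<open>The conjugated character is the weight in \<open>spectral_proj\<close>; with the factor
  \<open>dim D\<close> it is an idempotent for \<open>conv\<close>.\<close>

definition class_fun :: "('g \<Rightarrow> complex mat) set \<Rightarrow> 'g \<Rightarrow> complex" where
  "class_fun D x = cnj (char_class D x)"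

lemma class_fun_eq:
  assumes "D \<in> dual" "\<pi> \<in> D" "unitary_rep n \<pi>"
  shows "class_fun D x = of_nat n * (\<Sum>k<n. cnj (\<pi> x $$ (k, k)))"
  by (simp add: class_fun_def char_class_eq[OF assms])

lemma cont_class_fun:
  assumes D: "D \<in> dual"
  shows "cont (class_fun D)"
proof -
  obtain n \<pi> where \<pi>: "\<pi> \<in> D" "irreducible_unitary_rep n \<pi>" and rep: "unitary_rep n \<pi>"
    using dual_rep[OF D] .
  have "class_fun D = (\<lambda>x. of_nat n * (\<Sum>k<n. cnj (\<pi> x $$ (k, k))))"
    using class_fun_eq[OF D \<pi>(1) rep] by auto
  moreover have "cont (\<lambda>x. of_nat n * (\<Sum>k<n. cnj (\<pi> x $$ (k, k))))"
    by (intro continuous_intros rep_continuous[OF rep]) simp_all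
  ultimately show ?thesis
    by simp
qed

lemma class_fun_central:
  assumes D: "D \<in> dual"
  shows "class_fun D (x + y) = class_fun D (y + x)"
proof -
  obtain n \<pi> where \<pi>: "\<pi> \<in> D" "irreducible_unitary_rep n \<pi>" and rep: "unitary_rep n \<pi>"
    using dual_rep[OF D] .
  have "(\<Sum>k<n. \<pi> (x + y) $$ (k, k)) = (\<Sum>k<n. \<pi> (y + x) $$ (k, k))"
    unfolding rep_add[OF rep] by (rule sum_diag_mult_commute[OF rep_carrier[OF rep] rep_carrier[OF rep]])
  then show ?thesis
    unfolding class_fun_eq[OF D \<pi>(1) rep] cnj_sum[symmetric] by simp
qed

lemma invol_class_fun:
  assumes D: "D \<in> dual"
  shows "invol (class_fun D) = class_fun D"
proof -
  obtain n \<pi> where \<pi>: "\<pi> \<in> D" "irreducible_unitary_rep n \<pi>" and rep: "unitary_rep n \<pi>"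
    using dual_rep[OF D] .
  show ?thesis
    by (simp add: invol_def fun_eq_iff class_fun_eq[OF D \<pi>(1) rep] rep_uminus_index[OF rep])
qed

text \<open>The value \<open>class_fun D (- y + x)\<close> splits into products of a coefficient at
  \<open>y\<close> and a conjugated one at \<open>x\<close>, so the convolution becomes a finite sum
  of averages to which Schur orthogonality applies.\<close>

lemma conv_coefficient_class_fun:
  assumes f: "cont f" and D: "D \<in> dual" "\<rho> \<in> D" "unitary_rep m \<rho>"
  shows "conv f (class_fun D) x = of_nat m * (\<Sum>k<m. \<Sum>l<m. avg (\<lambda>y. \<rho> y $$ (l, k) * f y) * cnj (\<rho> x $$ (l, k)))"
proof -
  note rep = D(3)
  have c: "cont (\<lambda>y. \<rho> y $$ (l, k) * f y)" if "l < m" "k < m" for l k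
    using that by (intro continuous_on_mult rep_continuous[OF rep] f)
  have c2: "cont (\<lambda>y. \<Sum>l<m. (\<rho> y $$ (l, k) * f y) * cnj (\<rho> x $$ (l, k)))" if "k < m" for k
    using that by (intro continuous_on_sum continuous_on_mult_right c) simp_all
  have "f y * class_fun D (- y + x) =
      of_nat m * (\<Sum>k<m. \<Sum>l<m. (\<rho> y $$ (l, k) * f y) * cnj (\<rho> x $$ (l, k)))" for y
  proof -
    have "class_fun D (- y + x) = of_nat m * (\<Sum>k<m. \<Sum>l<m. \<rho> y $$ (l, k) * cnj (\<rho> x $$ (l, k)))"
      unfolding class_fun_eq[OF D] by (simp add: rep_add_index[OF rep] rep_uminus_index[OF rep])
    then show ?thesis
      by (simp add: sum_distrib_left mult_ac)
  qed
  then have "conv f (class_fun D) x =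
      avg (\<lambda>y. of_nat m * (\<Sum>k<m. \<Sum>l<m. (\<rho> y $$ (l, k) * f y) * cnj (\<rho> x $$ (l, k))))"
    by (simp add: conv_def)
  also have "\<dots> = of_nat m * avg (\<lambda>y. \<Sum>k<m. \<Sum>l<m. (\<rho> y $$ (l, k) * f y) * cnj (\<rho> x $$ (l, k)))"
    by (intro avg_mult_left continuous_on_sum c2) simp
  also have "avg (\<lambda>y. \<Sum>k<m. \<Sum>l<m. (\<rho> y $$ (l, k) * f y) * cnj (\<rho> x $$ (l, k))) =
      (\<Sum>k<m. avg (\<lambda>y. \<Sum>l<m. (\<rho> y $$ (l, k) * f y) * cnj (\<rho> x $$ (l, k))))"
    by (intro avg_sum c2) simp
  also have "\<dots> = (\<Sum>k<m. \<Sum>l<m. avg (\<lambda>y. (\<rho> y $$ (l, k) * f y) * cnj (\<rho> x $$ (l, k))))"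
    by (intro sum.cong refl avg_sum continuous_on_mult_right c) simp_all
  also have "\<dots> = (\<Sum>k<m. \<Sum>l<m. avg (\<lambda>y. \<rho> y $$ (l, k) * f y) * cnj (\<rho> x $$ (l, k)))"
    by (intro sum.cong refl avg_mult_right c) simp_all
  finally show ?thesis .
qed

text \<open>By Schur orthogonality a single term survives, and its value \<open>1 / n\<close>
  cancels the dimension contained in \<open>class_fun\<close>.\<close>

lemma conv_coefficient_same:
  assumes D: "D \<in> dual" "\<pi> \<in> D" "irreducible_unitary_rep n \<pi>" and "i < n" "j < n"
  shows "conv (\<lambda>y. cnj (\<pi> y $$ (j, i))) (class_fun D) = (\<lambda>x. cnj (\<pi> x $$ (j, i)))"
proof
  fix x
  have rep: "unitary_rep n \<pi>" and n: "0 < n"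
    using D(3) by (auto simp: irreducible_unitary_rep_def)
  have "cont (\<lambda>y. cnj (\<pi> y $$ (j, i)))"
    using assms by (intro continuous_on_cnj rep_continuous[OF rep])
  from conv_coefficient_class_fun[OF this D(1,2) rep, of x]
  have "conv (\<lambda>y. cnj (\<pi> y $$ (j, i))) (class_fun D) x =
      of_nat n * (\<Sum>k<n. \<Sum>l<n. (if l = j \<and> k = i then 1 / of_nat n else 0) * cnj (\<pi> x $$ (l, k)))"
    using assms by (simp add: schur_orthogonality[OF D(3)])
  also have "(\<Sum>k<n. \<Sum>l<n. (if l = j \<and> k = i then 1 / of_nat n else 0) * cnj (\<pi> x $$ (l, k))) =
      (\<Sum>k<n. if k = i then 1 / of_nat n * cnj (\<pi> x $$ (j, k)) else 0)"
  proof (intro sum.cong refl)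
    fix k
    have "(\<Sum>l<n. (if l = j \<and> k = i then 1 / of_nat n else 0) * cnj (\<pi> x $$ (l, k))) =
        (\<Sum>l<n. if l = j then (if k = i then 1 / of_nat n * cnj (\<pi> x $$ (j, k)) else 0) else 0)"
      by (intro sum.cong) auto
    then show "(\<Sum>l<n. (if l = j \<and> k = i then 1 / of_nat n else 0) * cnj (\<pi> x $$ (l, k))) =
        (if k = i then 1 / of_nat n * cnj (\<pi> x $$ (j, k)) else 0)"
      using \<open>j < n\<close> by simp
  qed
  also have "\<dots> = 1 / of_nat n * cnj (\<pi> x $$ (j, i))"
    using \<open>i < n\<close> by simp
  finally show "conv (\<lambda>y. cnj (\<pi> y $$ (j, i))) (class_fun D) x = cnj (\<pi> x $$ (j, i))"
    using n by simp
qed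

lemma conv_coefficient_different:
  assumes D: "D \<in> dual" "\<pi> \<in> D" "irreducible_unitary_rep n \<pi>" and D': "D' \<in> dual" "D \<noteq> D'" and "i < n" "j < n"
  shows "conv (\<lambda>y. cnj (\<pi> y $$ (j, i))) (class_fun D') = (\<lambda>_. 0)"
proof
  fix x
  obtain m \<rho> where \<rho>: "\<rho> \<in> D'" "irreducible_unitary_rep m \<rho>" "unitary_rep m \<rho>"
    using dual_rep[OF D'(1)] .
  have rep: "unitary_rep n \<pi>" "unitary_rep m \<rho>"
    using D(3) \<rho>(3) by (auto simp: irreducible_unitary_rep_def)
  have "(\<pi>, \<rho>) \<notin> rep_equiv"
    using quotient_eq_iff[OF equiv_rep_equiv, of D D' \<pi> \<rho>] D D' \<rho> by (simp add: dual_def)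
  then have orth: "avg (\<lambda>y. \<rho> y $$ (l, k) * cnj (\<pi> y $$ (j, i))) = 0" if "l < m" "k < m" for l k
    using schur_orthogonality_inequivalent[OF \<rho>(2) D(3)] that assms by blast
  have "cont (\<lambda>y. cnj (\<pi> y $$ (j, i)))"
    using assms by (intro continuous_on_cnj rep_continuous[OF rep(1)])
  from conv_coefficient_class_fun[OF this D'(1) \<rho>(1) rep(2), of x]
  show "conv (\<lambda>y. cnj (\<pi> y $$ (j, i))) (class_fun D') x = 0"
    by (simp add: orth)
qed

lemma conv_class_fun:
  assumes D: "D \<in> dual" and D': "D' \<in> dual"
  shows "conv (class_fun D) (class_fun D') x = (if D = D' then class_fun D x else 0)"
proof -
  obtain n \<pi> where \<pi>: "\<pi> \<in> D" "irreducible_unitary_rep n \<pi>" and rep: "unitary_rep n \<pi>"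
    using dual_rep[OF D] .
  have c: "cont (\<lambda>y. cnj (\<pi> y $$ (k, k)))" if "k < n" for k
    using that by (intro continuous_on_cnj rep_continuous[OF rep])
  have "class_fun D = (\<lambda>x. of_nat n * (\<Sum>k<n. cnj (\<pi> x $$ (k, k))))"
    using class_fun_eq[OF D \<pi>(1) rep] by auto
  then have "conv (class_fun D) (class_fun D') x = conv (\<lambda>x. of_nat n * (\<Sum>k<n. cnj (\<pi> x $$ (k, k)))) (class_fun D') x"
    by simp
  also have "\<dots> = of_nat n * conv (\<lambda>x. \<Sum>k<n. cnj (\<pi> x $$ (k, k))) (class_fun D') x"
    using c by (intro conv_scale_left cont_class_fun[OF D'] continuous_on_sum) simp
  also have "conv (\<lambda>x. \<Sum>k<n. cnj (\<pi> x $$ (k, k))) (class_fun D') x =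
      (\<Sum>k<n. conv (\<lambda>x. cnj (\<pi> x $$ (k, k))) (class_fun D') x)"
    using c by (intro conv_sum_left cont_class_fun[OF D']) simp
  also have "of_nat n * \<dots> = (if D = D' then class_fun D x else 0)"
  proof (cases "D = D'")
    case True
    then show ?thesis
      using conv_coefficient_same[OF D \<pi>] class_fun_eq[OF D \<pi>(1) rep] by simp
  next
    case False
    then show ?thesis
      using conv_coefficient_different[OF D \<pi> D' False] by simp
  qed
  finally show ?thesis .
qed

text \<open>Completeness: the idempotent of a self-adjoint \<open>u \<noteq> 0\<close> reproduces the coefficients of some irreducible
  representation, and these do not vanish under convolution with their character.\<close>

lemma eq_zero_if_conv_class_fun_zero:
  assumes u: "cont u" "invol u = u" and zero: "\<And>D. D \<in> dual \<Longrightarrow> conv u (class_fun D) = (\<lambda>_. 0)"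
  shows "u a = 0"
proof (rule ccontr)
  assume "u a \<noteq> 0"
  obtain p where p: "cont p" "invol p = p" "conv p p = p" "1 \<le> Re (p 0)"
      "\<And>e. cont e \<Longrightarrow> conv u e = (\<lambda>_. 0) \<Longrightarrow> conv p e = (\<lambda>_. 0)"
    using exists_idempotent[OF u \<open>u a \<noteq> 0\<close>] by metis
  obtain n f \<pi> where \<pi>: "irreducible_unitary_rep n \<pi>" and f: "orthonormal_family n f"
      "\<forall>i<n. conv (f i) p = f i" "\<forall>j<n. \<forall>x. f j x = (\<Sum>i<n. f i 0 * cnj (\<pi> x $$ (j, i)))"
    using exists_irreducible_coefficients[OF p(1-4)] by blast
  have n: "0 < n" and rep: "unitary_rep n \<pi>"
    using \<pi> by (auto simp: irreducible_unitary_rep_def)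
  define D where "D = rep_equiv `` {\<pi>}"
  have irr: "\<pi> \<in> irreps"
    using \<pi> by (auto simp: irreps_def)
  have D: "D \<in> dual" "\<pi> \<in> D"
    unfolding D_def dual_def by (rule quotientI[OF irr], rule equiv_class_self[OF equiv_rep_equiv irr])
  note cD = cont_class_fun[OF D(1)]
  have f0: "f 0 x = (\<Sum>i<n. f i 0 * cnj (\<pi> x $$ (0, i)))" for x
    using f(3) n by blast
  have cf0: "cont (f 0)"
    by (rule orthonormal_family_cont[OF f(1) n])
  have c: "cont (\<lambda>y. cnj (\<pi> y $$ (0, i)))" if "i < n" for i
    using that n by (intro continuous_on_cnj rep_continuous[OF rep])
  \<comment> \<open>\<open>f 0\<close> is reproduced by convolution with \<open>p\<close> and with
    \<open>class_fun D\<close>, whereas \<open>conv p (class_fun D)\<close> vanishes; associativity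
    leaves zero, against unit norm.\<close>
  have "f 0 x = 0" for x
  proof -
    have "f 0 x = (\<Sum>i<n. f i 0 * conv (\<lambda>y. cnj (\<pi> y $$ (0, i))) (class_fun D) x)"
      unfolding f0[of x] by (intro sum.cong refl) (simp add: conv_coefficient_same[OF D \<pi> _ n])
    also have "\<dots> = (\<Sum>i<n. conv (\<lambda>y. f i 0 * cnj (\<pi> y $$ (0, i))) (class_fun D) x)"
      by (intro sum.cong refl conv_scale_left[symmetric] c cD) simp
    also have "\<dots> = conv (\<lambda>y. \<Sum>i<n. f i 0 * cnj (\<pi> y $$ (0, i))) (class_fun D) x"
      by (intro conv_sum_left[symmetric] continuous_on_mult_left c cD) simp
    also have "(\<lambda>y. \<Sum>i<n. f i 0 * cnj (\<pi> y $$ (0, i))) = conv (f 0) p"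
      using f0 f(2) n by (auto simp: fun_eq_iff)
    also have "conv (conv (f 0) p) (class_fun D) = conv (f 0) (conv p (class_fun D))"
      by (rule conv_assoc[OF cf0 p(1) cD])
    also have "\<dots> = (\<lambda>_. 0)"
      unfolding p(5)[OF cD zero[OF D(1)]] by (rule conv_zero_right)
    finally show ?thesis .
  qed
  then have "ip (f 0) (f 0) = 0"
    by (simp add: ip_def avg_const)
  then show False
    using f(1) n by (simp add: orthonormal_family_def)
qed

section \<open>Finite sums of characters and approximation in the L2 norm\<close>

definition sum_class_fun :: "('g \<Rightarrow> complex mat) set set \<Rightarrow> 'g \<Rightarrow> complex" where
  "sum_class_fun S x = (\<Sum>D\<in>S. class_fun D x)"

lemma cont_sum_class_fun: "S \<subseteq> dual \<Longrightarrow> cont (sum_class_fun S)"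
  unfolding sum_class_fun_def by (intro continuous_on_sum cont_class_fun) auto

lemma sum_class_fun_singleton: "sum_class_fun {D} = class_fun D"
  by (simp add: sum_class_fun_def fun_eq_iff)

lemma invol_sum_class_fun: "S \<subseteq> dual \<Longrightarrow> invol (sum_class_fun S) = sum_class_fun S"
proof -
  assume S: "S \<subseteq> dual"
  have "invol (sum_class_fun S) x = (\<Sum>D\<in>S. invol (class_fun D) x)" for x
    by (simp add: invol_def sum_class_fun_def)
  then show ?thesis
    using S by (auto simp: fun_eq_iff sum_class_fun_def invol_class_fun intro!: sum.cong)
qed

lemma sum_class_fun_central: "S \<subseteq> dual \<Longrightarrow> sum_class_fun S (x + y) = sum_class_fun S (y + x)"
  unfolding sum_class_fun_def by (intro sum.cong refl class_fun_central) auto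

lemma conv_sum_class_fun:
  assumes S: "finite S" "S \<subseteq> dual" and T: "finite T" "T \<subseteq> dual"
  shows "conv (sum_class_fun S) (sum_class_fun T) = sum_class_fun (S \<inter> T)"
proof
  fix x
  have "conv (sum_class_fun S) (sum_class_fun T) x = (\<Sum>D\<in>S. conv (class_fun D) (sum_class_fun T) x)"
    unfolding sum_class_fun_def[of S, abs_def] using S
    by (intro conv_sum_left cont_class_fun cont_sum_class_fun[OF T(2)]) auto
  also have "\<dots> = (\<Sum>D\<in>S. \<Sum>D'\<in>T. conv (class_fun D) (class_fun D') x)"
    unfolding sum_class_fun_def[of T, abs_def] using S T
    by (intro sum.cong refl conv_sum_right cont_class_fun) auto
  also have "\<dots> = (\<Sum>D\<in>S. \<Sum>D'\<in>T. if D = D' then class_fun D x else 0)"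
    using S T by (intro sum.cong refl conv_class_fun) auto
  also have "\<dots> = (\<Sum>D\<in>S. if D \<in> T then class_fun D x else 0)"
    using T(1) by simp
  also have "\<dots> = sum_class_fun (S \<inter> T) x"
    unfolding sum_class_fun_def by (rule sum.inter_restrict[OF S(1), symmetric])
  finally show "conv (sum_class_fun S) (sum_class_fun T) x = sum_class_fun (S \<inter> T) x" .
qed

text \<open>Convolution with a self-adjoint idempotent is an orthogonal projection, so this is
  Pythagoras.\<close>

lemma l2norm_diff_conv_projection:
  assumes r: "cont r" and e: "cont e" "invol e = e" "conv e e = e"
  shows "(l2norm (\<lambda>x. r x - conv r e x))\<^sup>2 = (l2norm r)\<^sup>2 - (l2norm (conv r e))\<^sup>2"
proof -
  have c: "cont (conv r e)"
    by (rule cont_conv[OF r e(1)])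
  have "ip r (conv r e) = ip (conv r e) (conv r e)"
    unfolding ip_conv_left[OF r e(1) c] e(2) conv_assoc[OF r e(1,1)] e(3) ..
  then have "Re (ip r (conv r e)) = (l2norm (conv r e))\<^sup>2"
    by (simp add: ip_self[OF c])
  then show ?thesis
    by (simp add: l2norm_square_diff[OF r c])
qed

text \<open>Along finite sets that nearly minimise the norm of the residual \<open>r S\<close>, the
  residuals are Cauchy in \<open>l2norm\<close>, but they need not have a continuous limit. Their
  autocorrelations \<open>U n\<close> do converge uniformly. The limit \<open>u\<close> is
  annihilated by all characters, hence zero, although \<open>u 0\<close> is the limit of the squared
  norms and at least \<open>\<delta> > 0\<close>.\<close>

theorem peter_weyl_l2:
  assumes k: "cont k" and "0 < \<epsilon>"
  shows "\<exists>S. finite S \<and> S \<subseteq> dual \<and> l2norm (\<lambda>x. k x - conv k (sum_class_fun S) x) < \<epsilon>"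
proof (rule ccontr)
  assume contra: "\<not> ?thesis"
  define r where "r S = (\<lambda>x. k x - conv k (sum_class_fun S) x)" for S
  define Fin where "Fin = {S. finite S \<and> S \<subseteq> (dual :: ('g \<Rightarrow> complex mat) set set)}"
  have far: "\<epsilon> \<le> l2norm (r S)" if "S \<in> Fin" for S
  proof (rule ccontr)
    assume "\<not> \<epsilon> \<le> l2norm (r S)"
    then have "finite S \<and> S \<subseteq> dual \<and> l2norm (\<lambda>x. k x - conv k (sum_class_fun S) x) < \<epsilon>"
      using that by (simp add: r_def Fin_def)
    then show False
      using contra by blast
  qed
  have cS: "cont (sum_class_fun S)" if "S \<in> Fin" for S
    using that by (intro cont_sum_class_fun) (simp add: Fin_def)
  have cr: "cont (r S)" if "S \<in> Fin" for S
    unfolding r_def by (intro continuous_on_diff k cont_conv cS that)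
  have conv_r: "conv (r S) (sum_class_fun T) x = conv k (sum_class_fun T) x - conv k (sum_class_fun (S \<inter> T)) x"
    if "S \<in> Fin" "T \<in> Fin" for S T x
  proof -
    have "conv (r S) (sum_class_fun T) x =
        conv k (sum_class_fun T) x - conv (conv k (sum_class_fun S)) (sum_class_fun T) x"
      unfolding r_def by (rule conv_diff_left[OF k cont_conv[OF k cS[OF that(1)]] cS[OF that(2)]])
    also have "conv (conv k (sum_class_fun S)) (sum_class_fun T) = conv k (sum_class_fun (S \<inter> T))"
      using that by (simp add: conv_assoc k cS conv_sum_class_fun Fin_def)
    finally show ?thesis .
  qed
  have pyth: "(l2norm (\<lambda>x. r S x - r T x))\<^sup>2 = (l2norm (r S))\<^sup>2 - (l2norm (r T))\<^sup>2"
    if "S \<in> Fin" "T \<in> Fin" "S \<subseteq> T" for S T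
  proof -
    have *: "conv (r S) (sum_class_fun T) = (\<lambda>x. r S x - r T x)"
      using conv_r[OF that(1,2)] that(3) by (simp add: fun_eq_iff r_def Int_absorb2)
    have "(\<lambda>x. r S x - conv (r S) (sum_class_fun T) x) = r T"
      unfolding * by simp
    moreover have "invol (sum_class_fun T) = sum_class_fun T" "conv (sum_class_fun T) (sum_class_fun T) = sum_class_fun T"
      using that(2) by (simp_all add: invol_sum_class_fun conv_sum_class_fun Fin_def)
    ultimately show "(l2norm (\<lambda>x. r S x - r T x))\<^sup>2 = (l2norm (r S))\<^sup>2 - (l2norm (r T))\<^sup>2"
      using l2norm_diff_conv_projection[OF cr[OF that(1)] cS[OF that(2)]] by (simp add: *)
  qed
  define \<delta> where "\<delta> = (INF S\<in>Fin. (l2norm (r S))\<^sup>2)"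
  have bdd: "bdd_below ((\<lambda>S. (l2norm (r S))\<^sup>2) ` Fin)"
    by (intro bdd_belowI[of _ 0]) auto
  have ne: "Fin \<noteq> {}"
    by (auto simp: Fin_def)
  have \<delta>_le: "\<delta> \<le> (l2norm (r S))\<^sup>2" if "S \<in> Fin" for S
    unfolding \<delta>_def using bdd that by (rule cINF_lower)
  have "\<epsilon>\<^sup>2 \<le> \<delta>"
    unfolding \<delta>_def using far \<open>0 < \<epsilon>\<close> by (intro cINF_greatest[OF ne] power_mono) auto
  then have \<delta>_pos: "0 < \<delta>"
    using \<open>0 < \<epsilon>\<close> by (smt (verit) zero_less_power)
  have "\<exists>S\<in>Fin. (l2norm (r S))\<^sup>2 < \<delta> + inverse (real (Suc n))" for n
  proof -
    have "(INF S\<in>Fin. (l2norm (r S))\<^sup>2) < \<delta> + inverse (real (Suc n))"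
      unfolding \<delta>_def[symmetric] by simp
    then show ?thesis
      using cINF_less_iff[OF ne bdd] by blast
  qed
  then obtain S where S: "\<And>n. S n \<in> Fin" "\<And>n. (l2norm (r (S n)))\<^sup>2 < \<delta> + inverse (real (Suc n))"
    by metis
  have near: "(l2norm (\<lambda>x. r (S n) x - r T x))\<^sup>2 < inverse (real (Suc n))" if "T \<in> Fin" "S n \<subseteq> T" for n T
    unfolding pyth[OF S(1) that] using S(2)[of n] \<delta>_le[OF that(1)] by linarith
  let ?s = "\<lambda>n. sqrt (inverse (real (Suc n)))"
  have near': "l2norm (\<lambda>x. r (S n) x - r T x) < ?s n" if "T \<in> Fin" "S n \<subseteq> T" for n T
    by (rule real_less_rsqrt[OF near[OF that]])
  have dist_r: "l2norm (\<lambda>x. r (S n) x - r (S m) x) \<le> ?s n + ?s m" for n m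
  proof -
    \<comment> \<open>The union mediates between two nearly minimising sets: by \<open>near'\<close>
      both residuals are close to the residual of the union.\<close>
    have T: "S n \<union> S m \<in> Fin"
      using S(1)[of n] S(1)[of m] by (simp add: Fin_def)
    then show ?thesis
      using l2norm_diff_trans[OF cr[OF S(1)[of n]] cr[OF T] cr[OF S(1)[of m]]] near'[OF T, of n] near'[OF T, of m]
      by (simp add: l2norm_minus_commute[of "r (S n \<union> S m)"])
  qed
  define C where "C = sqrt (\<delta> + 1)"
  have C: "0 < C"
    using \<delta>_pos by (simp add: C_def)
  have r_le: "l2norm (r (S n)) \<le> C" for n
  proof -
    have "inverse (real (Suc n)) \<le> 1"
      by (simp add: divide_simps)
    then show ?thesis
      unfolding C_def using S(2)[of n] by (intro real_le_rsqrt) linarith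
  qed
  define U where "U n = conv (invol (r (S n))) (r (S n))" for n
  have cU: "cont (U n)" for n
    unfolding U_def by (intro cont_conv cont_invol cr S(1))
  have dist_U: "cmod (U n x - U m x) \<le> 2 * C * (?s n + ?s m)" for n m x
  proof -
    let ?a = "r (S n)" and ?b = "r (S m)"
    have c: "cont ?a" "cont ?b" "cont (invol ?a)" "cont (invol ?b)"
      by (intro cr cont_invol S(1))+
    have "U n x - U m x = conv (\<lambda>x. invol ?a x - invol ?b x) ?a x + conv (invol ?b) (\<lambda>x. ?a x - ?b x) x"
      by (simp add: conv_diff_left conv_diff_right c U_def)
    moreover have "(\<lambda>x. invol ?a x - invol ?b x) = invol (\<lambda>x. ?a x - ?b x)"
      by (simp add: invol_def fun_eq_iff)
    ultimately have "cmod (U n x - U m x) \<le>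
        cmod (conv (invol (\<lambda>x. ?a x - ?b x)) ?a x) + cmod (conv (invol ?b) (\<lambda>x. ?a x - ?b x) x)"
      by (simp add: norm_triangle_ineq)
    also have "\<dots> \<le> l2norm (\<lambda>x. ?a x - ?b x) * l2norm ?a + l2norm ?b * l2norm (\<lambda>x. ?a x - ?b x)"
      using cmod_conv_le[of "invol (\<lambda>x. ?a x - ?b x)" ?a x] cmod_conv_le[of "invol ?b" "\<lambda>x. ?a x - ?b x" x] c
      by (simp add: l2norm_invol cont_invol continuous_on_diff)
    also have "\<dots> \<le> (?s n + ?s m) * C + C * (?s n + ?s m)"
      using c C by (intro add_mono mult_mono dist_r r_le l2norm_nonneg continuous_on_diff) auto
    finally show ?thesis
      by (simp add: algebra_simps)
  qed
  have s_lim: "?s \<longlonglongrightarrow> 0"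
    using tendsto_real_sqrt[OF LIMSEQ_inverse_real_of_nat] by simp
  have "uniformly_Cauchy_on UNIV U"
  proof (rule uniformly_Cauchy_onI)
    fix e :: real assume e: "0 < e"
    define d where "d = e / (4 * C)"
    have d: "0 < d" "2 * C * (d + d) = e"
      using e C by (simp_all add: d_def field_simps)
    obtain M where M: "\<And>n. n \<ge> M \<Longrightarrow> ?s n < d"
      using order_tendstoD(2)[OF s_lim d(1)] by (auto simp: eventually_sequentially)
    have "dist (U m x) (U n x) < e" if "M \<le> m" "M \<le> n" for m n x
    proof -
      have "2 * C * (?s m + ?s n) < 2 * C * (d + d)"
        using M[OF that(1)] M[OF that(2)] C by (intro mult_strict_left_mono add_strict_mono) auto
      then show ?thesis
        using dist_U[of m x n] d(2) unfolding dist_norm by linarith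
    qed
    then show "\<exists>M. \<forall>x\<in>UNIV. \<forall>m\<ge>M. \<forall>n\<ge>M. dist (U m x) (U n x) < e"
      by blast
  qed
  then obtain u where unif: "uniform_limit UNIV U u sequentially"
    using Cauchy_uniformly_convergent unfolding uniformly_convergent_on_def by blast
  have cu: "cont u"
    using uniform_limit_theorem[OF _ unif] cU by simp
  have lim: "(\<lambda>n. U n x) \<longlonglongrightarrow> u x" for x
    using tendsto_uniform_limitI[OF unif] by simp
  have invol_u: "invol u = u"
  proof
    fix x
    have "invol (U n) = U n" for n
      unfolding U_def by (simp add: invol_conv cr S(1) cont_invol)
    moreover have "(\<lambda>n. invol (U n) x) \<longlonglongrightarrow> invol u x"
      unfolding invol_def by (intro tendsto_cnj lim)
    ultimately have "(\<lambda>n. U n x) \<longlonglongrightarrow> invol u x"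
      by simp
    then show "invol u x = u x"
      using lim by (rule LIMSEQ_unique)
  qed
  have "conv u (class_fun D) = (\<lambda>_. 0)" if D: "D \<in> dual" for D
  proof
    fix x
    note cD = cont_class_fun[OF D]
    \<comment> \<open>If \<open>D\<close> belongs to \<open>S n\<close>, the residual has no
      component in \<open>D\<close>. Otherwise its component is exactly the change of the residual
      when \<open>D\<close> is added to \<open>S n\<close>, which near-minimality makes
      small.\<close>
    have small: "l2norm (conv (r (S n)) (class_fun D)) \<le> ?s n" for n
    proof -
      let ?T = "insert D (S n)"
      have Fin: "?T \<in> Fin" "{D} \<in> Fin" "S n \<in> Fin"
        using D S(1)[of n] by (auto simp: Fin_def)
      show ?thesis
      proof (cases "D \<in> S n")
        case True
        then have "S n \<inter> {D} = {D}"
          by auto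
        then have "conv (r (S n)) (class_fun D) x = 0" for x
          using conv_r[OF Fin(3,2), of x] by (simp add: sum_class_fun_singleton)
        then have "conv (r (S n)) (class_fun D) = (\<lambda>_. 0)"
          by (rule ext)
        then show ?thesis
          by (simp add: l2norm_def ip_def avg_const)
      next
        case False
        then have "S n \<inter> {D} = {}"
          by auto
        moreover have "sum_class_fun {} = (\<lambda>_. 0)"
          by (rule ext) (simp add: sum_class_fun_def)
        ultimately have 1: "conv (r (S n)) (class_fun D) x = conv k (class_fun D) x" for x
          using conv_r[OF Fin(3,2), of x] by (simp add: sum_class_fun_singleton conv_zero_right)
        have "class_fun D = (\<lambda>x. sum_class_fun ?T x - sum_class_fun (S n) x)"
          using False Fin(3) by (simp add: sum_class_fun_def Fin_def)
        then have 2: "conv k (class_fun D) x = conv k (sum_class_fun ?T) x - conv k (sum_class_fun (S n)) x" for x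
          using conv_diff_right[OF cS[OF Fin(1)] cS[OF Fin(3)] k] by simp
        have "r (S n) x - r ?T x = conv k (sum_class_fun ?T) x - conv k (sum_class_fun (S n)) x" for x
          by (simp add: r_def)
        then have "conv (r (S n)) (class_fun D) = (\<lambda>x. r (S n) x - r ?T x)"
          using 1 2 by (intro ext) simp
        then show ?thesis
          using less_imp_le[OF near'[OF Fin(1) subset_insertI]] by simp
      qed
    qed
    have bound: "cmod (conv (U n) (class_fun D) x) \<le> C * ?s n" for n
    proof -
      have c: "cont (r (S n))" "cont (invol (r (S n)))"
        by (intro cr cont_invol S(1))+
      have "cmod (conv (U n) (class_fun D) x) \<le> l2norm (invol (r (S n))) * l2norm (conv (r (S n)) (class_fun D))"
        unfolding U_def conv_assoc[OF c(2,1) cD] by (intro cmod_conv_le c cont_conv cD)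
      also have "\<dots> \<le> C * ?s n"
        unfolding l2norm_invol[OF c(1)] using C by (intro mult_mono r_le small l2norm_nonneg cont_conv c cD) auto
      finally show ?thesis .
    qed
    have "(\<lambda>n. conv (U n) (class_fun D) x) \<longlonglongrightarrow> 0"
    proof (rule Lim_null_comparison[of _ "\<lambda>n. C * ?s n"])
      show "(\<lambda>n. C * ?s n) \<longlonglongrightarrow> 0"
        using tendsto_mult[OF tendsto_const s_lim, of C] by simp
    qed (use bound in simp)
    then show "conv u (class_fun D) x = 0"
      by (rule LIMSEQ_unique[OF conv_tendsto(1)[OF unif cU cu cD]])
  qed
  then have "u 0 = 0"
    using eq_zero_if_conv_class_fun_zero[OF cu invol_u] by blast
  then have "(\<lambda>n. Re (U n 0)) \<longlonglongrightarrow> 0"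
    using tendsto_Re[OF lim[of 0]] by simp
  moreover have "\<delta> \<le> Re (U n 0)" for n
  proof -
    have c: "cont (invol (r (S n)))"
      by (intro cont_invol cr S(1))
    have "U n 0 = ip (invol (r (S n))) (invol (r (S n)))"
      by (simp add: U_def ip_eq_conv)
    then have "Re (U n 0) = (l2norm (r (S n)))\<^sup>2"
      by (simp add: ip_self[OF c] l2norm_invol cr S(1))
    then show ?thesis
      using \<delta>_le[OF S(1)] by simp
  qed
  ultimately have "\<delta> \<le> 0"
    by (intro LIMSEQ_le_const) auto
  then show False
    using \<delta>_pos by simp
qed

end

section \<open>Spectral decomposition in Hilbert C*-systems\<close>

text \<open>Any bound on the norm can serve as the constant \<open>t\<close> in \<open>pos\<close>,
  so a family of positive elements with a common bound shares one constant.\<close>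

lemma norm_of_real_minus_pos_le:
  fixes h :: "'a::cstar_algebra"
  assumes "pos h" "norm h \<le> t"
  shows "norm (of_real t - h) \<le> t"
proof (rule pos_norm_le)
  show "pos (of_real t - h)"
    by (rule pos_of_real_minus[OF pos_star[OF assms(1)] assms(2)])
  show "pos (of_real t - (of_real t - h))"
    using assms(1) by simp
qed

context hilbert_cstar_system
begin

sublocale compact_group \<mu>
  by unfold_locales (fact compact_group haar)+

lemma bounded_linear_action: "bounded_linear (\<alpha> g)"
  by (rule star_automorphism_bounded_linear[OF automorphism])

lemma action_diff: "\<alpha> g (x - y) = \<alpha> g x - \<alpha> g y"
  by (rule linear_diff[OF bounded_linear.linear[OF bounded_linear_action]])

lemma action_scaleC: "\<alpha> g (c *\<^sub>C x) = c *\<^sub>C \<alpha> g x"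
  and action_mult: "\<alpha> g (x * y) = \<alpha> g x * \<alpha> g y"
  and action_star: "\<alpha> g (star x) = star (\<alpha> g x)"
  using automorphism[of g] by (simp_all add: star_automorphism_def)

lemma norm_action_le: "norm (\<alpha> g x) \<le> norm x"
  by (rule star_automorphism_norm_le[OF automorphism])

lemma action_add: "\<alpha> (g + h) x = \<alpha> g (\<alpha> h x)"
  by (simp add: hom)

lemma action_zero: "\<alpha> 0 x = x"
proof -
  have "\<alpha> 0 (\<alpha> 0 x) = \<alpha> 0 x"
    using action_add[of 0 0 x] by simp
  then show ?thesis
    using automorphism[of 0] by (simp add: star_automorphism_def bij_def inj_eq)
qed

lemma cont_action: "cont (\<lambda>g. \<alpha> g F)"
  by (rule pointwise_continuous)

text \<open>The integrated form of the action. It turns \<open>conv\<close> into composition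
  (\<open>act_act\<close>), so identities between spectral projections reduce to identities between
  functions on the group.\<close>

definition act :: "('g \<Rightarrow> complex) \<Rightarrow> 'f \<Rightarrow> 'f" where
  "act f F = avg (\<lambda>g. f g *\<^sub>C \<alpha> g F)"

lemma cont_act: "cont f \<Longrightarrow> cont (\<lambda>g. f g *\<^sub>C \<alpha> g F)"
  by (intro continuous_on_scaleC cont_action)

lemma spectral_proj_eq_act: "spectral_proj \<mu> \<alpha> D F = act (class_fun D) F"
  by (simp add: spectral_proj_def act_def class_fun_def)

lemma act_diff: "cont f \<Longrightarrow> act f (F - G) = act f F - act f G"
  unfolding act_def action_diff complex_vector.scale_right_diff_distrib
  by (intro avg_diff cont_act)

lemma act_diff_fun: "cont f \<Longrightarrow> cont h \<Longrightarrow> act (\<lambda>g. f g - h g) F = act f F - act h F"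
  unfolding act_def complex_vector.scale_left_diff_distrib
  by (intro avg_diff cont_act)

lemma act_sum_fun:
  assumes "\<And>i. i \<in> A \<Longrightarrow> cont (f i)"
  shows "act (\<lambda>g. \<Sum>i\<in>A. f i g) F = (\<Sum>i\<in>A. act (f i) F)"
  unfolding act_def complex_vector.scale_sum_left by (intro avg_sum cont_act assms)

text \<open>The bound is stated with \<open>l2norm\<close> rather than with the mean of
  \<open>cmod (f g)\<close> because this is the norm of the Peter-Weyl approximation.\<close>

lemma norm_act_le:
  assumes f: "cont f"
  shows "norm (act f F) \<le> l2norm f * norm F"
proof -
  have "norm (act f F) \<le> avg (\<lambda>g. norm (f g *\<^sub>C \<alpha> g F))"
    unfolding act_def by (rule norm_avg_le[OF cont_act[OF f]])
  also have "\<dots> \<le> avg (\<lambda>g. cmod (f g) * norm F)"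
    by (intro avg_mono continuous_on_norm cont_act f continuous_on_mult_right)
      (simp add: norm_scaleC mult_left_mono norm_action_le)
  also have "\<dots> = avg (\<lambda>g. cmod (f g)) * norm F"
    by (intro avg_mult_right continuous_on_norm f)
  also have "\<dots> \<le> l2norm f * norm F"
    by (intro mult_right_mono avg_cmod_le_l2norm f) simp
  finally show ?thesis .
qed

lemma act_act:
  assumes f: "cont f" and h: "cont h"
  shows "act f (act h F) = act (conv f h) F"
proof -
  have joint: "cont (\<lambda>z. (f (fst z) * h (- fst z + snd z)) *\<^sub>C \<alpha> (snd z) F)"
    by (intro continuous_on_scaleC continuous_on_mult cont_compose[OF f] cont_compose[OF h]
        cont_compose[OF cont_action] continuous_intros)
  have "f g *\<^sub>C \<alpha> g (act h F) = avg (\<lambda>k. (f g * h (- g + k)) *\<^sub>C \<alpha> k F)" for g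
  proof -
    have c: "cont (\<lambda>k. h k *\<^sub>C \<alpha> (g + k) F)"
      by (intro continuous_on_scaleC h cont_compose[OF cont_action] continuous_intros)
    have c': "cont (\<lambda>k. (f g * h (- g + k)) *\<^sub>C \<alpha> k F)"
      by (intro continuous_on_scaleC continuous_on_mult_left cont_compose[OF h] cont_action continuous_intros)
    have "\<alpha> g (act h F) = avg (\<lambda>k. h k *\<^sub>C \<alpha> (g + k) F)"
      unfolding act_def avg_linear[OF bounded_linear_action cont_act[OF h], symmetric]
      by (simp add: action_scaleC action_add)
    then have "f g *\<^sub>C \<alpha> g (act h F) = avg (\<lambda>k. f g *\<^sub>C h k *\<^sub>C \<alpha> (g + k) F)"
      by (simp only: avg_linear[OF bounded_bilinear.bounded_linear_right[OF bounded_bilinear_scaleC] c])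
    also have "\<dots> = avg (\<lambda>k. (f g * h (- g + k)) *\<^sub>C \<alpha> k F)"
      using avg_translate[OF c', of g] by (simp add: scaleC_scaleC add.assoc[symmetric])
    finally show ?thesis .
  qed
  then have "act f (act h F) = avg (\<lambda>g. avg (\<lambda>k. (f g * h (- g + k)) *\<^sub>C \<alpha> k F))"
    by (simp add: act_def)
  also have "\<dots> = avg (\<lambda>k. avg (\<lambda>g. (f g * h (- g + k)) *\<^sub>C \<alpha> k F))"
    by (rule avg_swap[OF joint])
  also have "\<dots> = act (conv f h) F"
  proof -
    have c: "cont (\<lambda>g. f g * h (- g + k))" for k
      by (intro continuous_on_mult f cont_reflect[OF h])
    show ?thesis
      unfolding act_def conv_def avg_linear[OF bounded_bilinear.bounded_linear_left[OF bounded_bilinear_scaleC] c] ..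
  qed
  finally show ?thesis .
qed

section \<open>The invariant mean and the scalar product with values in the fixed point
  algebra\<close>

definition cond_exp :: "'f \<Rightarrow> 'f" where
  "cond_exp F = avg (\<lambda>g. \<alpha> g F)"

abbreviation "inner_A \<equiv> A_inner \<mu> \<alpha>"
abbreviation "norm_A \<equiv> A_norm \<mu> \<alpha>"
abbreviation "spec \<equiv> spectral_proj \<mu> \<alpha>"

lemma A_inner_eq: "inner_A F G = cond_exp (F * star G)"
  by (simp add: A_inner_def spectral_proj_def char_class_trivial cond_exp_def)

lemma cond_exp_diff: "cond_exp (F - G) = cond_exp F - cond_exp G"
  unfolding cond_exp_def action_diff by (intro avg_diff cont_action)

lemma norm_cond_exp_le: "norm (cond_exp F) \<le> norm F"
  unfolding cond_exp_def by (intro norm_avg_le_const cont_action norm_action_le)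

lemma bounded_linear_cond_exp: "bounded_linear cond_exp"
proof (rule bounded_linear_intro[of _ 1])
  show "cond_exp (x + y) = cond_exp x + cond_exp y" for x y
    using cond_exp_diff[of "x + y" y] by simp
  show "cond_exp (r *\<^sub>R x) = r *\<^sub>R cond_exp x" for r x
    unfolding cond_exp_def
    by (simp add: avg_linear[OF bounded_linear_scaleR_right cont_action] linear_scale[OF bounded_linear.linear[OF bounded_linear_action]])
qed (simp add: norm_cond_exp_le)

lemma cond_exp_scaleC: "cond_exp (c *\<^sub>C x) = c *\<^sub>C cond_exp x"
  unfolding cond_exp_def action_scaleC
  by (rule avg_linear[OF bounded_bilinear.bounded_linear_right[OF bounded_bilinear_scaleC] cont_action])

lemma cond_exp_action: "cond_exp (\<alpha> h F) = cond_exp F"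
  unfolding cond_exp_def action_add[symmetric] by (rule avg_translate_right[OF cont_action])

text \<open>The elements \<open>\<alpha> g (F * star F)\<close> are positive with norm at most that
  of \<open>F * star F\<close>, so the inequality in \<open>pos\<close> holds for all
  \<open>g\<close> with the same \<open>t\<close> and survives averaging.\<close>

lemma pos_A_inner: "pos (inner_A F F)"
proof -
  let ?h = "F * star F"
  let ?t = "norm ?h"
  have h: "pos (\<alpha> g ?h)" for g
    unfolding action_mult action_star by (rule pos_mult_star_self)
  have "norm (of_real ?t - cond_exp ?h) = norm (avg (\<lambda>_. of_real ?t) - avg (\<lambda>g. \<alpha> g ?h))"
    by (simp add: cond_exp_def avg_const)
  also have "\<dots> \<le> ?t"
    by (intro norm_avg_diff_le continuous_on_const cont_action norm_of_real_minus_pos_le h norm_action_le)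
  finally have "norm (of_real ?t - cond_exp ?h) \<le> ?t" .
  moreover have "star (cond_exp ?h) = cond_exp ?h"
    unfolding cond_exp_def avg_linear[OF bounded_linear_star cont_action, symmetric] pos_star[OF h] ..
  ultimately show ?thesis
    unfolding A_inner_eq pos_def by blast
qed

lemma A_inner_diff_left: "inner_A (F - G) H = inner_A F H - inner_A G H"
  by (simp add: A_inner_eq left_diff_distrib cond_exp_diff)

lemma A_inner_diff_right: "inner_A H (F - G) = inner_A H F - inner_A H G"
  by (simp add: A_inner_eq star_diff right_diff_distrib cond_exp_diff)

lemma A_inner_sum_left: "inner_A (\<Sum>i\<in>I. F i) H = (\<Sum>i\<in>I. inner_A (F i) H)"
  unfolding A_inner_eq sum_distrib_right by (rule linear_sum[OF bounded_linear.linear[OF bounded_linear_cond_exp]])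

lemma norm_A_inner_le: "norm (inner_A F F) \<le> (norm F)\<^sup>2"
  unfolding A_inner_eq norm_mult_star_self[symmetric] by (rule norm_cond_exp_le)

text \<open>Invariance of \<open>cond_exp\<close> moves \<open>\<alpha> g\<close> from the left
  argument to the right one as \<open>\<alpha> (- g)\<close>; replacing \<open>g\<close> by its
  inverse under the average then turns \<open>f\<close> into \<open>invol f\<close>.\<close>

lemma A_inner_act_left:
  assumes f: "cont f"
  shows "inner_A (act f F) G = inner_A F (act (invol f) G)"
proof -
  have c1: "cont (\<lambda>g. (f g *\<^sub>C \<alpha> g F) * star G)"
    by (intro continuous_on_mult_right cont_act f)
  have shift: "cond_exp (\<alpha> g F * star G) = cond_exp (F * star (\<alpha> (- g) G))" for g
  proof -
    have "\<alpha> g (F * star (\<alpha> (- g) G)) = \<alpha> g F * star G"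
      by (simp add: action_mult action_star action_zero flip: action_add)
    then show ?thesis
      using cond_exp_action[of g "F * star (\<alpha> (- g) G)"] by simp
  qed
  have c2: "cont (\<lambda>g. f (- g) *\<^sub>C cond_exp (F * star (\<alpha> g G)))"
    by (intro continuous_on_scaleC cont_compose[OF f] bounded_linear.continuous_on[OF bounded_linear_cond_exp]
        continuous_on_mult_left continuous_on_star cont_action continuous_intros)
  have c3: "cont (\<lambda>g. invol f g *\<^sub>C \<alpha> g G)"
    by (intro cont_act cont_invol f)
  have c4: "cont (\<lambda>g. star (invol f g *\<^sub>C \<alpha> g G))"
    by (intro continuous_on_star c3)
  have c5: "cont (\<lambda>g. F * star (invol f g *\<^sub>C \<alpha> g G))"
    by (intro continuous_on_mult_left c4)
  have "inner_A (act f F) G = cond_exp (avg (\<lambda>g. (f g *\<^sub>C \<alpha> g F) * star G))"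
    unfolding A_inner_eq act_def avg_mult_right[OF cont_act[OF f]] ..
  also have "\<dots> = avg (\<lambda>g. f g *\<^sub>C cond_exp (\<alpha> g F * star G))"
    unfolding avg_linear[OF bounded_linear_cond_exp c1, symmetric] by (simp add: mult_scaleC_left cond_exp_scaleC)
  also have "\<dots> = avg (\<lambda>g. f (- g) *\<^sub>C cond_exp (F * star (\<alpha> g G)))"
    unfolding shift using avg_uminus[OF c2] by simp
  also have "\<dots> = avg (\<lambda>g. cond_exp (F * star (invol f g *\<^sub>C \<alpha> g G)))"
    by (simp add: star_scaleC mult_scaleC_right cond_exp_scaleC invol_def)
  also have "\<dots> = inner_A F (act (invol f) G)"
    unfolding A_inner_eq act_def avg_linear[OF bounded_linear_cond_exp c5] avg_mult_left[OF c4]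
      avg_linear[OF bounded_linear_star c3] ..
  finally show ?thesis .
qed

section \<open>Finite partial sums as orthogonal projections\<close>

abbreviation proj :: "('g \<Rightarrow> complex mat) set set \<Rightarrow> 'f \<Rightarrow> 'f" where
  "proj S F \<equiv> \<Sum>D\<in>S. spec D F"

lemma proj_eq_act: "S \<subseteq> dual \<Longrightarrow> proj S F = act (sum_class_fun S) F"
  unfolding spectral_proj_eq_act sum_class_fun_def[abs_def]
  by (intro act_sum_fun[symmetric] cont_class_fun) auto

lemma A_inner_proj:
  assumes S: "finite S" "S \<subseteq> dual"
  shows "inner_A (proj S F) (proj S G) = inner_A (proj S F) G"
    and "inner_A (proj S F) G = inner_A F (proj S G)"
proof -
  note c = cont_sum_class_fun[OF S(2)]
  have idem: "act (sum_class_fun S) (act (sum_class_fun S) F) = act (sum_class_fun S) F"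
    unfolding act_act[OF c c] conv_sum_class_fun[OF S S] by simp
  have sym: "inner_A (proj S F) G = inner_A F (proj S G)" for F G
    unfolding proj_eq_act[OF S(2)] A_inner_act_left[OF c] invol_sum_class_fun[OF S(2)] ..
  show "inner_A (proj S F) G = inner_A F (proj S G)"
    by (rule sym)
  show "inner_A (proj S F) (proj S G) = inner_A (proj S F) G"
    unfolding sym[of "proj S F" G, symmetric] unfolding proj_eq_act[OF S(2)] idem ..
qed

text \<open>Both sides equal \<open>inner_A (proj S F) F\<close>: the projection identity is applied
  once to \<open>S\<close> and once to each singleton, so mixed terms never have to be
  computed.\<close>

lemma sum_A_inner_spectral_proj:
  assumes S: "finite S" "S \<subseteq> dual"
  shows "(\<Sum>D\<in>S. inner_A (spec D F) (spec D F)) =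
    inner_A (proj S F) (proj S F)"
proof -
  have "inner_A (proj S F) (proj S F) = (\<Sum>D\<in>S. inner_A (spec D F) F)"
    unfolding A_inner_proj(1)[OF S] by (rule A_inner_sum_left)
  also have "\<dots> = (\<Sum>D\<in>S. inner_A (spec D F) (spec D F))"
    using S A_inner_proj(1)[of "{D}" F F for D] by (intro sum.cong refl) auto
  finally show ?thesis ..
qed

lemma A_inner_pythagoras:
  assumes S: "finite S" "S \<subseteq> dual"
  shows "inner_A F F = inner_A (F - proj S F) (F - proj S F) + inner_A (proj S F) (proj S F)"
  unfolding A_inner_diff_left A_inner_diff_right A_inner_proj(1)[OF S, of F F] A_inner_proj(2)[OF S, of F F]
  by simp

lemma norm_A_inner_diff_proj_le:
  assumes S: "finite S" "S \<subseteq> dual"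
  shows "norm (inner_A (F - proj S F) (F - proj S F)) \<le> (norm F)\<^sup>2"
proof -
  have "norm (inner_A (F - proj S F) (F - proj S F)) \<le>
      norm (inner_A (F - proj S F) (F - proj S F) + inner_A (proj S F) (proj S F))"
    by (rule norm_le_norm_add[OF pos_A_inner pos_A_inner])
  also have "\<dots> \<le> (norm F)\<^sup>2"
    unfolding A_inner_pythagoras[OF S, symmetric] by (rule norm_A_inner_le)
  finally show ?thesis .
qed

text \<open>The weight \<open>k\<close> is supported where \<open>\<alpha> g F\<close> is close to \<open>F\<close>.\<close>

lemma exists_approximate_unit:
  assumes "0 < \<epsilon>"
  obtains k where "cont k" "norm (act k F - F) \<le> \<epsilon>"
proof -
  define \<phi> where "\<phi> g = max 0 (\<epsilon> - norm (\<alpha> g F - F))" for g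
  have c\<phi>: "cont \<phi>"
    unfolding \<phi>_def
    by (intro continuous_on_max continuous_on_diff continuous_on_norm continuous_on_const cont_action)
  \<comment> \<open>\<open>\<phi>\<close> takes the value \<open>\<epsilon>\<close> at 0, so its
    average is positive and the weight can be normalised to total mass 1.\<close>
  define c where "c = avg \<phi>"
  have c: "0 < c"
    unfolding c_def by (rule avg_pos[OF c\<phi>, of 0]) (simp_all add: \<phi>_def action_zero assms)
  define k where "k g = complex_of_real (\<phi> g / c)" for g
  have cr: "cont (\<lambda>g. \<phi> g / c)"
    by (intro continuous_on_divide c\<phi> continuous_on_const) (use c in simp)
  have ck: "cont k"
    unfolding k_def by (intro continuous_on_of_real cr)
  have one: "avg (\<lambda>g. \<phi> g / c) = 1"
    using avg_mult_right[OF c\<phi>, of "1 / c"] c by (simp add: c_def[symmetric])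
  have "avg (\<lambda>g. k g *\<^sub>C F) = avg k *\<^sub>C F"
    by (rule avg_linear[OF bounded_bilinear.bounded_linear_left[OF bounded_bilinear_scaleC] ck])
  also have "avg k = 1"
    unfolding k_def avg_linear[OF bounded_linear_of_real cr] one by simp
  finally have F: "avg (\<lambda>g. k g *\<^sub>C F) = F"
    by simp
  have cF: "cont (\<lambda>g. k g *\<^sub>C F)" and cd: "cont (\<lambda>g. k g *\<^sub>C (\<alpha> g F - F))"
    by (intro continuous_on_scaleC ck continuous_on_diff cont_action continuous_on_const)+
  have "act k F - F = avg (\<lambda>g. k g *\<^sub>C (\<alpha> g F - F))"
    unfolding complex_vector.scale_right_diff_distrib avg_diff[OF cont_act[OF ck] cF] F act_def ..
  then have "norm (act k F - F) \<le> avg (\<lambda>g. norm (k g *\<^sub>C (\<alpha> g F - F)))"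
    using norm_avg_le[OF cd] by simp
  also have "\<dots> \<le> avg (\<lambda>g. \<phi> g / c * \<epsilon>)"
  proof (rule avg_mono)
    show "norm (k g *\<^sub>C (\<alpha> g F - F)) \<le> \<phi> g / c * \<epsilon>" for g
    proof -
      have nonneg: "0 \<le> \<phi> g / c" and near: "\<phi> g = 0 \<or> norm (\<alpha> g F - F) \<le> \<epsilon>"
        using c by (auto simp: \<phi>_def)
      have eq: "norm (k g *\<^sub>C (\<alpha> g F - F)) = \<phi> g / c * norm (\<alpha> g F - F)"
        by (simp only: norm_scaleC k_def norm_of_real abs_of_nonneg[OF nonneg])
      show ?thesis
      proof (cases "\<phi> g = 0")
        case False
        then show ?thesis
          unfolding eq using near by (intro mult_left_mono nonneg) simp
      qed (simp add: eq)
    qed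
  qed (intro continuous_on_norm cd continuous_on_mult_right cr)+
  also have "\<dots> = \<epsilon>"
    using avg_mult_right[OF cr, of \<epsilon>] one by simp
  finally show ?thesis
    using ck that by blast
qed

text \<open>The approximant \<open>G\<close> has components only in \<open>S\<^sub>0\<close>, so
  \<open>proj S\<close> fixes it for every larger \<open>S\<close>, and \<open>F - proj S F\<close>
  equals the corresponding difference for the small element \<open>F - G\<close>. The contraction
  bound does not depend on \<open>S\<close>.\<close>

lemma proj_approximation:
  assumes "0 < \<epsilon>"
  obtains S\<^sub>0 where "finite S\<^sub>0" "S\<^sub>0 \<subseteq> dual"
    "\<And>S. finite S \<Longrightarrow> S\<^sub>0 \<subseteq> S \<Longrightarrow> S \<subseteq> dual \<Longrightarrow>
      norm (inner_A (F - proj S F) (F - proj S F)) \<le> \<epsilon>\<^sup>2"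
proof -
  obtain k where k: "cont k" "norm (act k F - F) \<le> \<epsilon> / 2"
    using exists_approximate_unit[OF half_gt_zero[OF assms]] .
  \<comment> \<open>The summand 1 avoids division by zero when \<open>F = 0\<close>.\<close>
  define B where "B = norm F + 1"
  have B: "0 < B" "norm F \<le> B"
    using norm_ge_zero[of F] unfolding B_def by linarith+
  have "0 < \<epsilon> / 2 / B"
    using assms B by simp
  then obtain S\<^sub>0 where S0: "finite S\<^sub>0" "S\<^sub>0 \<subseteq> dual"
      "l2norm (\<lambda>x. k x - conv k (sum_class_fun S\<^sub>0) x) < \<epsilon> / 2 / B"
    using peter_weyl_l2[OF k(1)] by blast
  note c0 = cont_sum_class_fun[OF S0(2)]
  note ck0 = cont_conv[OF k(1) c0]
  define G where "G = act (conv k (sum_class_fun S\<^sub>0)) F"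
  have "norm (act k F - G) \<le> l2norm (\<lambda>x. k x - conv k (sum_class_fun S\<^sub>0) x) * norm F"
    unfolding G_def act_diff_fun[OF k(1) ck0, symmetric] by (intro norm_act_le continuous_on_diff k(1) ck0)
  also have "\<dots> \<le> \<epsilon> / 2 / B * B"
    using S0(3) B assms by (intro mult_mono) auto
  also have "\<dots> = \<epsilon> / 2"
    using B by simp
  finally have FG: "norm (F - G) \<le> \<epsilon>"
    using k(2) norm_triangle_ineq4[of "act k F - G" "act k F - F"] by simp
  show ?thesis
  proof (rule that[OF S0(1,2)])
    fix S assume S: "finite S" "S\<^sub>0 \<subseteq> S" "S \<subseteq> (dual :: ('g \<Rightarrow> complex mat) set set)"
    note c = cont_sum_class_fun[OF S(3)]
    \<comment> \<open>The central function \<open>sum_class_fun S\<close> is moved past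
      \<open>k\<close> to meet \<open>sum_class_fun S\<^sub>0\<close>, which absorbs it because
      \<open>S\<^sub>0\<close> is contained in \<open>S\<close>.\<close>
    have "conv (sum_class_fun S) (conv k (sum_class_fun S\<^sub>0)) = conv (conv (sum_class_fun S) k) (sum_class_fun S\<^sub>0)"
      by (rule conv_assoc[OF c k(1) c0, symmetric])
    also have "conv (sum_class_fun S) k = conv k (sum_class_fun S)"
      by (rule conv_commute[OF k(1) c sum_class_fun_central[OF S(3)]])
    also have "conv (conv k (sum_class_fun S)) (sum_class_fun S\<^sub>0) = conv k (sum_class_fun S\<^sub>0)"
      unfolding conv_assoc[OF k(1) c c0] conv_sum_class_fun[OF S(1,3) S0(1,2)] using S(2) by (simp add: Int_absorb1)
    finally have "proj S G = G"
      unfolding proj_eq_act[OF S(3)] G_def act_act[OF c ck0] by simp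
    then have eq: "F - proj S F = (F - G) - proj S (F - G)"
      unfolding proj_eq_act[OF S(3)] act_diff[OF c] by simp
    have "norm (inner_A (F - proj S F) (F - proj S F)) \<le> (norm (F - G))\<^sup>2"
      unfolding eq by (rule norm_A_inner_diff_proj_le[OF S(1,3)])
    also have "\<dots> \<le> \<epsilon>\<^sup>2"
      by (rule power_mono[OF FG]) simp
    finally show "norm (inner_A (F - proj S F) (F - proj S F)) \<le> \<epsilon>\<^sup>2" .
  qed
qed

lemma A_norm_convergence:
  "((\<lambda>S. norm_A (F - proj S F)) \<longlongrightarrow> 0) (finite_subsets_at_top dual)"
proof (rule tendstoI)
  fix e :: real assume e: "0 < e"
  obtain S\<^sub>0 where S0: "finite S\<^sub>0" "S\<^sub>0 \<subseteq> dual"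
      "\<And>S. finite S \<Longrightarrow> S\<^sub>0 \<subseteq> S \<Longrightarrow> S \<subseteq> dual \<Longrightarrow>
        norm (inner_A (F - proj S F) (F - proj S F)) \<le> (e / 2)\<^sup>2"
    using proj_approximation[OF half_gt_zero[OF e]] by metis
  have "dist (norm_A (F - proj S F)) 0 < e" if "finite S" "S\<^sub>0 \<subseteq> S" "S \<subseteq> dual" for S
  proof -
    have "norm_A (F - proj S F) \<le> e / 2"
      unfolding A_norm_def using S0(3)[OF that] e by (intro real_le_lsqrt) auto
    moreover have "0 \<le> norm_A (F - proj S F)"
      by (simp add: A_norm_def)
    ultimately show ?thesis
      using e by simp
  qed
  then show "\<forall>\<^sub>F S in finite_subsets_at_top dual. dist (norm_A (F - proj S F)) 0 < e"
    unfolding eventually_finite_subsets_at_top using S0(1,2) by blast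
qed

text \<open>By Pythagoras the remainder of a partial sum is exactly \<open>inner_A\<close> of
  \<open>F - proj S F\<close> with itself, so the estimate behind the first limit applies here
  too.\<close>

lemma parseval:
  "((\<lambda>D. inner_A (spec D F) (spec D F)) has_sum inner_A F F) dual"
  unfolding has_sum_def
proof (rule tendstoI)
  let ?a = "\<lambda>D. inner_A (spec D F) (spec D F)"
  fix e :: real assume e: "0 < e"
  \<comment> \<open>The remainder is quadratic in the error, hence the square root; the half gives
    the strict inequality.\<close>
  define d where "d = sqrt (e / 2)"
  have d: "0 < d" "d\<^sup>2 < e"
    using e by (simp_all add: d_def)
  obtain S\<^sub>0 where S0: "finite S\<^sub>0" "S\<^sub>0 \<subseteq> dual"
      "\<And>S. finite S \<Longrightarrow> S\<^sub>0 \<subseteq> S \<Longrightarrow> S \<subseteq> dual \<Longrightarrow>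
        norm (inner_A (F - proj S F) (F - proj S F)) \<le> d\<^sup>2"
    using proj_approximation[OF d(1)] by metis
  have "dist (sum ?a S) (inner_A F F) < e" if "finite S" "S\<^sub>0 \<subseteq> S" "S \<subseteq> dual" for S
  proof -
    have "inner_A F F - sum ?a S = inner_A (F - proj S F) (F - proj S F)"
      unfolding sum_A_inner_spectral_proj[OF that(1,3)] using A_inner_pythagoras[OF that(1,3), of F] by simp
    then show ?thesis
      using S0(3)[OF that] d(2) by (simp add: dist_norm norm_minus_commute)
  qed
  then show "\<forall>\<^sub>F S in finite_subsets_at_top dual. dist (sum ?a S) (inner_A F F) < e"
    unfolding eventually_finite_subsets_at_top using S0(1,2) by blast
qed

end

theorem proposition2p5:
  fixes \<mu> :: "'g::{topological_group_add, t2_space} measure"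
    and \<alpha> :: "'g \<Rightarrow> 'f \<Rightarrow> 'f::cstar_algebra"
    and F :: 'f
  assumes "hilbert_cstar_system \<mu> \<alpha>"
  shows "((\<lambda>S. A_norm \<mu> \<alpha> (F - (\<Sum>D\<in>S. spectral_proj \<mu> \<alpha> D F))) \<longlongrightarrow> 0)
           (finite_subsets_at_top dual) \<and>
         ((\<lambda>D. A_inner \<mu> \<alpha> (spectral_proj \<mu> \<alpha> D F) (spectral_proj \<mu> \<alpha> D F))
           has_sum A_inner \<mu> \<alpha> F F) dual"
  by (intro conjI hilbert_cstar_system.A_norm_convergence[OF assms] hilbert_cstar_system.parseval[OF assms])

end
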